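(* Let $E=E_0\oplus E_1\to M$ be a supervector bundle over a smooth manifold $M$. For any graded connection $\boldsymbol{\nabla}$ on the graded vector bundle $\mathcal{L}=\Omega(M)\otimes\Gamma(E)$ over $(M,\Omega(M))$, the curvature of the associated Quillen superconnection $D^{\boldsymbol{\nabla}}$ and the graded curvature of $\boldsymbol{\nabla}$ are related by $$R^{D^{\boldsymbol{\nabla}}}=\frac{1}{2}R^{\boldsymbol{\nabla}}(\mathrm{d},\mathrm{d}),$$ where $\mathrm{d}$ is the exterior differential of $M$, regarded as an element of $\mathrm{Der}\,\Omega(M)$.
   Context: The ground field is $\mathbb{R}$. $\Omega(M)=\Gamma(\Lambda T^*M)$ is the algebra of differential forms on $M$, with exterior differential $\mathrm{d}$. $\mathrm{Der}\,\Omega(M)$ is the $\Omega(M)$-module of graded derivations of $\Omega(M)$: spanned by homogeneous $\mathbb{R}$-linear maps $\delta$ with $\delta(\alpha\beta)=\delta(\alpha)\beta+(-1)^{|\alpha||\delta|}\alpha\,\delta(\beta)$; its bracket is $[\delta,\delta']=\delta\delta'-(-1)^{|\delta||\delta'|}\delta'\delta$. The Cartan-Koszul supermanifold $(M,\Omega(M))$ has $\Omega(M)$ as its (sheaf of) superfunctions. A supervector bundle $E=E_0\oplus E_1\to M$ is a $\mathbb{Z}_2$-graded real vector bundle. $\Omega(M;E)=\Omega(M)\otimes_{C^\infty(M)}\Gamma(E)$ is the space of $E$-valued forms, with total $\mathbb{Z}_2$-degree $|\alpha\otimes\phi|=|\alpha|+|\phi|$ mod $2$. It is identified with the graded vector bundle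 $\mathcal{L}=\Omega(M)\otimes\Gamma(E)$ over $(M,\Omega(M))$, writing $\alpha\phi$ for $\alpha\otimes\phi$. A graded connection on $\mathcal{L}$ is an even morphism of left $\Omega(M)$-modules $\boldsymbol{\nabla}:\mathrm{Der}\,\Omega(M)\to\mathrm{End}_{\mathbb{R}}(\mathcal{L})$, $\delta\mapsto\boldsymbol{\nabla}_\delta$, such that $\boldsymbol{\nabla}_\delta(\alpha\phi)=\delta(\alpha)\phi+(-1)^{|\alpha||\delta|}\alpha\boldsymbol{\nabla}_\delta\phi$ for homogeneous $\delta\in\mathrm{Der}\,\Omega(M)$, $\alpha\in\Omega(M)$, and $\phi\in\mathcal{L}$. Its graded curvature is $$R^{\boldsymbol{\nabla}}(\delta,\delta')\phi=\boldsymbol{\nabla}_\delta\boldsymbol{\nabla}_{\delta'}\phi-(-1)^{|\delta||\delta'|}\boldsymbol{\nabla}_{\delta'}\boldsymbol{\nabla}_\delta\phi-\boldsymbol{\nabla}_{[\delta,\delta']}\phi .$$ The operator associated to $\boldsymbol{\nabla}$ is $D^{\boldsymbol{\nabla}}:\Omega(M;E)\to\Omega(M;E)$, $D^{\boldsymbol{\nabla}}(\alpha\otimes\phi)=\boldsymbol{\nabla}_{\mathrm{d}}(\alpha\phi)$; it is a Quillen superconnection, i.e. an $\mathbb{R}$-linear operator of odd total degree with $D(\alpha\wedge\sigma)=\mathrm{d}\alpha\wedge\sigma+(-1)^{|\alpha|}\alpha\wedge D\sigma$. The curvature of a Quillen superconnection $D$ is $R^D=D^2$. *)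

theory Defs
  imports "HOL-Analysis.Analysis" "HOL-Library.Function_Algebras"
begin

section \<open>Smooth functions of finitely many real variables\<close>

text \<open>Points of n-space are functions \<open>nat \<Rightarrow> real\<close> vanishing at all indices \<open>\<ge> n\<close>,
  with the topology \<^const>\<open>Euclidean_space\<close>; this keeps the dimension a natural number, 0 included.\<close>

definition partial :: "nat \<Rightarrow> ((nat \<Rightarrow> real) \<Rightarrow> real) \<Rightarrow> (nat \<Rightarrow> real) \<Rightarrow> real" where
  "partial j f p = deriv (\<lambda>t. f (p(j := t))) (p j)"

primrec Ck_on :: "nat \<Rightarrow> nat \<Rightarrow> (nat \<Rightarrow> real) set \<Rightarrow> ((nat \<Rightarrow> real) \<Rightarrow> real) \<Rightarrow> bool" where
  "Ck_on n 0 V f \<longleftrightarrow> continuous_map (subtopology (Euclidean_space n) V) euclideanreal f"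
| "Ck_on n (Suc k) V f \<longleftrightarrow>
     continuous_map (subtopology (Euclidean_space n) V) euclideanreal f \<and>
     (\<forall>j<n. (\<forall>p\<in>V. (\<lambda>t. f (p(j := t))) differentiable (at (p j))) \<and> Ck_on n k V (partial j f))"

definition smooth_on :: "nat \<Rightarrow> (nat \<Rightarrow> real) set \<Rightarrow> ((nat \<Rightarrow> real) \<Rightarrow> real) \<Rightarrow> bool" where
  "smooth_on n V f \<longleftrightarrow> (\<forall>k. Ck_on n k V f)"


section \<open>Smooth manifolds\<close>

type_synonym 'a chart = "'a set \<times> ('a \<Rightarrow> nat \<Rightarrow> real)"

definition chart_inv :: "'a chart \<Rightarrow> (nat \<Rightarrow> real) \<Rightarrow> 'a" where
  "chart_inv c = inv_into (fst c) (snd c)"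

record 'a mfd =
  mdim :: nat
  mspace :: "'a topology"
  atlas :: "'a chart set"

abbreviation points :: "'a mfd \<Rightarrow> 'a set" where
  "points M \<equiv> topspace (mspace M)"

definition is_chart :: "nat \<Rightarrow> 'a topology \<Rightarrow> 'a chart \<Rightarrow> bool" where
  "is_chart n X c \<longleftrightarrow>
     openin X (fst c) \<and> openin (Euclidean_space n) (snd c ` fst c) \<and>
     homeomorphic_map (subtopology X (fst c)) (subtopology (Euclidean_space n) (snd c ` fst c)) (snd c)"

text \<open>The atlas need not be maximal: any smooth atlas determines the smooth structure.\<close>

definition smooth_manifold :: "'a mfd \<Rightarrow> bool" where
  "smooth_manifold M \<longleftrightarrow>
     Hausdorff_space (mspace M) \<and> second_countable (mspace M) \<and>
     (\<forall>c\<in>atlas M. is_chart (mdim M) (mspace M) c) \<and>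
     (\<Union>c\<in>atlas M. fst c) = points M \<and>
     (\<forall>c\<in>atlas M. \<forall>c'\<in>atlas M. \<forall>i<mdim M.
        smooth_on (mdim M) (snd c ` (fst c \<inter> fst c')) (\<lambda>q. snd c' (chart_inv c q) i))"

definition smooth_fun_on :: "'a mfd \<Rightarrow> 'a set \<Rightarrow> ('a \<Rightarrow> real) \<Rightarrow> bool" where
  "smooth_fun_on M U f \<longleftrightarrow>
     (\<forall>c\<in>atlas M. smooth_on (mdim M) (snd c ` (U \<inter> fst c)) (\<lambda>q. f (chart_inv c q)))"

definition smooth_functions :: "'a mfd \<Rightarrow> ('a \<Rightarrow> real) set" where
  "smooth_functions M = {f. smooth_fun_on M (points M) f}"


section \<open>Tangent vectors\<close>

text \<open>A tangent vector at \<open>p\<close> is the family of its component vectors in all charts around \<open>p\<close>,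
  any two of them being related by the Jacobian matrix of the change of coordinates.\<close>

type_synonym 'a tangent = "'a chart \<Rightarrow> nat \<Rightarrow> real"

definition charts_at :: "'a mfd \<Rightarrow> 'a \<Rightarrow> 'a chart set" where
  "charts_at M p = {c \<in> atlas M. p \<in> fst c}"

definition jacobian :: "'a chart \<Rightarrow> 'a chart \<Rightarrow> 'a \<Rightarrow> nat \<Rightarrow> nat \<Rightarrow> real" where
  "jacobian c c' p i j = partial j (\<lambda>q. snd c' (chart_inv c q) i) (snd c p)"

definition tangent_space :: "'a mfd \<Rightarrow> 'a \<Rightarrow> 'a tangent set" where
  "tangent_space M p =
     {v. (\<forall>c i. \<not> (c \<in> charts_at M p \<and> i < mdim M) \<longrightarrow> v c i = 0) \<and>
         (\<forall>c\<in>charts_at M p. \<forall>c'\<in>charts_at M p. \<forall>i<mdim M.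
            v c' i = (\<Sum>j<mdim M. jacobian c c' p i j * v c j))}"

text \<open>The tangent vector at \<open>p\<close> with components \<open>\<xi>\<close> in the chart \<open>c\<close>, and the
  coordinate vectors of \<open>c\<close>.\<close>

definition tangent_of :: "'a mfd \<Rightarrow> 'a chart \<Rightarrow> 'a \<Rightarrow> (nat \<Rightarrow> real) \<Rightarrow> 'a tangent" where
  "tangent_of M c p \<xi> = (\<lambda>c' i. if c' \<in> charts_at M p \<and> i < mdim M
                              then (\<Sum>j<mdim M. jacobian c c' p i j * \<xi> j) else 0)"

definition coord_vector :: "'a mfd \<Rightarrow> 'a chart \<Rightarrow> 'a \<Rightarrow> nat \<Rightarrow> 'a tangent" where
  "coord_vector M c p j = tangent_of M c p (\<lambda>i. if i = j then 1 else 0)"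


section \<open>Differential forms\<close>

text \<open>The exterior algebra of the cotangent space at \<open>p\<close> consists of the alternating multilinear
  forms on the tangent space: an inhomogeneous element is a function of lists of tangent vectors
  whose restriction to lists of length \<open>k\<close> is its component of degree \<open>k\<close>. Components of degree
  above the dimension vanish automatically. Outside their domain these functions are 0.\<close>

type_synonym 'a form = "'a \<Rightarrow> 'a tangent list \<Rightarrow> real"

definition ext_cotangent :: "'a mfd \<Rightarrow> 'a \<Rightarrow> ('a tangent list \<Rightarrow> real) set" where
  "ext_cotangent M p =
     {w. (\<forall>vs. \<not> set vs \<subseteq> tangent_space M p \<longrightarrow> w vs = 0) \<and>
         (\<forall>us vs. \<forall>v\<in>tangent_space M p. \<forall>v'\<in>tangent_space M p.
            set us \<union> set vs \<subseteq> tangent_space M p \<longrightarrow>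
            w (us @ (v + v') # vs) = w (us @ v # vs) + w (us @ v' # vs)) \<and>
         (\<forall>us vs r. \<forall>v\<in>tangent_space M p.
            set us \<union> set vs \<subseteq> tangent_space M p \<longrightarrow>
            w (us @ (\<lambda>c i. r * v c i) # vs) = r * w (us @ v # vs)) \<and>
         (\<forall>vs. \<not> distinct vs \<longrightarrow> w vs = 0)}"

definition forms :: "'a mfd \<Rightarrow> 'a form set" where
  "forms M =
     {\<omega>. (\<forall>p\<in>points M. \<omega> p \<in> ext_cotangent M p) \<and> (\<forall>p. p \<notin> points M \<longrightarrow> \<omega> p = 0) \<and>
         (\<forall>c\<in>atlas M. \<forall>js. set js \<subseteq> {..<mdim M} \<longrightarrow>
            smooth_on (mdim M) (snd c ` fst c)
              (\<lambda>q. \<omega> (chart_inv c q) (map (coord_vector M c (chart_inv c q)) js)))}"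

text \<open>Elements of \<open>\<int>/2\<close> are represented by the natural numbers 0 and 1.\<close>

definition forms_par :: "'a mfd \<Rightarrow> nat \<Rightarrow> 'a form set" where
  "forms_par M i = {\<omega>\<in>forms M. \<forall>p vs. length vs mod 2 \<noteq> i \<longrightarrow> \<omega> p vs = 0}"

definition scale_form :: "real \<Rightarrow> 'a form \<Rightarrow> 'a form" where
  "scale_form r \<alpha> = (\<lambda>p vs. r * \<alpha> p vs)"

definition fun_form :: "('a \<Rightarrow> real) \<Rightarrow> 'a form \<Rightarrow> 'a form" where
  "fun_form f \<alpha> = (\<lambda>p vs. f p * \<alpha> p vs)"

text \<open>Sum over shuffles: \<open>S\<close> is the set of positions of the arguments passed to the first factor,
  and the exponent is the number of inversions of the shuffle.\<close>

definition wedge :: "'a form \<Rightarrow> 'a form \<Rightarrow> 'a form" where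
  "wedge \<alpha> \<beta> = (\<lambda>p vs. \<Sum>S\<in>Pow {..<length vs}.
     (-1) ^ card {(i, j). i < j \<and> j \<in> S \<and> i \<notin> S} * \<alpha> p (nths vs S) * \<beta> p (nths vs (- S)))"

text \<open>Exterior differential. In a chart \<open>c\<close> around \<open>p\<close> the arguments are extended to the vector
  fields with constant components, and
  \<open>(d\<omega>)(V\<^sub>0,\<dots>,V\<^sub>k) = \<Sum>\<^sub>a (-1)\<^sup>a V\<^sub>a (\<omega>(V\<^sub>0,\<dots>,V\<^sub>a omitted,\<dots>,V\<^sub>k))\<close>;
  equivalently \<open>d(\<Sum> \<omega>\<^sub>I dx\<^sup>I) = \<Sum> d\<omega>\<^sub>I \<and> dx\<^sup>I\<close>. The value does not depend on the chart.\<close>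

definition ext_d_at :: "'a mfd \<Rightarrow> 'a chart \<Rightarrow> 'a form \<Rightarrow> 'a \<Rightarrow> 'a tangent list \<Rightarrow> real" where
  "ext_d_at M c \<omega> p vs =
     (\<Sum>a<length vs. (-1) ^ a *
        (\<Sum>j<mdim M. (vs ! a) c j *
           partial j (\<lambda>q. \<omega> (chart_inv c q)
                           (map (\<lambda>v. tangent_of M c (chart_inv c q) (v c)) (nths vs (- {a}))))
             (snd c p)))"

definition ext_d :: "'a mfd \<Rightarrow> 'a form \<Rightarrow> 'a form" where
  "ext_d M = (\<lambda>\<omega>\<in>forms M. \<lambda>p vs.
     if p \<in> points M \<and> set vs \<subseteq> tangent_space M p
     then ext_d_at M (SOME c. c \<in> charts_at M p) \<omega> p vs else 0)"


section \<open>Graded derivations\<close>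

text \<open>Operators on forms are \<^const>\<open>extensional\<close>, so that they are equal if they agree on forms.\<close>

type_synonym 'a form_op = "'a form \<Rightarrow> 'a form"

definition der_par :: "'a mfd \<Rightarrow> nat \<Rightarrow> 'a form_op set" where
  "der_par M i =
     {\<delta> \<in> forms M \<rightarrow>\<^sub>E forms M.
        (\<forall>\<alpha>\<in>forms M. \<forall>\<beta>\<in>forms M. \<delta> (\<alpha> + \<beta>) = \<delta> \<alpha> + \<delta> \<beta>) \<and>
        (\<forall>r. \<forall>\<alpha>\<in>forms M. \<delta> (scale_form r \<alpha>) = scale_form r (\<delta> \<alpha>)) \<and>
        (\<forall>j<2. \<forall>\<alpha>\<in>forms_par M j. \<delta> \<alpha> \<in> forms_par M ((i + j) mod 2)) \<and>
        (\<forall>j<2. \<forall>\<alpha>\<in>forms_par M j. \<forall>\<beta>\<in>forms M.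
           \<delta> (wedge \<alpha> \<beta>) = wedge (\<delta> \<alpha>) \<beta> + scale_form ((-1) ^ (j * i)) (wedge \<alpha> (\<delta> \<beta>)))}"

definition der_add :: "'a mfd \<Rightarrow> 'a form_op \<Rightarrow> 'a form_op \<Rightarrow> 'a form_op" where
  "der_add M \<delta> \<delta>' = (\<lambda>\<omega>\<in>forms M. \<delta> \<omega> + \<delta>' \<omega>)"

definition der_lmul :: "'a mfd \<Rightarrow> 'a form \<Rightarrow> 'a form_op \<Rightarrow> 'a form_op" where
  "der_lmul M \<alpha> \<delta> = (\<lambda>\<omega>\<in>forms M. wedge \<alpha> (\<delta> \<omega>))"

definition Der :: "'a mfd \<Rightarrow> 'a form_op set" where
  "Der M = {der_add M \<delta> \<delta>' | \<delta> \<delta>'. \<delta> \<in> der_par M 0 \<and> \<delta>' \<in> der_par M 1}"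

text \<open>The degree of a homogeneous derivation. Only the zero derivation has both degrees; the
  choice made for it is immaterial.\<close>

definition der_deg :: "'a mfd \<Rightarrow> 'a form_op \<Rightarrow> nat" where
  "der_deg M \<delta> = (if \<delta> \<in> der_par M 1 then 1 else 0)"

definition der_bracket :: "'a mfd \<Rightarrow> 'a form_op \<Rightarrow> 'a form_op \<Rightarrow> 'a form_op" where
  "der_bracket M \<delta> \<delta>' =
     (\<lambda>\<omega>\<in>forms M. \<delta> (\<delta>' \<omega>) - scale_form ((-1) ^ (der_deg M \<delta> * der_deg M \<delta>')) (\<delta>' (\<delta> \<omega>)))"


section \<open>Supervector bundles\<close>

text \<open>The fibres are linear subspaces of a fixed (arbitrarily large) real vector space; fibres over
  different points may overlap there, the total space being their disjoint union. A local
  trivialization \<open>(U, \<phi>)\<close> identifies the fibre over \<open>p \<in> U\<close> with \<open>vrank\<close>-space by \<open>\<phi> p\<close>; the smooth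
  structure of the total space is the one determined by the smooth transition matrices.\<close>

record ('a, 'v) vbundle =
  vrank :: nat
  fibre :: "'a \<Rightarrow> 'v set"
  trivs :: "('a set \<times> ('a \<Rightarrow> 'v \<Rightarrow> nat \<Rightarrow> real)) set"

definition vector_bundle :: "'a mfd \<Rightarrow> ('a, 'v::real_vector) vbundle \<Rightarrow> bool" where
  "vector_bundle M E \<longleftrightarrow>
     (\<forall>p\<in>points M. subspace (fibre E p)) \<and>
     (\<Union>(U, \<phi>)\<in>trivs E. U) = points M \<and>
     (\<forall>(U, \<phi>)\<in>trivs E. openin (mspace M) U \<and>
        (\<forall>p\<in>U. bij_betw (\<phi> p) (fibre E p) (topspace (Euclidean_space (vrank E))) \<and>
           (\<forall>v\<in>fibre E p. \<forall>w\<in>fibre E p. \<phi> p (v + w) = \<phi> p v + \<phi> p w) \<and>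
           (\<forall>r. \<forall>v\<in>fibre E p. \<phi> p (r *\<^sub>R v) = (\<lambda>i. r * \<phi> p v i)))) \<and>
     (\<forall>(U, \<phi>)\<in>trivs E. \<forall>(V, \<psi>)\<in>trivs E. \<forall>i<vrank E. \<forall>j<vrank E.
        smooth_fun_on M (U \<inter> V)
          (\<lambda>p. \<psi> p (inv_into (fibre E p) (\<phi> p) (\<lambda>k. if k = j then 1 else 0)) i))"

definition bundle_sum :: "('a, 'v) vbundle \<Rightarrow> ('a, 'w) vbundle \<Rightarrow> ('a, 'v \<times> 'w) vbundle" where
  "bundle_sum E F =
     \<lparr> vrank = vrank E + vrank F,
       fibre = (\<lambda>p. fibre E p \<times> fibre F p),
       trivs = {(U \<inter> V, \<lambda>p (v, w) i. if i < vrank E then \<phi> p v i else \<psi> p w (i - vrank E))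
                | U \<phi> V \<psi>. (U, \<phi>) \<in> trivs E \<and> (V, \<psi>) \<in> trivs F} \<rparr>"

definition supervector_bundle ::
  "'a mfd \<Rightarrow> ('a, 'v::real_vector \<times> 'w::real_vector) vbundle \<Rightarrow> bool" where
  "supervector_bundle M E \<longleftrightarrow>
     (\<exists>E0 E1. vector_bundle M E0 \<and> vector_bundle M E1 \<and> E = bundle_sum E0 E1)"

definition sections :: "'a mfd \<Rightarrow> ('a, 'v::real_vector) vbundle \<Rightarrow> ('a \<Rightarrow> 'v) set" where
  "sections M E =
     {s. (\<forall>p\<in>points M. s p \<in> fibre E p) \<and> (\<forall>p. p \<notin> points M \<longrightarrow> s p = 0) \<and>
         (\<forall>(U, \<phi>)\<in>trivs E. \<forall>i<vrank E. smooth_fun_on M U (\<lambda>p. \<phi> p (s p) i))}"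

definition sections_par ::
  "'a mfd \<Rightarrow> ('a, 'v::real_vector \<times> 'w::real_vector) vbundle \<Rightarrow> nat \<Rightarrow> ('a \<Rightarrow> 'v \<times> 'w) set" where
  "sections_par M E i =
     {s\<in>sections M E. \<forall>p. if i = 0 then snd (s p) = 0 else fst (s p) = 0}"


section \<open>Bundle-valued forms\<close>

text \<open>\<open>\<Omega>(M;E) = \<Omega>(M) \<otimes> \<Gamma>(E)\<close> over the smooth functions: a list of pairs \<open>(\<alpha>\<^sub>i, \<phi>\<^sub>i)\<close> stands for the
  formal sum of the \<open>\<alpha>\<^sub>i \<otimes> \<phi>\<^sub>i\<close>, and the tensor product is the quotient by the congruence generated
  by the bilinearity relations. Negatives need no separate treatment, since
  \<open>\<alpha> \<otimes> \<phi> + (-\<alpha>) \<otimes> \<phi> = 0 \<otimes> \<phi> = 0\<close>.\<close>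

type_synonym ('a, 'v) tensor = "('a form \<times> ('a \<Rightarrow> 'v)) list set"

inductive_set tensor_rel ::
  "'a mfd \<Rightarrow> ('a, 'v::real_vector) vbundle \<Rightarrow>
   (('a form \<times> ('a \<Rightarrow> 'v)) list \<times> ('a form \<times> ('a \<Rightarrow> 'v)) list) set"
  for M E where
  refl: "xs \<in> lists (forms M \<times> sections M E) \<Longrightarrow> (xs, xs) \<in> tensor_rel M E"
| sym: "(xs, ys) \<in> tensor_rel M E \<Longrightarrow> (ys, xs) \<in> tensor_rel M E"
| trans: "(xs, ys) \<in> tensor_rel M E \<Longrightarrow> (ys, zs) \<in> tensor_rel M E \<Longrightarrow> (xs, zs) \<in> tensor_rel M E"
| append: "(xs, xs') \<in> tensor_rel M E \<Longrightarrow> (ys, ys') \<in> tensor_rel M E \<Longrightarrow>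
    (xs @ ys, xs' @ ys') \<in> tensor_rel M E"
| commute: "xs \<in> lists (forms M \<times> sections M E) \<Longrightarrow> ys \<in> lists (forms M \<times> sections M E) \<Longrightarrow>
    (xs @ ys, ys @ xs) \<in> tensor_rel M E"
| zero: "\<phi> \<in> sections M E \<Longrightarrow> ([(0, \<phi>)], []) \<in> tensor_rel M E"
| add_left: "\<alpha> \<in> forms M \<Longrightarrow> \<beta> \<in> forms M \<Longrightarrow> \<phi> \<in> sections M E \<Longrightarrow>
    ([(\<alpha> + \<beta>, \<phi>)], [(\<alpha>, \<phi>), (\<beta>, \<phi>)]) \<in> tensor_rel M E"
| add_right: "\<alpha> \<in> forms M \<Longrightarrow> \<phi> \<in> sections M E \<Longrightarrow> \<psi> \<in> sections M E \<Longrightarrow>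
    ([(\<alpha>, \<phi> + \<psi>)], [(\<alpha>, \<phi>), (\<alpha>, \<psi>)]) \<in> tensor_rel M E"
| balanced: "f \<in> smooth_functions M \<Longrightarrow> \<alpha> \<in> forms M \<Longrightarrow> \<phi> \<in> sections M E \<Longrightarrow>
    ([(fun_form f \<alpha>, \<phi>)], [(\<alpha>, \<lambda>p. f p *\<^sub>R \<phi> p)]) \<in> tensor_rel M E"

definition bundle_forms :: "'a mfd \<Rightarrow> ('a, 'v::real_vector) vbundle \<Rightarrow> ('a, 'v) tensor set" where
  "bundle_forms M E = lists (forms M \<times> sections M E) // tensor_rel M E"

definition bf_add :: "'a mfd \<Rightarrow> ('a, 'v::real_vector) vbundle \<Rightarrow>
    ('a, 'v) tensor \<Rightarrow> ('a, 'v) tensor \<Rightarrow> ('a, 'v) tensor" where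
  "bf_add M E X Y = (\<Union>xs\<in>X. \<Union>ys\<in>Y. tensor_rel M E `` {xs @ ys})"

definition bf_scale :: "'a mfd \<Rightarrow> ('a, 'v::real_vector) vbundle \<Rightarrow>
    real \<Rightarrow> ('a, 'v) tensor \<Rightarrow> ('a, 'v) tensor" where
  "bf_scale M E r X = (\<Union>xs\<in>X. tensor_rel M E `` {map (\<lambda>(\<alpha>, \<phi>). (scale_form r \<alpha>, \<phi>)) xs})"

definition bf_minus :: "'a mfd \<Rightarrow> ('a, 'v::real_vector) vbundle \<Rightarrow>
    ('a, 'v) tensor \<Rightarrow> ('a, 'v) tensor \<Rightarrow> ('a, 'v) tensor" where
  "bf_minus M E X Y = bf_add M E X (bf_scale M E (-1) Y)"

definition bf_lmul :: "'a mfd \<Rightarrow> ('a, 'v::real_vector) vbundle \<Rightarrow>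
    'a form \<Rightarrow> ('a, 'v) tensor \<Rightarrow> ('a, 'v) tensor" where
  "bf_lmul M E \<beta> X = (\<Union>xs\<in>X. tensor_rel M E `` {map (\<lambda>(\<alpha>, \<phi>). (wedge \<beta> \<alpha>, \<phi>)) xs})"

definition bundle_forms_par ::
  "'a mfd \<Rightarrow> ('a, 'v::real_vector \<times> 'w::real_vector) vbundle \<Rightarrow> nat \<Rightarrow> ('a, 'v \<times> 'w) tensor set" where
  "bundle_forms_par M E i =
     {X\<in>bundle_forms M E. \<exists>xs\<in>X. \<forall>(\<alpha>, \<phi>)\<in>set xs. \<exists>j<2. \<exists>k<2.
        \<alpha> \<in> forms_par M j \<and> \<phi> \<in> sections_par M E k \<and> (j + k) mod 2 = i}"


section \<open>Graded connections and their curvature\<close>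

type_synonym ('a, 'v) bf_op = "('a, 'v) tensor \<Rightarrow> ('a, 'v) tensor"

definition graded_connection :: "'a mfd \<Rightarrow> ('a, 'v::real_vector \<times> 'w::real_vector) vbundle \<Rightarrow>
    ('a form_op \<Rightarrow> ('a, 'v \<times> 'w) bf_op) \<Rightarrow> bool" where
  "graded_connection M E nabla \<longleftrightarrow>
     (\<forall>\<delta>\<in>Der M.
        nabla \<delta> \<in> bundle_forms M E \<rightarrow> bundle_forms M E \<and>
        (\<forall>X\<in>bundle_forms M E. \<forall>Y\<in>bundle_forms M E.
           nabla \<delta> (bf_add M E X Y) = bf_add M E (nabla \<delta> X) (nabla \<delta> Y)) \<and>
        (\<forall>r. \<forall>X\<in>bundle_forms M E. nabla \<delta> (bf_scale M E r X) = bf_scale M E r (nabla \<delta> X))) \<and>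
     (\<forall>\<delta>\<in>Der M. \<forall>\<delta>'\<in>Der M. \<forall>X\<in>bundle_forms M E.
        nabla (der_add M \<delta> \<delta>') X = bf_add M E (nabla \<delta> X) (nabla \<delta>' X)) \<and>
     (\<forall>\<alpha>\<in>forms M. \<forall>\<delta>\<in>Der M. \<forall>X\<in>bundle_forms M E.
        nabla (der_lmul M \<alpha> \<delta>) X = bf_lmul M E \<alpha> (nabla \<delta> X)) \<and>
     (\<forall>i<2. \<forall>j<2. \<forall>\<delta>\<in>der_par M i. \<forall>X\<in>bundle_forms_par M E j.
        nabla \<delta> X \<in> bundle_forms_par M E ((i + j) mod 2)) \<and>
     (\<forall>i<2. \<forall>j<2. \<forall>\<delta>\<in>der_par M i. \<forall>\<alpha>\<in>forms_par M j. \<forall>X\<in>bundle_forms M E.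
        nabla \<delta> (bf_lmul M E \<alpha> X) =
          bf_add M E (bf_lmul M E (\<delta> \<alpha>) X) (bf_scale M E ((-1) ^ (j * i)) (bf_lmul M E \<alpha> (nabla \<delta> X))))"

definition graded_curvature :: "'a mfd \<Rightarrow> ('a, 'v::real_vector \<times> 'w::real_vector) vbundle \<Rightarrow>
    ('a form_op \<Rightarrow> ('a, 'v \<times> 'w) bf_op) \<Rightarrow> 'a form_op \<Rightarrow> 'a form_op \<Rightarrow> ('a, 'v \<times> 'w) bf_op" where
  "graded_curvature M E nabla \<delta> \<delta>' X =
     bf_minus M E
       (bf_minus M E (nabla \<delta> (nabla \<delta>' X))
          (bf_scale M E ((-1) ^ (der_deg M \<delta> * der_deg M \<delta>')) (nabla \<delta>' (nabla \<delta> X))))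
       (nabla (der_bracket M \<delta> \<delta>') X)"

definition assoc_superconnection :: "'a mfd \<Rightarrow>
    ('a form_op \<Rightarrow> ('a, 'v \<times> 'w) bf_op) \<Rightarrow> ('a, 'v \<times> 'w) bf_op" where
  "assoc_superconnection M nabla = nabla (ext_d M)"

definition superconnection_curvature :: "('a, 'v) bf_op \<Rightarrow> ('a, 'v) bf_op" where
  "superconnection_curvature D = D \<circ> D"

end

theory Submission
  imports Defs
begin

text \<open>The exterior differential is an odd derivation, so the graded commutator of
  \<open>\<nabla>\<^sub>d\<close> with itself is \<open>2 \<nabla>\<^sub>d \<nabla>\<^sub>d\<close>, while \<open>[d, d] = 2 d d = 0\<close> is the product of the
  form \<open>0\<close> with \<open>d\<close> and hence contributes nothing. What has to be shown is that \<open>d\<close> is well defined,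
  obeys the graded Leibniz rule and squares to zero; in a chart the latter two follow by
  induction on the number of arguments from Cartan's formula
  \<open>(dF)(v, us) = \<partial>\<^sub>v (F us) - d(\<iota>\<^sub>v F)(us)\<close> for a constant vector field \<open>v\<close>.\<close>

text \<open>The obstacle is that \<open>ext_d\<close> works in a chart picked by
  \<open>SOME\<close>, with vector fields whose components are constant there. Such fields are not
  constant in another chart, so chart independence amounts to naturality of d under a nonlinear
  change of coordinates. It is reduced to the Leibniz rule and to d d = 0 in n-space, both proved
  before the manifold enters: Euler's identity sum_i dx^i wedge iota_i F = k F builds a form of
  degree k > 0 from the dx^i and forms of degree k - 1, and the pullback of dx^i is the differential
  of a component of the transition map, hence closed. Since \<open>Ck_on\<close> speaks of iterated
  partial derivatives only, the symmetry of second derivatives and the chain rule are derived from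
  continuity of the partial derivatives and the mean value theorem. The factor 1/2 is cancelled on
  representatives: twice the class of a list ys is the class of ys @ ys, and the bilinearity
  relations bring half of it back to ys.\<close>

section \<open>Shuffle products\<close>

text \<open>The wedge product at a point; the recursion is
  \<open>\<iota>\<^sub>v (a \<and> b) = \<iota>\<^sub>v a \<and> b + (-1)\<^sup>|\<^sup>a\<^sup>| a \<and> \<iota>\<^sub>v b\<close>.\<close>

fun shuffle_prod :: "('b list \<Rightarrow> real) \<Rightarrow> ('b list \<Rightarrow> real) \<Rightarrow> 'b list \<Rightarrow> real" where
  "shuffle_prod a b [] = a [] * b []"
| "shuffle_prod a b (v # vs) =
     shuffle_prod (\<lambda>us. a (v # us)) b vs +
     shuffle_prod (\<lambda>us. (-1) ^ length us * a us) (\<lambda>us. b (v # us)) vs"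

text \<open>Separates the shuffles that pass the first argument to the left factor (0 is a position
  in S) from those that pass it to the right one; the remaining positions are shifted by
  one.\<close>

lemma Pow_lessThan_Suc:
  "Pow {..<Suc n} = (\<lambda>T. insert 0 (Suc ` T)) ` Pow {..<n} \<union> (`) Suc ` Pow {..<n}"
proof -
  have "Pow (Suc ` {..<n}) = (`) Suc ` Pow {..<n}"
    by (simp add: image_Pow_surj)
  then show ?thesis
    by (auto simp: lessThan_Suc_eq_insert_0 Pow_insert image_image)
qed

text \<open>If the first argument goes to the right factor, position 0 forms an inversion with every
  position in S. These \<open>card T\<close> extra inversions are the sign (-1)^|a| in the
  recursion.\<close>

lemma card_inversions_image_Suc:
  assumes "finite T"
  shows "card {(i, j). i < j \<and> j \<in> Suc ` T \<and> i \<notin> Suc ` T} =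
    card T + card {(i, j). i < j \<and> j \<in> T \<and> i \<notin> T}"
proof -
  let ?I = "{(i, j). i < j \<and> j \<in> T \<and> i \<notin> T}"
  have "{(i, j). i < j \<and> j \<in> Suc ` T \<and> i \<notin> Suc ` T} =
      Pair 0 ` Suc ` T \<union> map_prod Suc Suc ` ?I" (is "?J = ?A \<union> ?B")
  proof safe
    fix i j assume *: "i < Suc j" "j \<in> T" "i \<notin> Suc ` T" "(i, Suc j) \<notin> map_prod Suc Suc ` ?I"
    show "(i, Suc j) \<in> Pair 0 ` Suc ` T"
    proof (cases i)
      case (Suc k)
      with * show ?thesis by (auto simp: image_iff)
    qed (use * in auto)
  qed auto
  moreover have "finite ?I"
    by (rule finite_subset[of _ "{..Max T} \<times> T"])
      (use assms in \<open>auto intro: order.trans[OF less_imp_le Max_ge]\<close>)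
  ultimately have "card ?J = card ?A + card ?B"
    by (auto intro!: card_Un_disjoint simp: assms)
  then show ?thesis
    by (simp add: card_image inj_on_def)
qed

text \<open>Position 0 in S takes part in no inversion: it is not outside S, and nothing precedes
  it. So this branch of the recursion carries no sign.\<close>

lemma card_inversions_insert_0_image_Suc:
  "card {(i, j). i < j \<and> j \<in> insert 0 (Suc ` T) \<and> i \<notin> insert 0 (Suc ` T)} =
    card {(i, j). i < j \<and> j \<in> T \<and> i \<notin> T}"
proof -
  have "{(i, j). i < j \<and> j \<in> insert 0 (Suc ` T) \<and> i \<notin> insert 0 (Suc ` T)} =
      map_prod Suc Suc ` {(i, j). i < j \<and> j \<in> T \<and> i \<notin> T}"
  proof (intro set_eqI)
    fix x :: "nat \<times> nat"
    show "x \<in> {(i, j). i < j \<and> j \<in> insert 0 (Suc ` T) \<and> i \<notin> insert 0 (Suc ` T)} \<longleftrightarrow>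
      x \<in> map_prod Suc Suc ` {(i, j). i < j \<and> j \<in> T \<and> i \<notin> T}"
      by (cases "fst x"; cases x) (auto simp: image_iff)
  qed
  then show ?thesis
    by (simp add: card_image inj_on_def)
qed

text \<open>Connects the recursion with the sum in \<open>wedge\<close>. From here on identities for
  the wedge product are list inductions with both factors arbitrary, and no shuffle is handled
  explicitly again.\<close>

lemma shuffle_prod_eq_sum:
  "shuffle_prod a b vs = (\<Sum>S\<in>Pow {..<length vs}.
     (-1) ^ card {(i, j). i < j \<and> j \<in> S \<and> i \<notin> S} * a (nths vs S) * b (nths vs (- S)))"
proof (induction vs arbitrary: a b)
  case (Cons v vs)
  let ?P = "Pow {..<length vs}"
  let ?f = "\<lambda>S. (-1) ^ card {(i, j). i < j \<and> j \<in> S \<and> i \<notin> S} *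
    a (nths (v # vs) S) * b (nths (v # vs) (- S)) :: real"
  have inj: "inj_on (\<lambda>T. insert 0 (Suc ` T)) ?P" "inj_on ((`) Suc) ?P"
    by (auto simp: inj_on_def)
  have *: "{j. Suc j \<in> Suc ` T} = T" "{j. Suc j \<in> insert 0 (Suc ` T)} = T" "{j. Suc j \<in> - (Suc ` T)} = - T" "{j. Suc j \<in> - insert 0 (Suc ` T)} = - T" for T
    by auto
  have "sum ?f (Pow {..<length (v # vs)}) =
    (\<Sum>T\<in>?P. ?f (insert 0 (Suc ` T))) + (\<Sum>T\<in>?P. ?f (Suc ` T))"
    unfolding length_Cons Pow_lessThan_Suc
    by (subst sum.union_disjoint) (auto simp: sum.reindex[OF inj(1)] sum.reindex[OF inj(2)])
  also have "(\<Sum>T\<in>?P. ?f (insert 0 (Suc ` T))) = shuffle_prod (\<lambda>us. a (v # us)) b vs"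
    unfolding Cons.IH card_inversions_insert_0_image_Suc nths_Cons *
    by (intro sum.cong) auto
  also have "(\<Sum>T\<in>?P. ?f (Suc ` T)) =
    shuffle_prod (\<lambda>us. (-1) ^ length us * a us) (\<lambda>us. b (v # us)) vs"
    unfolding Cons.IH 
  proof (intro sum.cong[OF HOL.refl])
    fix T assume T: "T \<in> ?P"
    then have "finite T" using finite_subset by blast
    \<comment> \<open>Gives \<open>length (nths vs T) = card T\<close>, so that the extra inversions
      become the sign on the left factor.\<close>
    moreover have "{i. i < length vs \<and> i \<in> T} = T" using T by auto
    ultimately show "?f (Suc ` T) = (-1) ^ card {(i, j). i < j \<and> j \<in> T \<and> i \<notin> T} *
        ((-1) ^ length (nths vs T) * a (nths vs T)) * b (v # nths vs (- T))"
      unfolding card_inversions_image_Suc[OF \<open>finite T\<close>] nths_Cons *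
      by (simp add: length_nths power_add)
  qed
  finally show ?case by simp
qed simp

lemma wedge_eq: "wedge \<alpha> \<beta> p vs = shuffle_prod (\<alpha> p) (\<beta> p) vs"
  by (simp add: wedge_def shuffle_prod_eq_sum)

text \<open>The hypotheses concern lists built from the arguments and no longer than them: later the
  arguments are tangent vectors, and the length bound excludes high degrees.\<close>

lemma shuffle_prod_cong:
  assumes "\<And>us. set us \<subseteq> set vs \<Longrightarrow> length us \<le> length vs \<Longrightarrow> a us = a' us"
    and "\<And>us. set us \<subseteq> set vs \<Longrightarrow> length us \<le> length vs \<Longrightarrow> b us = b' us"
  shows "shuffle_prod a b vs = shuffle_prod a' b' vs"
  using assms
proof (induction vs arbitrary: a b a' b')
  case (Cons v vs)
  have "a us = a' us" "b us = b' us" "a (v # us) = a' (v # us)" "b (v # us) = b' (v # us)"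
    if "set us \<subseteq> set vs" "length us \<le> length vs" for us
    using that Cons.prems(1)[of us] Cons.prems(2)[of us] Cons.prems(1)[of "v # us"] Cons.prems(2)[of "v # us"]
    by auto
  then show ?case
    unfolding shuffle_prod.simps
    by (intro arg_cong2[where f = "(+)"] Cons.IH) auto
qed simp

lemma shuffle_prod_zero_left [simp]: "shuffle_prod (\<lambda>us. 0) b vs = 0"
  by (induction vs arbitrary: b) auto

lemma shuffle_prod_zero_right [simp]: "shuffle_prod a (\<lambda>us. 0) vs = 0"
  by (induction vs arbitrary: a) auto

lemma shuffle_prod_sum_left:
  "shuffle_prod (\<lambda>us. \<Sum>i\<in>I. r i * a i us) b vs = (\<Sum>i\<in>I. r i * shuffle_prod (a i) b vs)"
proof (induction vs arbitrary: a b)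
  case (Cons v vs)
  have "(\<lambda>us. (-1) ^ length us * (\<Sum>i\<in>I. r i * a i us)) =
      (\<lambda>us. \<Sum>i\<in>I. r i * ((-1) ^ length us * a i us))"
    by (simp add: sum_distrib_left mult_ac)
  then show ?case
    by (simp add: Cons.IH sum.distrib distrib_left)
qed (simp add: sum_distrib_left mult_ac)

lemma shuffle_prod_sum_right:
  "shuffle_prod a (\<lambda>us. \<Sum>i\<in>I. r i * b i us) vs = (\<Sum>i\<in>I. r i * shuffle_prod a (b i) vs)"
  by (induction vs arbitrary: a b) (simp_all add: sum_distrib_left sum.distrib distrib_left mult_ac)

lemma shuffle_prod_lincomb_left:
  "shuffle_prod (\<lambda>us. r * a us + s * a' us) b vs =
    r * shuffle_prod a b vs + s * shuffle_prod a' b vs"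
proof (induction vs arbitrary: a a' b)
  case (Cons v vs)
  have "(\<lambda>us. (-1) ^ length us * (r * a us + s * a' us)) =
      (\<lambda>us. r * ((-1) ^ length us * a us) + s * ((-1) ^ length us * a' us))"
    by (simp add: algebra_simps)
  then show ?case
    by (simp add: Cons.IH algebra_simps)
qed (simp add: algebra_simps)

lemma shuffle_prod_lincomb_right:
  "shuffle_prod a (\<lambda>us. r * b us + s * b' us) vs =
    r * shuffle_prod a b vs + s * shuffle_prod a b' vs"
  by (induction vs arbitrary: a b b') (simp_all add: algebra_simps)

lemma shuffle_prod_diff_left:
  "shuffle_prod (\<lambda>us. a us - a' us) b vs = shuffle_prod a b vs - shuffle_prod a' b vs"
  using shuffle_prod_lincomb_left[of 1 a "-1" a' b vs] by simp

lemma shuffle_prod_diff_right: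
  "shuffle_prod a (\<lambda>us. b us - b' us) vs = shuffle_prod a b vs - shuffle_prod a b' vs"
  using shuffle_prod_lincomb_right[of a 1 b "-1" b' vs] by simp

lemma shuffle_prod_scale_left:
  "shuffle_prod (\<lambda>us. r * a us) b vs = r * shuffle_prod a b vs"
  using shuffle_prod_lincomb_left[of r a 0 a b vs] by simp

lemma shuffle_prod_scale_right:
  "shuffle_prod a (\<lambda>us. r * b us) vs = r * shuffle_prod a b vs"
  using shuffle_prod_lincomb_right[of a r b 0 b vs] by simp

lemma shuffle_prod_uminus_left:
  "shuffle_prod (\<lambda>us. - a us) b vs = - shuffle_prod a b vs"
  using shuffle_prod_scale_left[of "-1" a b vs] by simp

lemma shuffle_prod_uminus_right:
  "shuffle_prod a (\<lambda>us. - b us) vs = - shuffle_prod a b vs"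
  using shuffle_prod_scale_right[of a "-1" b vs] by simp

lemma shuffle_prod_map:
  "shuffle_prod a b (map f vs) = shuffle_prod (\<lambda>us. a (map f us)) (\<lambda>us. b (map f us)) vs"
  by (induction vs arbitrary: a b) auto

text \<open>Every shuffle hands the offending argument to one of the factors, which then vanishes.
  This yields the default value 0 of a wedge product outside the tangent vectors.\<close>

lemma shuffle_prod_eq_0:
  assumes "\<And>us. \<not> set us \<subseteq> T \<Longrightarrow> a us = 0" "\<And>us. \<not> set us \<subseteq> T \<Longrightarrow> b us = 0" "\<not> set vs \<subseteq> T"
  shows "shuffle_prod a b vs = 0"
  using assms
proof (induction vs arbitrary: a b)
  case (Cons v vs)
  show ?case
  proof (cases "v \<in> T")
    case True
    with Cons.prems(3) have "\<not> set vs \<subseteq> T" by simp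
    then have "shuffle_prod (\<lambda>us. a (v # us)) b vs = 0"
      "shuffle_prod (\<lambda>us. (-1) ^ length us * a us) (\<lambda>us. b (v # us)) vs = 0"
      by (rule Cons.IH[rotated 2]; use Cons.prems(1,2) in simp)+
    then show ?thesis by simp
  next
    case False
    with Cons.prems show ?thesis by simp
  qed
qed simp

text \<open>A left factor of pure degree m leaves exactly k of the m + k arguments to the right
  factor. It allows an induction hypothesis that is available in a single degree to be used under a
  product.\<close>

lemma shuffle_prod_support:
  assumes "\<And>us. length us \<noteq> m \<Longrightarrow> a us = 0"
    and "\<And>us. length us = k \<Longrightarrow> b us = b' us"
    and "length vs = m + k"
  shows "shuffle_prod a b vs = shuffle_prod a b' vs"
  using assms
proof (induction vs arbitrary: m k a b b')
  case (Cons v vs)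
  have 1: "shuffle_prod (\<lambda>us. a (v # us)) b vs = shuffle_prod (\<lambda>us. a (v # us)) b' vs"
  proof (cases m)
    case 0
    then have "a (v # us) = 0" for us using Cons.prems(1) by simp
    then show ?thesis by simp
  next
    case (Suc m')
    show ?thesis
      by (rule Cons.IH[of m' _ k]) (use Cons.prems Suc in auto)
  qed
  have 2: "shuffle_prod (\<lambda>us. (-1) ^ length us * a us) (\<lambda>us. b (v # us)) vs =
      shuffle_prod (\<lambda>us. (-1) ^ length us * a us) (\<lambda>us. b' (v # us)) vs"
  proof (cases k)
    case 0
    \<comment> \<open>With k = 0 the remaining list has length m - 1, so \<open>a\<close> vanishes
      on all its sublists.\<close>
    have "shuffle_prod (\<lambda>us. (-1) ^ length us * a us) c vs = 0" for c
    proof -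
      have "shuffle_prod (\<lambda>us. (-1) ^ length us * a us) c vs = shuffle_prod (\<lambda>us. 0) c vs"
        by (rule shuffle_prod_cong) (use Cons.prems 0 in auto)
      then show ?thesis by simp
    qed
    then show ?thesis by simp
  next
    case (Suc k')
    show ?thesis
      by (rule Cons.IH[of m _ k']) (use Cons.prems Suc in auto)
  qed
  show ?case using 1 2 by simp
qed simp

text \<open>Covers both halves of multilinearity: r = s = 1 gives additivity and s = 0 homogeneity.
  The relation between z, x and y enters through its effect on \<open>a\<close> and
  \<open>b\<close>, as the argument type carries no algebraic structure here.\<close>

lemma shuffle_prod_slot:
  assumes "\<And>us ws. set us \<union> set ws \<subseteq> T \<Longrightarrow>
      a (us @ z # ws) = r * a (us @ x # ws) + s * a (us @ y # ws)"
    and "\<And>us ws. set us \<union> set ws \<subseteq> T \<Longrightarrow>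
      b (us @ z # ws) = r * b (us @ x # ws) + s * b (us @ y # ws)"
    and "set us \<union> set ws \<subseteq> T"
  shows "shuffle_prod a b (us @ z # ws) =
    r * shuffle_prod a b (us @ x # ws) + s * shuffle_prod a b (us @ y # ws)"
  using assms
proof (induction us arbitrary: a b)
  case Nil
  have "shuffle_prod (\<lambda>us. a (z # us)) b ws =
      shuffle_prod (\<lambda>us. r * a (x # us) + s * a (y # us)) b ws"
    by (rule shuffle_prod_cong) (use Nil.prems(1)[of "[]"] Nil.prems(3) in auto)
  moreover have "shuffle_prod c (\<lambda>us. b (z # us)) ws =
      shuffle_prod c (\<lambda>us. r * b (x # us) + s * b (y # us)) ws" for c
    by (rule shuffle_prod_cong) (use Nil.prems(2)[of "[]"] Nil.prems(3) in auto)
  ultimately show ?case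
    by (simp add: shuffle_prod_lincomb_left shuffle_prod_lincomb_right algebra_simps)
next
  case (Cons u us)
  have 1: "shuffle_prod (\<lambda>us. a (u # us)) b (us @ z # ws) =
    r * shuffle_prod (\<lambda>us. a (u # us)) b (us @ x # ws) + s * shuffle_prod (\<lambda>us. a (u # us)) b (us @ y # ws)"
  proof (rule Cons.IH)
    fix us' ws' assume "set us' \<union> set ws' \<subseteq> T"
    then show "a (u # us' @ z # ws') = r * a (u # us' @ x # ws') + s * a (u # us' @ y # ws')"
      using Cons.prems(1)[of "u # us'" ws'] Cons.prems(3) by simp
  qed (use Cons.prems in auto)
  have 2: "shuffle_prod (\<lambda>us. (-1) ^ length us * a us) (\<lambda>us. b (u # us)) (us @ z # ws) =
    r * shuffle_prod (\<lambda>us. (-1) ^ length us * a us) (\<lambda>us. b (u # us)) (us @ x # ws) +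
    s * shuffle_prod (\<lambda>us. (-1) ^ length us * a us) (\<lambda>us. b (u # us)) (us @ y # ws)"
  proof (rule Cons.IH)
    fix us' ws' assume T: "set us' \<union> set ws' \<subseteq> T"
    show "(-1) ^ length (us' @ z # ws') * a (us' @ z # ws') =
      r * ((-1) ^ length (us' @ x # ws') * a (us' @ x # ws')) +
      s * ((-1) ^ length (us' @ y # ws') * a (us' @ y # ws'))"
      using Cons.prems(1)[OF T] by (simp add: algebra_simps)
    show "b (u # us' @ z # ws') = r * b (u # us' @ x # ws') + s * b (u # us' @ y # ws')"
      using Cons.prems(2)[of "u # us'" ws'] Cons.prems(3) T by simp
  qed (use Cons.prems in auto)
  show ?case using 1 2 by (simp add: algebra_simps)
qed

text \<open>Shuffles that send both copies of v to one factor vanish by assumption; those that split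
  them come in pairs of opposite sign.\<close>

lemma shuffle_prod_adjacent:
  assumes "\<And>us v ws. set (us @ v # ws) \<subseteq> T \<Longrightarrow> a (us @ v # v # ws) = 0"
    and "\<And>us v ws. set (us @ v # ws) \<subseteq> T \<Longrightarrow> b (us @ v # v # ws) = 0"
    and "set (us @ v # ws) \<subseteq> T"
  shows "shuffle_prod a b (us @ v # v # ws) = 0"
  using assms
proof (induction us arbitrary: a b)
  case Nil
  have "shuffle_prod (\<lambda>us. a (v # v # us)) b ws = shuffle_prod (\<lambda>us. 0) b ws"
    by (rule shuffle_prod_cong) (use Nil.prems(1)[of "[]"] Nil.prems(3) in auto)
  moreover have "shuffle_prod c (\<lambda>us. b (v # v # us)) ws = shuffle_prod c (\<lambda>us. 0) ws" for c
    by (rule shuffle_prod_cong) (use Nil.prems(2)[of "[]"] Nil.prems(3) in auto)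
  ultimately show ?case
    by (simp add: shuffle_prod_uminus_left)
next
  case (Cons u us)
  have 1: "shuffle_prod (\<lambda>us. a (u # us)) b (us @ v # v # ws) = 0"
  proof (rule Cons.IH)
    fix us' v' ws' assume "set (us' @ v' # ws') \<subseteq> T"
    then show "a (u # us' @ v' # v' # ws') = 0"
      using Cons.prems(1)[of "u # us'" v' ws'] Cons.prems(3) by simp
  qed (use Cons.prems in auto)
  have 2: "shuffle_prod (\<lambda>us. (-1) ^ length us * a us) (\<lambda>us. b (u # us)) (us @ v # v # ws) = 0"
  proof (rule Cons.IH)
    fix us' v' ws' assume "set (us' @ v' # ws') \<subseteq> T"
    then show "b (u # us' @ v' # v' # ws') = 0"
      using Cons.prems(2)[of "u # us'" v' ws'] Cons.prems(3) by simp
  qed (use Cons.prems in auto)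
  show ?case using 1 2 by simp
qed

text \<open>Polarization: expand \<open>a\<close> with x + y in both adjacent slots. The set T
  stands for the tangent space, since additivity of a form is given on tangent vectors.\<close>

lemma alternating_swap:
  fixes a :: "'b::plus list \<Rightarrow> real"
  assumes add: "\<And>us ws x y. set us \<union> set ws \<subseteq> T \<Longrightarrow> x \<in> T \<Longrightarrow> y \<in> T \<Longrightarrow>
      a (us @ (x + y) # ws) = a (us @ x # ws) + a (us @ y # ws)"
    and adj: "\<And>us v ws. set (us @ v # ws) \<subseteq> T \<Longrightarrow> a (us @ v # v # ws) = 0"
    and closed: "\<And>x y. x \<in> T \<Longrightarrow> y \<in> T \<Longrightarrow> x + y \<in> T"
    and T: "set us \<subseteq> T" "x \<in> T" "y \<in> T" "set ws \<subseteq> T"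
  shows "a (us @ x # y # ws) = - a (us @ y # x # ws)"
proof -
  have "0 = a (us @ (x + y) # (x + y) # ws)"
    using adj[of us "x + y" ws] closed T by auto
  also have "\<dots> = a (us @ x # (x + y) # ws) + a (us @ y # (x + y) # ws)"
    using add[of us "(x + y) # ws" x y] closed T by auto
  also have "a (us @ x # (x + y) # ws) = a (us @ x # x # ws) + a (us @ x # y # ws)"
    using add[of "us @ [x]" ws x y] T by auto
  also have "a (us @ y # (x + y) # ws) = a (us @ y # x # ws) + a (us @ y # y # ws)"
    using add[of "us @ [y]" ws x y] T by auto
  finally show ?thesis
    using adj[of us x ws] adj[of us y ws] T by simp
qed

text \<open>Adjacent swaps move one of two equal entries next to the other, at the cost of a sign.
  Thus the recursive formulas have to be checked for adjacent repetitions alone.\<close>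

lemma alternating_not_distinct:
  fixes a :: "'b::plus list \<Rightarrow> real"
  assumes add: "\<And>us ws x y. set us \<union> set ws \<subseteq> T \<Longrightarrow> x \<in> T \<Longrightarrow> y \<in> T \<Longrightarrow>
      a (us @ (x + y) # ws) = a (us @ x # ws) + a (us @ y # ws)"
    and adj: "\<And>us v ws. set (us @ v # ws) \<subseteq> T \<Longrightarrow> a (us @ v # v # ws) = 0"
    and closed: "\<And>x y. x \<in> T \<Longrightarrow> y \<in> T \<Longrightarrow> x + y \<in> T"
    and vs: "\<not> distinct vs" "set vs \<subseteq> T"
  shows "a vs = 0"
proof -
  have "a (us @ y # xs @ y # ws) = 0" if "set (us @ y # xs @ ws) \<subseteq> T" for us xs y ws
    using that
  proof (induction xs arbitrary: us)
    case Nil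
    then show ?case using adj[of us y ws] by simp
  next
    case (Cons x xs)
    have "a (us @ y # x # xs @ y # ws) = - a (us @ x # y # xs @ y # ws)"
      by (rule alternating_swap[where T = T]) (use add adj closed Cons.prems in auto)
    also have "a (us @ x # y # xs @ y # ws) = 0"
      using Cons.IH[of "us @ [x]"] Cons.prems by auto
    finally show ?case by simp
  qed
  moreover obtain us xs ws y where "vs = us @ [y] @ xs @ [y] @ ws"
    using not_distinct_decomp[OF vs(1)] by blast
  ultimately show ?thesis using vs(2) by auto
qed

section \<open>Multilinear alternating forms on component vectors and Euler's identity\<close>

definition unit_vec :: "nat \<Rightarrow> nat \<Rightarrow> real" where
  "unit_vec i = (\<lambda>j. if j = i then 1 else 0)"

text \<open>Vectors are arbitrary functions on the naturals. The expansion in unit vectors encodes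
  additivity, homogeneity and independence of the components from index n on, all at once.\<close>

definition multilinear :: "nat \<Rightarrow> ((nat \<Rightarrow> real) list \<Rightarrow> real) \<Rightarrow> bool" where
  "multilinear n a \<longleftrightarrow>
     (\<forall>us u vs. a (us @ u # vs) = (\<Sum>i<n. u i * a (us @ unit_vec i # vs)))"

text \<open>The adjacent form of the condition is stable under fixing a leading argument, which is
  how Cartan's formula descends to shorter lists.\<close>

definition alternating :: "('b list \<Rightarrow> real) \<Rightarrow> bool" where
  "alternating a \<longleftrightarrow> (\<forall>us v vs. a (us @ v # v # vs) = 0)"

lemma multilinearD:
  "multilinear n a \<Longrightarrow> a (us @ u # vs) = (\<Sum>i<n. u i * a (us @ unit_vec i # vs))"
  unfolding multilinear_def by blast

lemma multilinear_Cons: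
  assumes "multilinear n a"
  shows "multilinear n (\<lambda>us. a (u # us))"
  unfolding multilinear_def
proof (intro allI)
  fix us v vs
  show "a (u # us @ v # vs) = (\<Sum>i<n. v i * a (u # us @ unit_vec i # vs))"
    using multilinearD[OF assms, of "u # us" v vs] by simp
qed

lemma alternatingD: "alternating a \<Longrightarrow> a (us @ v # v # vs) = 0"
  unfolding alternating_def by blast

lemma alternating_Cons: "alternating a \<Longrightarrow> alternating (\<lambda>us. a (u # us))"
  using alternatingD[of a "u # us" for us] by (auto simp: alternating_def)

lemma multilinear_add:
  assumes "multilinear n a"
  shows "a (us @ (x + y) # ws) = a (us @ x # ws) + a (us @ y # ws)"
  unfolding multilinearD[OF assms, of us "x + y"] multilinearD[OF assms, of us x]
    multilinearD[OF assms, of us y]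
  by (simp add: distrib_right sum.distrib)

lemma multilinear_alternating_swap:
  assumes "multilinear n a" "alternating a"
  shows "a (us @ x # y # ws) = - a (us @ y # x # ws)"
  by (rule alternating_swap[where T = UNIV])
    (use assms in \<open>auto intro: multilinear_add alternatingD\<close>)

definition dx :: "nat \<Rightarrow> (nat \<Rightarrow> real) list \<Rightarrow> real" where
  "dx i us = (case us of [u] \<Rightarrow> u i | _ \<Rightarrow> 0)"

lemma dx_length: "length us \<noteq> 1 \<Longrightarrow> dx i us = 0"
  by (auto simp: dx_def split: list.split)

text \<open>Each argument contributes one copy of \<open>a\<close>. For the leading v, the branch
  that feeds it to dx i sums to \<open>a (v # vs)\<close> by multilinearity. In the other branch two
  signs cancel, one from passing dx i and one from swapping v with the unit vector, and the identity
  for \<open>a\<close> with v fixed remains.\<close>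

lemma euler_identity:
  assumes "multilinear n a" "alternating a"
  shows "(\<Sum>i<n. shuffle_prod (dx i) (\<lambda>us. a (unit_vec i # us)) vs) = real (length vs) * a vs"
  using assms
proof (induction vs arbitrary: a)
  case Nil
  then show ?case by (simp add: dx_def)
next
  case (Cons v vs)
  have 1: "shuffle_prod (\<lambda>us. dx i (v # us)) b vs = v i * b vs" for i b
  proof -
    \<comment> \<open>After taking its argument, dx i is a constant supported on the empty list, and
      the shuffle product with it is multiplication by that constant.\<close>
    have "shuffle_prod (\<lambda>us. c * of_bool (us = [])) b vs = c * b vs" for c
    proof (induction vs arbitrary: b)
      case (Cons u us)
      have *: "(\<lambda>us. (-1) ^ length us * (c * of_bool (us = []))) = (\<lambda>us. c * of_bool (us = []))"
        by auto
      show ?case by (simp only: shuffle_prod.simps * Cons.IH) simp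
    qed simp
    moreover have "(\<lambda>us. dx i (v # us)) = (\<lambda>us. v i * of_bool (us = []))"
      by (auto simp: dx_def fun_eq_iff split: list.split)
    ultimately show ?thesis by simp
  qed
  have 2: "(\<lambda>us. (-1) ^ length us * dx i us) = (\<lambda>us. - dx i us)" for i
    by (auto simp: dx_def fun_eq_iff split: list.split)
  have "a (unit_vec i # v # us) = - a (v # unit_vec i # us)" for i us
    using multilinear_alternating_swap[OF Cons.prems, of "[]" "unit_vec i" v us] by simp
  then have "(\<Sum>i<n. shuffle_prod (dx i) (\<lambda>us. a (unit_vec i # us)) (v # vs)) =
    (\<Sum>i<n. v i * a (unit_vec i # vs)) +
    (\<Sum>i<n. shuffle_prod (dx i) (\<lambda>us. a (v # unit_vec i # us)) vs)"
    by (simp add: 1 2 shuffle_prod_uminus_left shuffle_prod_uminus_right sum.distrib)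
  also have "(\<Sum>i<n. v i * a (unit_vec i # vs)) = a (v # vs)"
    using multilinearD[OF Cons.prems(1), of "[]" v vs] by simp
  also have "(\<Sum>i<n. shuffle_prod (dx i) (\<lambda>us. a (v # unit_vec i # us)) vs) =
    real (length vs) * a (v # vs)"
    by (rule Cons.IH) (use Cons.prems in \<open>auto intro: multilinear_Cons alternating_Cons\<close>)
  finally show ?case by (simp add: algebra_simps)
qed

section \<open>Calculus along coordinate lines\<close>

text \<open>The differentiability clause of \<open>Ck_on\<close>. It is carried along with every
  computation because \<open>partial\<close> is built on the total function \<open>deriv\<close> and
  is a genuine derivative only under this condition.\<close>

definition line_differentiable :: "nat \<Rightarrow> ((nat \<Rightarrow> real) \<Rightarrow> real) \<Rightarrow> (nat \<Rightarrow> real) \<Rightarrow> bool" where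
  "line_differentiable j f p \<longleftrightarrow> (\<lambda>t. f (p(j := t))) differentiable (at (p j))"

lemma line_differentiable_deriv:
  assumes "line_differentiable j f p"
  shows "((\<lambda>t. f (p(j := t))) has_real_derivative partial j f p) (at (p j))"
  using assms DERIV_deriv_iff_real_differentiable
  unfolding line_differentiable_def partial_def by blast

lemma line_differentiable_deriv':
  assumes "line_differentiable j f (p(j := t))"
  shows "((\<lambda>t. f (p(j := t))) has_real_derivative partial j f (p(j := t))) (at t)"
  using line_differentiable_deriv[OF assms] by simp

lemma line_derivI:
  assumes "((\<lambda>t. f (p(j := t))) has_real_derivative D) (at (p j))"
  shows "line_differentiable j f p" "partial j f p = D"
  using assms DERIV_imp_deriv real_differentiable_def
  unfolding line_differentiable_def partial_def by blast+

lemma line_deriv_cong: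
  assumes "\<forall>\<^sub>F t in nhds (p j). f (p(j := t)) = g (p(j := t))"
  shows "line_differentiable j f p \<longleftrightarrow> line_differentiable j g p"
    and "partial j f p = partial j g p"
proof -
  have *: "((\<lambda>t. f (p(j := t))) has_real_derivative D) (at (p j)) \<longleftrightarrow>
      ((\<lambda>t. g (p(j := t))) has_real_derivative D) (at (p j))" for D
    using assms by (intro DERIV_cong_ev) auto
  show "line_differentiable j f p \<longleftrightarrow> line_differentiable j g p"
    using * by (simp add: line_differentiable_def real_differentiable_def)
  show "partial j f p = partial j g p"
    using * by (simp add: partial_def deriv_def)
qed

lemma line_deriv_const:
  "line_differentiable j (\<lambda>p. c) p" "partial j (\<lambda>p. c) p = 0"
  using line_derivI[of "\<lambda>p. c" p j 0] by auto

lemma line_deriv_add: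
  assumes "line_differentiable j f p" "line_differentiable j g p"
  shows "line_differentiable j (\<lambda>p. f p + g p) p"
    "partial j (\<lambda>p. f p + g p) p = partial j f p + partial j g p"
  using line_derivI[OF DERIV_add[OF assms[THEN line_differentiable_deriv]]] by auto

lemma line_deriv_diff:
  assumes "line_differentiable j f p" "line_differentiable j g p"
  shows "line_differentiable j (\<lambda>p. f p - g p) p"
    "partial j (\<lambda>p. f p - g p) p = partial j f p - partial j g p"
  using line_derivI[OF DERIV_diff[OF assms[THEN line_differentiable_deriv]]] by auto

lemma line_deriv_mult:
  assumes "line_differentiable j f p" "line_differentiable j g p"
  shows "line_differentiable j (\<lambda>p. f p * g p) p"
    "partial j (\<lambda>p. f p * g p) p = partial j f p * g p + f p * partial j g p"
  using line_derivI[OF DERIV_mult[OF assms[THEN line_differentiable_deriv]]]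
  by (auto simp: mult_ac)

lemma line_deriv_cmult:
  assumes "line_differentiable j f p"
  shows "line_differentiable j (\<lambda>p. c * f p) p"
    "partial j (\<lambda>p. c * f p) p = c * partial j f p"
  using line_derivI[OF DERIV_cmult[OF assms[THEN line_differentiable_deriv]]] by auto

lemma line_deriv_sum:
  assumes "\<And>i. i \<in> I \<Longrightarrow> line_differentiable j (f i) p"
  shows "line_differentiable j (\<lambda>p. \<Sum>i\<in>I. f i p) p"
    "partial j (\<lambda>p. \<Sum>i\<in>I. f i p) p = (\<Sum>i\<in>I. partial j (f i) p)"
proof -
  have "((\<lambda>t. \<Sum>i\<in>I. f i (p(j := t))) has_real_derivative (\<Sum>i\<in>I. partial j (f i) p)) (at (p j))"
    using assms by (intro DERIV_sum line_differentiable_deriv)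
  then show "line_differentiable j (\<lambda>p. \<Sum>i\<in>I. f i p) p"
    "partial j (\<lambda>p. \<Sum>i\<in>I. f i p) p = (\<Sum>i\<in>I. partial j (f i) p)"
    by (rule line_derivI)+
qed

lemma line_deriv_coord:
  "line_differentiable j (\<lambda>p. p i) p" "partial j (\<lambda>p. p i) p = (if i = j then 1 else 0)"
proof -
  have "((\<lambda>t. (p(j := t)) i) has_real_derivative (if i = j then 1 else 0)) (at (p j))"
    by (cases "i = j") auto
  then show "line_differentiable j (\<lambda>p. p i) p" "partial j (\<lambda>p. p i) p = (if i = j then 1 else 0)"
    by (rule line_derivI)+
qed

section \<open>Box neighbourhoods in n-space and locality of partial derivatives\<close>

definition box_nhd :: "nat \<Rightarrow> (nat \<Rightarrow> real) \<Rightarrow> real \<Rightarrow> (nat \<Rightarrow> real) set" where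
  "box_nhd n p d = {x. (\<forall>i\<ge>n. x i = 0) \<and> (\<forall>i<n. \<bar>x i - p i\<bar> < d)}"

text \<open>The product topology supplies a radius for every index. From n on both points are 0, so
  the minimum over the finitely many indices below n does.\<close>

lemma openin_Euclidean_space_box:
  assumes "openin (Euclidean_space n) V" "p \<in> V"
  shows "\<exists>d>0. box_nhd n p d \<subseteq> V"
proof -
  obtain U where U: "openin (powertop_real UNIV) U" "V = U \<inter> {x. \<forall>i\<ge>n. x i = 0}"
    using assms(1) unfolding Euclidean_space_def openin_subtopology by blast
  have "p \<in> U" using assms(2) U(2) by simp
  with U(1)[unfolded openin_product_topology_alt] obtain X where
    X: "\<forall>i\<in>UNIV. openin euclideanreal (X i)" "p \<in> Pi\<^sub>E UNIV X" "Pi\<^sub>E UNIV X \<subseteq> U"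
    by (auto dest!: bspec[of U _ p])
  have "\<exists>d>0. ball (p i) d \<subseteq> X i" for i
  proof -
    have "open (X i)" "p i \<in> X i" using X(1,2) by auto
    then show ?thesis unfolding open_contains_ball by blast
  qed
  then obtain d where d: "\<forall>i. d i > 0 \<and> ball (p i) (d i) \<subseteq> X i"
    by metis
  \<comment> \<open>The element 1 keeps the set nonempty when n = 0.\<close>
  define m where "m = Min (insert 1 (d ` {..<n}))"
  have m_le: "m \<le> d i" if "i < n" for i
    using that by (auto simp: m_def)
  have "m > 0" using d by (auto simp: m_def)
  moreover have "box_nhd n p m \<subseteq> V"
  proof
    fix x assume x: "x \<in> box_nhd n p m"
    have "x i \<in> X i" for i
    proof (cases "i < n")
      case True
      then have "x i \<in> ball (p i) (d i)"
        using x m_le[OF True] less_le_trans by (fastforce simp: box_nhd_def dist_real_def abs_minus_commute)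
      then show ?thesis using d by blast
    next
      case False
      then have "x i = p i"
        using x U(2) assms(2) by (auto simp: box_nhd_def)
      then show ?thesis using X(2) by (auto simp: PiE_def)
    qed
    then have "x \<in> U" using X(3) by (auto simp: PiE_def)
    then show "x \<in> V" using x U(2) by (auto simp: box_nhd_def)
  qed
  ultimately show ?thesis by blast
qed

lemma continuous_map_box:
  assumes "continuous_map (subtopology (Euclidean_space n) V) euclideanreal f"
    "openin (Euclidean_space n) V" "p \<in> V" "e > 0"
  shows "\<exists>d>0. \<forall>x\<in>box_nhd n p d. x \<in> V \<and> \<bar>f x - f p\<bar> < e"
proof -
  let ?X = "subtopology (Euclidean_space n) V"
  have "openin ?X {x \<in> topspace ?X. f x \<in> ball (f p) e}"
    by (rule openin_continuous_map_preimage[OF assms(1)]) auto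
  moreover have "topspace ?X = V"
    using openin_subset[OF assms(2)] by auto
  ultimately have *: "openin (Euclidean_space n) {x \<in> V. f x \<in> ball (f p) e}"
    by (simp only: openin_open_subtopology[OF assms(2)])
  have "p \<in> {x \<in> V. f x \<in> ball (f p) e}" using assms(3,4) by auto
  from openin_Euclidean_space_box[OF * this]
  obtain d where "d > 0" "box_nhd n p d \<subseteq> {x \<in> V. dist (f x) (f p) < e}"
    by (auto simp: dist_commute)
  then show ?thesis by (auto simp: dist_real_def)
qed

lemma openin_Euclidean_space_line:
  assumes "openin (Euclidean_space n) V" "p \<in> V" "j < n"
  shows "\<forall>\<^sub>F t in nhds (p j). p(j := t) \<in> V"
proof -
  obtain d where d: "d > 0" "box_nhd n p d \<subseteq> V"
    using openin_Euclidean_space_box[OF assms(1,2)] by blast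
  have "\<forall>i\<ge>n. p i = 0"
    using openin_subset[OF assms(1)] assms(2) by (auto simp: topspace_Euclidean_space)
  then have "p(j := t) \<in> box_nhd n p d" if "dist t (p j) < d" for t
    using assms(3) that d(1) by (auto simp: box_nhd_def dist_real_def)
  then show ?thesis
    using d unfolding eventually_nhds_metric by blast
qed

lemma line_deriv_cong_open:
  assumes "openin (Euclidean_space n) V" "p \<in> V" "j < n" "\<And>x. x \<in> V \<Longrightarrow> f x = g x"
  shows "line_differentiable j f p \<longleftrightarrow> line_differentiable j g p"
    and "partial j f p = partial j g p"
proof -
  have "\<forall>\<^sub>F t in nhds (p j). f (p(j := t)) = g (p(j := t))"
    using eventually_mono[OF openin_Euclidean_space_line[OF assms(1-3)] assms(4)] .
  then show "line_differentiable j f p \<longleftrightarrow> line_differentiable j g p" "partial j f p = partial j g p"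
    by (rule line_deriv_cong)+
qed

section \<open>Arithmetic of C^k and smooth functions\<close>

lemma Ck_on_continuous:
  "Ck_on n k V f \<Longrightarrow> continuous_map (subtopology (Euclidean_space n) V) euclideanreal f"
  by (cases k) auto

lemma Ck_on_Suc_D:
  assumes "Ck_on n (Suc k) V f" "j < n"
  shows "p \<in> V \<Longrightarrow> line_differentiable j f p" "Ck_on n k V (partial j f)"
  using assms by (auto simp: line_differentiable_def)

text \<open>Openness is what lets equality on V pass to the partial derivatives, and hence to the
  next stage of the induction.\<close>

lemma Ck_on_cong:
  assumes "openin (Euclidean_space n) V" "\<And>x. x \<in> V \<Longrightarrow> f x = g x" "Ck_on n k V f"
  shows "Ck_on n k V g"
  using assms(2,3)
proof (induction k arbitrary: f g)
  case 0
  then show ?case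
    using openin_subset[OF assms(1)] by (auto elim!: continuous_map_eq)
next
  case (Suc k)
  have "topspace (subtopology (Euclidean_space n) V) \<subseteq> V" by auto
  then have "continuous_map (subtopology (Euclidean_space n) V) euclideanreal g"
    using continuous_map_eq[OF Ck_on_continuous[OF Suc.prems(2)], of g] Suc.prems(1) by blast
  moreover have "Ck_on n k V (partial j g)" if j: "j < n" for j
    by (rule Suc.IH[OF line_deriv_cong_open(2)[OF assms(1) _ j Suc.prems(1)]
          Ck_on_Suc_D(2)[OF Suc.prems(2) j]])
  moreover have "line_differentiable j g p" if j: "j < n" and p: "p \<in> V" for j p
    using line_deriv_cong_open(1)[OF assms(1) p j, of f g] Suc.prems(1)
      Ck_on_Suc_D(1)[OF Suc.prems(2) j p] by blast
  ultimately show ?case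
    by (simp add: line_differentiable_def)
qed

lemma Ck_on_Suc_imp: "Ck_on n (Suc k) V f \<Longrightarrow> Ck_on n k V f"
proof (induction k arbitrary: f)
  case (Suc k)
  then have "Ck_on n k V (partial j f)" if "j < n" for j
    using that by (intro Suc.IH) (auto simp del: Ck_on.simps dest: Ck_on_Suc_D)
  with Suc.prems show ?case by simp
qed simp

lemma Ck_on_const: "Ck_on n k V (\<lambda>x. c)"
proof (induction k arbitrary: c)
  case (Suc k)
  have "partial j (\<lambda>x. c) = (\<lambda>x. 0)" for j by (simp add: fun_eq_iff line_deriv_const)
  then show ?case using Suc by simp
qed simp

lemma Ck_on_add:
  assumes V: "openin (Euclidean_space n) V"
  shows "Ck_on n k V f \<Longrightarrow> Ck_on n k V g \<Longrightarrow> Ck_on n k V (\<lambda>x. f x + g x)"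
proof (induction k arbitrary: f g)
  case 0
  then show ?case by (auto intro: continuous_map_add)
next
  case (Suc k)
  note D = Ck_on_Suc_D[OF Suc.prems(1)] Ck_on_Suc_D[OF Suc.prems(2)]
  have "Ck_on n k V (partial j (\<lambda>x. f x + g x))" if "j < n" for j
    by (rule Ck_on_cong[OF V _ Suc.IH[OF D(2,4)]]) (use that D in \<open>auto simp: line_deriv_add\<close>)
  moreover have "line_differentiable j (\<lambda>x. f x + g x) p" if "j < n" "p \<in> V" for j p
    using D that by (auto intro: line_deriv_add)
  moreover have "continuous_map (subtopology (Euclidean_space n) V) euclideanreal (\<lambda>x. f x + g x)"
    using Suc.prems[THEN Ck_on_continuous] by (auto intro: continuous_map_add)
  ultimately show ?case by (auto simp: line_differentiable_def)
qed

lemma Ck_on_mult: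
  assumes V: "openin (Euclidean_space n) V"
  shows "Ck_on n k V f \<Longrightarrow> Ck_on n k V g \<Longrightarrow> Ck_on n k V (\<lambda>x. f x * g x)"
proof (induction k arbitrary: f g)
  case 0
  then show ?case by (auto intro: continuous_map_real_mult)
next
  case (Suc k)
  note D = Ck_on_Suc_D[OF Suc.prems(1)] Ck_on_Suc_D[OF Suc.prems(2)]
  have "Ck_on n k V (partial j (\<lambda>x. f x * g x))" if "j < n" for j
    by (rule Ck_on_cong[OF V _ Ck_on_add[OF V Suc.IH[OF D(2) Ck_on_Suc_imp[OF Suc.prems(2)]]
          Suc.IH[OF Ck_on_Suc_imp[OF Suc.prems(1)] D(4)]]])
      (use that D in \<open>auto simp: line_deriv_mult\<close>)
  moreover have "line_differentiable j (\<lambda>x. f x * g x) p" if "j < n" "p \<in> V" for j p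
    using D that by (auto intro: line_deriv_mult)
  moreover have "continuous_map (subtopology (Euclidean_space n) V) euclideanreal (\<lambda>x. f x * g x)"
    using Suc.prems[THEN Ck_on_continuous] by (auto intro: continuous_map_real_mult)
  ultimately show ?case by (auto simp: line_differentiable_def)
qed

lemma smooth_on_D:
  assumes "smooth_on n V f" "j < n"
  shows "p \<in> V \<Longrightarrow> line_differentiable j f p" "smooth_on n V (partial j f)"
proof -
  have Ck: "Ck_on n (Suc k) V f" for k using assms(1) unfolding smooth_on_def by blast
  show "p \<in> V \<Longrightarrow> line_differentiable j f p"
    by (rule Ck_on_Suc_D(1)[OF Ck assms(2)])
  show "smooth_on n V (partial j f)"
    unfolding smooth_on_def using Ck_on_Suc_D(2)[OF Ck assms(2)] by blast
qed

lemma smooth_on_cong: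
  "openin (Euclidean_space n) V \<Longrightarrow> (\<And>x. x \<in> V \<Longrightarrow> f x = g x) \<Longrightarrow> smooth_on n V f \<Longrightarrow> smooth_on n V g"
  unfolding smooth_on_def using Ck_on_cong by blast

lemma smooth_on_const: "smooth_on n V (\<lambda>x. c)"
  by (simp add: smooth_on_def Ck_on_const)

lemma smooth_on_add:
  "openin (Euclidean_space n) V \<Longrightarrow> smooth_on n V f \<Longrightarrow> smooth_on n V g \<Longrightarrow>
    smooth_on n V (\<lambda>x. f x + g x)"
  by (simp add: smooth_on_def Ck_on_add)

lemma smooth_on_mult:
  "openin (Euclidean_space n) V \<Longrightarrow> smooth_on n V f \<Longrightarrow> smooth_on n V g \<Longrightarrow>
    smooth_on n V (\<lambda>x. f x * g x)"
  by (simp add: smooth_on_def Ck_on_mult)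

lemma smooth_on_sum:
  assumes "openin (Euclidean_space n) V" "\<And>i. i \<in> I \<Longrightarrow> smooth_on n V (f i)"
  shows "smooth_on n V (\<lambda>x. \<Sum>i\<in>I. f i x)"
  using assms(2)
  by (induction I rule: infinite_finite_induct) (auto intro: smooth_on_const smooth_on_add assms(1))

section \<open>Symmetry of second derivatives and the chain rule\<close>

lemma mean_value_closed_segment:
  fixes h :: "real \<Rightarrow> real"
  assumes "\<And>t. t \<in> closed_segment a b \<Longrightarrow> (h has_real_derivative h' t) (at t)"
  shows "\<exists>t\<in>closed_segment a b. h b - h a = (b - a) * h' t"
proof (cases a b rule: linorder_cases)
  case less
  with MVT2[of a b h h'] assms show ?thesis
    by (fastforce simp: closed_segment_eq_real_ivl)
next
  case equal
  then show ?thesis by auto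
next
  case greater
  with MVT2[of b a h h'] assms obtain t where "b < t" "t < a" "h a - h b = (a - b) * h' t"
    by (auto simp: closed_segment_eq_real_ivl)
  then show ?thesis
    by (intro bexI[of _ t]) (auto simp: closed_segment_eq_real_ivl algebra_simps)
qed

text \<open>The mean value theorem is applied first in direction i, then in direction j. The
  left-hand side is symmetric in i and j while the order of the derivatives on the right is not,
  which is the source of \<open>partial_commute\<close>.\<close>

lemma second_difference:
  assumes box: "box_nhd n p d \<subseteq> V" "\<forall>k\<ge>n. p k = 0" and f: "Ck_on n (Suc (Suc 0)) V f"
    and ij: "i < n" "j < n" "i \<noteq> j" and h: "0 < h" "h < d"
  shows "\<exists>x\<in>box_nhd n p d. f (p(i := p i + h, j := p j + h)) - f (p(i := p i + h)) -
      f (p(j := p j + h)) + f p = h * h * partial j (partial i f) x"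
proof -
  have mem: "p(i := s, j := t) \<in> box_nhd n p d"
    if "s \<in> {p i..p i + h}" "t \<in> {p j..p j + h}" for s t
    using that ij h box(2) by (auto simp: box_nhd_def)
  have mem_j: "p(i := s, j := p j + h) \<in> V" "p(i := s) \<in> V" if "s \<in> {p i..p i + h}" for s
    using mem[OF that, of "p j + h"] mem[OF that, of "p j"] h box(1) ij
    by (auto simp: fun_upd_idem subset_iff)
  have Di: "((\<lambda>s. f (p(i := s, j := p j + h)) - f (p(i := s))) has_real_derivative
      partial i f (p(i := s, j := p j + h)) - partial i f (p(i := s))) (at s)"
    if s: "s \<in> {p i..p i + h}" for s
  proof (rule DERIV_diff)
    have *: "p(i := s, j := p j + h) = p(j := p j + h, i := s)" for s
      using ij by (simp add: fun_upd_twist)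
    have "line_differentiable i f (p(j := p j + h, i := s))"
      using Ck_on_Suc_D(1)[OF f ij(1) mem_j(1)[OF s]] by (simp add: *)
    then show "((\<lambda>s. f (p(i := s, j := p j + h))) has_real_derivative
      partial i f (p(i := s, j := p j + h))) (at s)"
      using line_differentiable_deriv' unfolding * by blast
    show "((\<lambda>s. f (p(i := s))) has_real_derivative partial i f (p(i := s))) (at s)"
      using line_differentiable_deriv'[OF Ck_on_Suc_D(1)[OF f ij(1) mem_j(2)[OF s]]] .
  qed
  have "\<exists>s>p i. s < p i + h \<and>
     (f (p(i := p i + h, j := p j + h)) - f (p(i := p i + h))) -
     (f (p(i := p i, j := p j + h)) - f (p(i := p i))) =
     (p i + h - p i) * (partial i f (p(i := s, j := p j + h)) - partial i f (p(i := s)))"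
    by (rule MVT2, use h in simp) (rule Di, simp)
  then obtain s where s: "s \<in> {p i..p i + h}" and mvt:
    "(f (p(i := p i + h, j := p j + h)) - f (p(i := p i + h))) -
     (f (p(i := p i, j := p j + h)) - f (p(i := p i))) =
     (p i + h - p i) * (partial i f (p(i := s, j := p j + h)) - partial i f (p(i := s)))"
    by (auto dest: less_imp_le)
  have eq_s: "f (p(i := p i + h, j := p j + h)) - f (p(i := p i + h)) - f (p(j := p j + h)) + f p =
      h * (partial i f (p(i := s, j := p j + h)) - partial i f (p(i := s)))"
    using mvt by simp
  have "\<exists>t>p j. t < p j + h \<and>
     partial i f (p(i := s, j := p j + h)) - partial i f (p(i := s, j := p j)) =
     (p j + h - p j) * partial j (partial i f) (p(i := s, j := t))"
  proof (rule MVT2)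
    fix t assume "p j \<le> t" "t \<le> p j + h"
    then have "p(i := s, j := t) \<in> V" using mem s box(1) by auto
    then have "line_differentiable j (partial i f) (p(i := s, j := t))"
      using Ck_on_Suc_D(1)[OF Ck_on_Suc_D(2)[OF f ij(1)] ij(2)] by blast
    then show "((\<lambda>t. partial i f (p(i := s, j := t))) has_real_derivative
        partial j (partial i f) (p(i := s, j := t))) (at t)"
      by (rule line_differentiable_deriv')
  qed (use h in auto)
  moreover have "p(i := s, j := p j) = p(i := s)"
    using ij by (simp add: fun_upd_idem)
  ultimately obtain t where t: "t \<in> {p j..p j + h}" and eq_t:
    "partial i f (p(i := s, j := p j + h)) - partial i f (p(i := s)) =
      h * partial j (partial i f) (p(i := s, j := t))"
    by (auto dest: less_imp_le)
  show ?thesis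
    by (rule bexI[OF _ mem[OF s t]]) (simp add: eq_s eq_t)
qed

text \<open>Schwarz's theorem: over a small square the two mixed derivatives, taken at suitable
  points, equal the same difference quotient. Continuity then brings their values at p within 2 e of
  each other.\<close>

lemma partial_commute:
  assumes V: "openin (Euclidean_space n) V" and p: "p \<in> V" and f: "Ck_on n (Suc (Suc 0)) V f"
    and ij: "i < n" "j < n"
  shows "partial i (partial j f) p = partial j (partial i f) p"
proof (cases "i = j")
  case False
  let ?A = "partial i (partial j f)" and ?B = "partial j (partial i f)"
  have cont: "continuous_map (subtopology (Euclidean_space n) V) euclideanreal ?A"
    "continuous_map (subtopology (Euclidean_space n) V) euclideanreal ?B"
    using ij f by auto
  have "\<bar>?A p - ?B p\<bar> < e + e" if "e > 0" for e
  proof -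
    obtain d where d: "d > 0" "\<And>x. x \<in> box_nhd n p d \<Longrightarrow> x \<in> V \<and> \<bar>?A x - ?A p\<bar> < e"
      using continuous_map_box[OF cont(1) V p \<open>e > 0\<close>] by blast
    obtain d' where d': "d' > 0" "\<And>x. x \<in> box_nhd n p d' \<Longrightarrow> x \<in> V \<and> \<bar>?B x - ?B p\<bar> < e"
      using continuous_map_box[OF cont(2) V p \<open>e > 0\<close>] by blast
    define h where "h = min d d' / 2"
    have h: "0 < h" "h < d" "h < d'" using d d' by (auto simp: h_def)
    have p0: "\<forall>k\<ge>n. p k = 0"
      using openin_subset[OF V] p by (auto simp: topspace_Euclidean_space)
    obtain x where x: "x \<in> box_nhd n p d'"
      "f (p(i := p i + h, j := p j + h)) - f (p(i := p i + h)) - f (p(j := p j + h)) + f p =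
        h * h * ?B x"
      using second_difference[OF _ p0 f ij False h(1,3)] d'(2) by blast
    obtain y where y: "y \<in> box_nhd n p d"
      "f (p(j := p j + h, i := p i + h)) - f (p(j := p j + h)) - f (p(i := p i + h)) + f p =
        h * h * ?A y"
      using second_difference[OF _ p0 f ij(2,1) False[symmetric] h(1,2)] d(2) by blast
    have "h * h * ?A y = h * h * ?B x"
      unfolding x(2)[symmetric] y(2)[symmetric] fun_upd_twist[OF False, of p "p i + h" "p j + h"]
      by linarith
    then have "?A y = ?B x" using h(1) by simp
    then show ?thesis using d(2)[OF y(1)] d'(2)[OF x(1)] by linarith
  qed
  \<comment> \<open>With e half the difference, a nonzero difference would be smaller than
    itself.\<close>
  from this[of "\<bar>?A p - ?B p\<bar> / 2"] show ?thesis by auto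
qed simp

text \<open>The increment of f is split into n steps parallel to the axes, each treated by the mean
  value theorem; continuity of the partial derivatives gives the limit. The curve stays in n-space
  near t0, so that the last step ends exactly at its point.\<close>

lemma chain_rule:
  assumes V: "openin (Euclidean_space n) V" and f: "Ck_on n (Suc 0) V f" and p: "\<gamma> t0 \<in> V"
    and \<gamma>: "\<And>i. i < n \<Longrightarrow> ((\<lambda>t. \<gamma> t i) has_real_derivative \<gamma>' i) (at t0)"
    and zero: "\<forall>\<^sub>F t in nhds t0. \<forall>i\<ge>n. \<gamma> t i = 0"
  shows "((\<lambda>t. f (\<gamma> t)) has_real_derivative (\<Sum>i<n. partial i f (\<gamma> t0) * \<gamma>' i)) (at t0)"
proof -
  let ?p = "\<gamma> t0"
  \<comment> \<open>The path of axis-parallel steps: the first k coordinates have already moved to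
    those of the curve at t, the others are still at the base point.\<close>
  define z where "z k t = (\<lambda>i. if i < k then \<gamma> t i else ?p i)" for k :: nat and t
  have p0: "\<forall>i\<ge>n. ?p i = 0"
    using openin_subset[OF V] p by (auto simp: topspace_Euclidean_space)
  obtain d where d: "d > 0" "box_nhd n ?p d \<subseteq> V"
    using openin_Euclidean_space_box[OF V p] by blast
  have near: "\<forall>\<^sub>F t in at t0. \<forall>i<n. \<bar>\<gamma> t i - ?p i\<bar> < e" if "e > 0" for e
  proof -
    have "\<forall>\<^sub>F t in at t0. \<bar>\<gamma> t i - ?p i\<bar> < e" if "i < n" for i
    proof -
      have "((\<lambda>t. \<gamma> t i) \<longlongrightarrow> ?p i) (at t0)"
        using DERIV_isCont[OF \<gamma>[OF that]] by (simp add: isCont_def)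
      then show ?thesis
        using \<open>e > 0\<close> by (simp add: tendsto_iff dist_real_def)
    qed
    then have "\<forall>i\<in>{..<n}. \<forall>\<^sub>F t in at t0. \<bar>\<gamma> t i - ?p i\<bar> < e" by simp
    then have "\<forall>\<^sub>F t in at t0. \<forall>i\<in>{..<n}. \<bar>\<gamma> t i - ?p i\<bar> < e"
      by (intro eventually_ball_finite) auto
    then show ?thesis by (auto elim: eventually_mono)
  qed
  have zero': "\<forall>\<^sub>F t in at t0. \<forall>i\<ge>n. \<gamma> t i = 0"
    using zero by (simp add: eventually_nhds_conv_at)
  have step: "\<exists>x. (\<forall>i\<ge>n. x i = 0) \<and> (\<forall>i<n. \<bar>x i - ?p i\<bar> \<le> \<bar>\<gamma> t i - ?p i\<bar>) \<and>
      f (z (Suc k) t) - f (z k t) = (\<gamma> t k - ?p k) * partial k f x"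
    if t: "\<forall>i<n. \<bar>\<gamma> t i - ?p i\<bar> < d" and k: "k < n" for t k
  proof -
    have bd: "\<bar>((z k t)(k := s)) i - ?p i\<bar> \<le> \<bar>\<gamma> t i - ?p i\<bar>"
      if "s \<in> closed_segment (?p k) (\<gamma> t k)" for s i
      using that by (auto simp: z_def closed_segment_eq_real_ivl split: if_splits)
    have z0: "\<forall>i\<ge>n. ((z k t)(k := s)) i = 0" for s
      using k p0 by (auto simp: z_def)
    have "((\<lambda>s. f ((z k t)(k := s))) has_real_derivative partial k f ((z k t)(k := s))) (at s)"
      if s: "s \<in> closed_segment (?p k) (\<gamma> t k)" for s
    proof -
      have "(z k t)(k := s) \<in> box_nhd n ?p d"
        using z0 bd[OF s] t unfolding box_nhd_def by (blast intro: le_less_trans)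
      then have "line_differentiable k f ((z k t)(k := s))"
        using Ck_on_Suc_D(1)[OF f k] d by blast
      then show ?thesis by (rule line_differentiable_deriv')
    qed
    \<comment> \<open>Coordinate k may move in either direction or stay where it is, hence the mean
      value theorem without an ordering of the end points.\<close>
    from mean_value_closed_segment[OF this, of "?p k" "\<gamma> t k"]
    obtain s where s: "s \<in> closed_segment (?p k) (\<gamma> t k)"
      "f ((z k t)(k := \<gamma> t k)) - f ((z k t)(k := ?p k)) =
        (\<gamma> t k - ?p k) * partial k f ((z k t)(k := s))"
      by blast
    moreover have "(z k t)(k := \<gamma> t k) = z (Suc k) t" "(z k t)(k := ?p k) = z k t"
      by (auto simp: z_def fun_eq_iff)
    ultimately show ?thesis
      using z0 bd[OF s(1)] by (intro exI[of _ "(z k t)(k := s)"]) simp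
  qed
  define good where "good t k x \<longleftrightarrow> (\<forall>i\<ge>n. x i = 0) \<and> (\<forall>i<n. \<bar>x i - ?p i\<bar> \<le> \<bar>\<gamma> t i - ?p i\<bar>) \<and>
      f (z (Suc k) t) - f (z k t) = (\<gamma> t k - ?p k) * partial k f x" for t k x
  \<comment> \<open>The intermediate points are chosen as functions of t, so that their limit at t0
    can be taken.\<close>
  define \<xi> where "\<xi> t k = (SOME x. good t k x)" for t k
  have good: "good t k (\<xi> t k)" if "\<forall>i<n. \<bar>\<gamma> t i - ?p i\<bar> < d" "k < n" for t k
    using someI_ex[of "good t k"] step[OF that] unfolding \<xi>_def good_def by blast
  have lim: "((\<lambda>t. partial k f (\<xi> t k)) \<longlongrightarrow> partial k f ?p) (at t0)" if k: "k < n" for k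
    unfolding tendsto_iff dist_real_def
  proof (intro allI impI)
    fix e :: real assume "e > 0"
    have "continuous_map (subtopology (Euclidean_space n) V) euclideanreal (partial k f)"
      using Ck_on_Suc_D(2)[OF f k] by simp
    from continuous_map_box[OF this V p \<open>e > 0\<close>] obtain d' where d':
      "d' > 0" "\<And>x. x \<in> box_nhd n ?p d' \<Longrightarrow> \<bar>partial k f x - partial k f ?p\<bar> < e" by blast
    show "\<forall>\<^sub>F t in at t0. \<bar>partial k f (\<xi> t k) - partial k f ?p\<bar> < e"
      using near[OF d(1)] near[OF d'(1)]
    proof eventually_elim
      case (elim t)
      then have "\<xi> t k \<in> box_nhd n ?p d'"
        using good[OF elim(1) k] unfolding good_def box_nhd_def by (blast intro: le_less_trans)
      then show ?case by (rule d'(2))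
    qed
  qed
  have "((\<lambda>t. \<Sum>k<n. partial k f (\<xi> t k) * ((\<gamma> t k - ?p k) / (t - t0))) \<longlongrightarrow>
      (\<Sum>k<n. partial k f ?p * \<gamma>' k)) (at t0)"
    by (intro tendsto_sum tendsto_mult lim) (use \<gamma> in \<open>auto simp: has_field_derivative_iff\<close>)
  moreover have "\<forall>\<^sub>F t in at t0. (\<Sum>k<n. partial k f (\<xi> t k) * ((\<gamma> t k - ?p k) / (t - t0))) =
      (f (\<gamma> t) - f ?p) / (t - t0)"
    using near[OF d(1)] zero'
  proof eventually_elim
    case (elim t)
    have "z n t = \<gamma> t" "z 0 t = ?p"
      using elim(2) p0 by (auto simp: z_def fun_eq_iff)
    then have "f (\<gamma> t) - f ?p = (\<Sum>k<n. f (z (Suc k) t) - f (z k t))"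
      using sum_lessThan_telescope[of "\<lambda>k. f (z k t)" n] by simp
    also have "\<dots> = (\<Sum>k<n. (\<gamma> t k - ?p k) * partial k f (\<xi> t k))"
      using good[OF elim(1)] by (intro sum.cong) (auto simp: good_def)
    finally show ?case by (simp add: sum_divide_distrib mult_ac)
  qed
  ultimately have "((\<lambda>t. (f (\<gamma> t) - f ?p) / (t - t0)) \<longlongrightarrow> (\<Sum>k<n. partial k f ?p * \<gamma>' k)) (at t0)"
    by (rule Lim_transform_eventually)
  then show ?thesis by (simp add: has_field_derivative_iff)
qed

section \<open>The exterior derivative in coordinates\<close>

text \<open>The formula of \<open>ext_d_at\<close> inside one chart: F is the coordinate expression
  of a form, and each argument is the constant vector field with these components.\<close>

definition coord_d ::
    "nat \<Rightarrow> ((nat \<Rightarrow> real) \<Rightarrow> (nat \<Rightarrow> real) list \<Rightarrow> real) \<Rightarrow> (nat \<Rightarrow> real) \<Rightarrow> (nat \<Rightarrow> real) list \<Rightarrow> real" where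
  "coord_d n F p us = (\<Sum>a<length us. (-1) ^ a *
     (\<Sum>j<n. (us ! a) j * partial j (\<lambda>q. F q (nths us (- {a}))) p))"

lemma coord_d_Nil [simp]: "coord_d n F p [] = 0"
  by (simp add: coord_d_def)

text \<open>Cartan's formula: omitting position 0 gives the derivative term, and for all other
  positions the shift by one reverses the sign.\<close>

lemma coord_d_Cons:
  "coord_d n F p (v # us) =
     (\<Sum>j<n. v j * partial j (\<lambda>q. F q us) p) - coord_d n (\<lambda>q us. F q (v # us)) p us"
proof -
  have "{j. Suc j \<in> - {0}} = UNIV" "{j. Suc j \<in> - {Suc a}} = - {a}" for a by auto
  then have "nths (v # us) (- {0}) = us" "nths (v # us) (- {Suc a}) = v # nths us (- {a})" for a
    by (simp_all add: nths_Cons nths_all)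
  then show ?thesis
    by (simp add: coord_d_def sum.lessThan_Suc_shift sum_negf del: sum.lessThan_Suc)
qed

lemma length_nths_Compl_singleton:
  assumes "a < length us"
  shows "Suc (length (nths us (- {a}))) = length us"
proof -
  have "{i. i < length us \<and> i \<in> - {a}} = {..<length us} - {a}" by auto
  then show ?thesis using assms by (simp add: length_nths)
qed

text \<open>Only lists one shorter than \<open>us\<close> are read. Arguments about degree, parity
  and the grading sign rest on this.\<close>

lemma coord_d_cong:
  assumes "\<And>ws j. Suc (length ws) = length us \<Longrightarrow> j < n \<Longrightarrow>
    partial j (\<lambda>q. F q ws) p = partial j (\<lambda>q. G q ws) p"
  shows "coord_d n F p us = coord_d n G p us"
  unfolding coord_d_def
  by (intro sum.cong HOL.refl arg_cong2[where f = "(*)"] assms length_nths_Compl_singleton) auto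

lemma coord_d_cong_open:
  assumes "openin (Euclidean_space n) V" "p \<in> V"
    and "\<And>q ws. q \<in> V \<Longrightarrow> Suc (length ws) = length us \<Longrightarrow> F q ws = G q ws"
  shows "coord_d n F p us = coord_d n G p us"
  by (rule coord_d_cong, rule line_deriv_cong_open(2)[OF assms(1,2)]) (use assms(3) in auto)

lemma coord_d_const [simp]: "coord_d n (\<lambda>q. a) p us = 0"
  by (simp add: coord_d_def line_deriv_const)

definition form_differentiable ::
    "nat \<Rightarrow> ((nat \<Rightarrow> real) \<Rightarrow> (nat \<Rightarrow> real) list \<Rightarrow> real) \<Rightarrow> (nat \<Rightarrow> real) \<Rightarrow> bool" where
  "form_differentiable n F p \<longleftrightarrow> (\<forall>us. \<forall>j<n. line_differentiable j (\<lambda>q. F q us) p)"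

lemma form_differentiable_Cons:
  "form_differentiable n F p \<Longrightarrow> form_differentiable n (\<lambda>q us. F q (v # us)) p"
  by (simp add: form_differentiable_def)

lemma form_differentiable_involution:
  "form_differentiable n F p \<Longrightarrow> form_differentiable n (\<lambda>q us. (-1) ^ length us * F q us) p"
  by (simp add: form_differentiable_def line_deriv_cmult)

lemma coord_d_sum:
  assumes "\<And>i. i \<in> I \<Longrightarrow> form_differentiable n (F i) p"
  shows "coord_d n (\<lambda>q us. \<Sum>i\<in>I. r i * F i q us) p us = (\<Sum>i\<in>I. r i * coord_d n (F i) p us)"
proof -
  have "partial j (\<lambda>q. \<Sum>i\<in>I. r i * F i q ws) p = (\<Sum>i\<in>I. r i * partial j (\<lambda>q. F i q ws) p)"
    if "j < n" for j ws
    using assms that unfolding form_differentiable_def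
    by (subst line_deriv_sum(2)) (auto simp: line_deriv_cmult)
  then have "coord_d n (\<lambda>q us. \<Sum>i\<in>I. r i * F i q us) p us =
    (\<Sum>a<length us. \<Sum>j<n. \<Sum>i\<in>I. (-1) ^ a * ((us ! a) j * (r i * partial j (\<lambda>q. F i q (nths us (- {a}))) p)))"
    unfolding coord_d_def by (simp add: sum_distrib_left)
  also have "\<dots> = (\<Sum>a<length us. \<Sum>i\<in>I. \<Sum>j<n. (-1) ^ a * ((us ! a) j * (r i * partial j (\<lambda>q. F i q (nths us (- {a}))) p)))"
    by (intro sum.cong HOL.refl sum.swap)
  also have "\<dots> = (\<Sum>i\<in>I. \<Sum>a<length us. \<Sum>j<n. (-1) ^ a * ((us ! a) j * (r i * partial j (\<lambda>q. F i q (nths us (- {a}))) p)))"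
    by (rule sum.swap)
  finally show ?thesis
    unfolding coord_d_def by (simp add: sum_distrib_left mult_ac)
qed

lemma coord_d_add:
  assumes "form_differentiable n F p" "form_differentiable n G p"
  shows "coord_d n (\<lambda>q us. F q us + G q us) p us = coord_d n F p us + coord_d n G p us"
  using assms unfolding coord_d_def form_differentiable_def
  by (simp add: line_deriv_add(2) distrib_left sum.distrib)

lemma coord_d_diff:
  assumes "form_differentiable n F p" "form_differentiable n G p"
  shows "coord_d n (\<lambda>q us. F q us - G q us) p us = coord_d n F p us - coord_d n G p us"
  using assms unfolding coord_d_def form_differentiable_def
  by (simp add: line_deriv_diff(2) right_diff_distrib sum_subtractf)

lemma coord_d_cmult:
  assumes "form_differentiable n F p"
  shows "coord_d n (\<lambda>q us. c * F q us) p us = c * coord_d n F p us"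
  using assms unfolding coord_d_def form_differentiable_def
  by (simp add: line_deriv_cmult(2) sum_distrib_left mult_ac)

text \<open>On lists one shorter than \<open>us\<close> the grading sign is constant and opposite to
  the sign for \<open>us\<close> itself.\<close>

lemma coord_d_involution:
  assumes "form_differentiable n F p"
  shows "coord_d n (\<lambda>q us. (-1) ^ length us * F q us) p us = - ((-1) ^ length us * coord_d n F p us)"
proof -
  have "coord_d n (\<lambda>q us. (-1) ^ length us * F q us) p us =
      coord_d n (\<lambda>q ws. (- ((-1) ^ length us)) * F q ws) p us"
  proof (rule coord_d_cong)
    fix ws :: "(nat \<Rightarrow> real) list" and j
    assume "Suc (length ws) = length us"
    then have "(-1) ^ length us = - ((-1) ^ length ws :: real)" by (metis power_Suc mult_minus1)
    then show "partial j (\<lambda>q. (-1) ^ length ws * F q ws) p = partial j (\<lambda>q. - ((-1) ^ length us) * F q ws) p"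
      by simp
  qed
  then show ?thesis using coord_d_cmult[OF assms, of "- ((-1) ^ length us)"] by simp
qed

lemma shuffle_prod_deriv:
  assumes "form_differentiable n F p" "form_differentiable n G p" "j < n"
  shows "line_differentiable j (\<lambda>q. shuffle_prod (F q) (G q) us) p"
    and "partial j (\<lambda>q. shuffle_prod (F q) (G q) us) p =
      shuffle_prod (\<lambda>us. partial j (\<lambda>q. F q us) p) (G p) us +
      shuffle_prod (F p) (\<lambda>us. partial j (\<lambda>q. G q us) p) us"
  using assms
proof (induction us arbitrary: F G)
  case Nil
  {
    case 1
    then show ?case by (simp add: form_differentiable_def line_deriv_mult)
  next
    case 2
    then show ?case by (simp add: form_differentiable_def line_deriv_mult)
  }
next
  case (Cons v us)
  have *: "line_differentiable j (\<lambda>q. shuffle_prod (\<lambda>us. F q (v # us)) (G q) us) p"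
    "line_differentiable j (\<lambda>q. shuffle_prod (\<lambda>us. (-1) ^ length us * F q us) (\<lambda>us. G q (v # us)) us) p"
    if "form_differentiable n F p" "form_differentiable n G p" for F G
    using that assms(3)
    by (auto intro: Cons.IH(1) form_differentiable_Cons form_differentiable_involution)
  {
    case 1
    then show ?case using *[of F G] by (simp add: line_deriv_add)
  next
    case 2
    have i: "partial j (\<lambda>q. shuffle_prod (\<lambda>us. F q (v # us)) (G q) us) p =
      shuffle_prod (\<lambda>us. partial j (\<lambda>q. F q (v # us)) p) (G p) us +
      shuffle_prod (\<lambda>us. F p (v # us)) (\<lambda>us. partial j (\<lambda>q. G q us) p) us"
      by (rule Cons.IH(2)) (use 2 in \<open>auto intro: form_differentiable_Cons\<close>)
    have "partial j (\<lambda>q. shuffle_prod (\<lambda>us. (-1) ^ length us * F q us) (\<lambda>us. G q (v # us)) us) p =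
      shuffle_prod (\<lambda>us. partial j (\<lambda>q. (-1) ^ length us * F q us) p) (\<lambda>us. G p (v # us)) us +
      shuffle_prod (\<lambda>us. (-1) ^ length us * F p us) (\<lambda>us. partial j (\<lambda>q. G q (v # us)) p) us"
      by (rule Cons.IH(2)) (use 2 in \<open>auto intro: form_differentiable_Cons form_differentiable_involution\<close>)
    moreover have "partial j (\<lambda>q. (-1) ^ length us * F q us) p = (-1) ^ length us * partial j (\<lambda>q. F q us) p" for us
      using 2 by (auto simp: form_differentiable_def line_deriv_cmult)
    ultimately show ?case
      using *[of F G] 2 i by (simp add: line_deriv_add)
  }
qed

lemma form_differentiable_shuffle_prod:
  "form_differentiable n F p \<Longrightarrow> form_differentiable n G p \<Longrightarrow>
    form_differentiable n (\<lambda>q. shuffle_prod (F q) (G q)) p"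
  by (auto simp: form_differentiable_def[of n "\<lambda>q. shuffle_prod (F q) (G q)"] intro: shuffle_prod_deriv)

lemma minus_one_power_cancel [simp]: "(-1) ^ k * ((-1) ^ k * x) = (x :: real)"
  by (simp add: mult.assoc[symmetric] power_mult_distrib[symmetric])

text \<open>The Leibniz rule for inhomogeneous forms: the factor (-1)^|a| is kept as the grading
  involution on the left factor. The shuffle recursion produces the same involution, so the
  statement is stable under the induction.\<close>

lemma coord_d_shuffle_prod:
  assumes "form_differentiable n F p" "form_differentiable n G p"
  shows "coord_d n (\<lambda>q. shuffle_prod (F q) (G q)) p us =
    shuffle_prod (coord_d n F p) (G p) us +
    shuffle_prod (\<lambda>us. (-1) ^ length us * F p us) (coord_d n G p) us"
  using assms
proof (induction us arbitrary: F G)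
  case (Cons v us)
  note LD = Cons.prems form_differentiable_Cons[OF Cons.prems(1), of v]
    form_differentiable_Cons[OF Cons.prems(2), of v] form_differentiable_involution[OF Cons.prems(1)]
  have "coord_d n (\<lambda>q. shuffle_prod (F q) (G q)) p (v # us) =
    (\<Sum>j<n. v j * partial j (\<lambda>q. shuffle_prod (F q) (G q) us) p) -
    (coord_d n (\<lambda>q us. shuffle_prod (\<lambda>us. F q (v # us)) (G q) us) p us +
     coord_d n (\<lambda>q us. shuffle_prod (\<lambda>us. (-1) ^ length us * F q us) (\<lambda>us. G q (v # us)) us) p us)"
    unfolding coord_d_Cons shuffle_prod.simps
    by (subst coord_d_add) (use LD in \<open>auto intro: form_differentiable_shuffle_prod\<close>)
  also have "(\<Sum>j<n. v j * partial j (\<lambda>q. shuffle_prod (F q) (G q) us) p) =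
    shuffle_prod (\<lambda>us. \<Sum>j<n. v j * partial j (\<lambda>q. F q us) p) (G p) us +
    shuffle_prod (F p) (\<lambda>us. \<Sum>j<n. v j * partial j (\<lambda>q. G q us) p) us"
    by (simp add: shuffle_prod_deriv(2)[OF Cons.prems] shuffle_prod_sum_left shuffle_prod_sum_right
        distrib_left sum.distrib)
  also have "coord_d n (\<lambda>q us. shuffle_prod (\<lambda>us. F q (v # us)) (G q) us) p us =
    shuffle_prod (coord_d n (\<lambda>q us. F q (v # us)) p) (G p) us +
    shuffle_prod (\<lambda>us. (-1) ^ length us * F p (v # us)) (coord_d n G p) us"
    by (rule Cons.IH[OF LD(3,2)])
  also have "coord_d n (\<lambda>q us. shuffle_prod (\<lambda>us. (-1) ^ length us * F q us) (\<lambda>us. G q (v # us)) us) p us =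
    shuffle_prod (coord_d n (\<lambda>q us. (-1) ^ length us * F q us) p) (\<lambda>us. G p (v # us)) us +
    shuffle_prod (\<lambda>us. (-1) ^ length us * ((-1) ^ length us * F p us)) (coord_d n (\<lambda>q us. G q (v # us)) p) us"
    by (rule Cons.IH[OF LD(5,4)])
  also have "coord_d n (\<lambda>q us. (-1) ^ length us * F q us) p = (\<lambda>us. - ((-1) ^ length us * coord_d n F p us))"
    using coord_d_involution[OF LD(1)] by blast
  finally show ?case
    by (simp add: coord_d_Cons shuffle_prod_diff_left shuffle_prod_diff_right shuffle_prod_uminus_left)
qed simp

text \<open>Symmetry of the second derivatives is part of the condition, which turns d d = 0 into an
  algebraic statement at one point.\<close>

definition twice_differentiable ::
    "nat \<Rightarrow> ((nat \<Rightarrow> real) \<Rightarrow> (nat \<Rightarrow> real) list \<Rightarrow> real) \<Rightarrow> (nat \<Rightarrow> real) \<Rightarrow> bool" where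
  "twice_differentiable n F p \<longleftrightarrow> (\<forall>us. \<forall>i<n. \<forall>j<n.
     line_differentiable i (partial j (\<lambda>q. F q us)) p \<and>
     partial i (partial j (\<lambda>q. F q us)) p = partial j (partial i (\<lambda>q. F q us)) p)"

text \<open>The argument vectors are constant, so a coordinate derivative passes through d termwise
  by the symmetry of second derivatives.\<close>

lemma coord_d_deriv:
  assumes "twice_differentiable n F p" "i < n"
  shows "line_differentiable i (\<lambda>q. coord_d n F q us) p"
    and "partial i (\<lambda>q. coord_d n F q us) p = coord_d n (\<lambda>q us. partial i (\<lambda>q. F q us) q) p us"
proof -
  have *: "line_differentiable i (\<lambda>q. (us ! a) j * partial j (\<lambda>q. F q (nths us (- {a}))) q) p"
    if "j < n" for j a
    using assms that by (auto simp: twice_differentiable_def intro: line_deriv_cmult)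
  then have inner: "line_differentiable i (\<lambda>q. \<Sum>j<n. (us ! a) j * partial j (\<lambda>q. F q (nths us (- {a}))) q) p" for a
    by (intro line_deriv_sum(1)) auto
  then have **: "line_differentiable i (\<lambda>q. (-1) ^ a * (\<Sum>j<n. (us ! a) j * partial j (\<lambda>q. F q (nths us (- {a}))) q)) p" for a
    by (rule line_deriv_cmult(1))
  show "line_differentiable i (\<lambda>q. coord_d n F q us) p"
    unfolding coord_d_def by (intro line_deriv_sum **)
  have "partial i (\<lambda>q. coord_d n F q us) p =
      (\<Sum>a<length us. partial i (\<lambda>q. (-1) ^ a * (\<Sum>j<n. (us ! a) j * partial j (\<lambda>q. F q (nths us (- {a}))) q)) p)"
    unfolding coord_d_def by (intro line_deriv_sum(2) **)
  also have "\<dots> = (\<Sum>a<length us. (-1) ^ a * (\<Sum>j<n. partial i (\<lambda>q. (us ! a) j * partial j (\<lambda>q. F q (nths us (- {a}))) q) p))"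
  proof -
    have "partial i (\<lambda>q. \<Sum>j<n. (us ! a) j * partial j (\<lambda>q. F q (nths us (- {a}))) q) p =
        (\<Sum>j<n. partial i (\<lambda>q. (us ! a) j * partial j (\<lambda>q. F q (nths us (- {a}))) q) p)" for a
      by (rule line_deriv_sum(2)) (simp add: *)
    then show ?thesis by (simp add: line_deriv_cmult(2)[OF inner])
  qed
  also have "\<dots> = coord_d n (\<lambda>q us. partial i (\<lambda>q. F q us) q) p us"
    unfolding coord_d_def
  proof (intro sum.cong HOL.refl arg_cong2[where f = "(*)"])
    fix a j assume "j \<in> {..<n}"
    then have "line_differentiable i (partial j (\<lambda>q. F q (nths us (- {a})))) p"
      "partial i (partial j (\<lambda>q. F q (nths us (- {a})))) p = partial j (partial i (\<lambda>q. F q (nths us (- {a})))) p"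
      using assms by (auto simp: twice_differentiable_def)
    then show "partial i (\<lambda>q. (us ! a) j * partial j (\<lambda>q. F q (nths us (- {a}))) q) p =
        (us ! a) j * partial j (\<lambda>q. partial i (\<lambda>q. F q (nths us (- {a}))) q) p"
      by (simp add: line_deriv_cmult)
  qed
  finally show "partial i (\<lambda>q. coord_d n F q us) p = coord_d n (\<lambda>q us. partial i (\<lambda>q. F q us) q) p us" .
qed

text \<open>Applying Cartan's formula to both copies of d leaves the v-derivative of dF minus d of
  the v-derivative of F, which cancel by \<open>coord_d_deriv\<close>, and d d of F with v
  fixed.\<close>

lemma coord_d_coord_d:
  assumes "twice_differentiable n F p"
  shows "coord_d n (coord_d n F) p us = 0"
  using assms
proof (induction us arbitrary: F)
  case (Cons v us)
  have C: "twice_differentiable n (\<lambda>q us. F q (v # us)) p"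
    using Cons.prems by (simp add: twice_differentiable_def)
  have "coord_d n (\<lambda>q us. coord_d n F q (v # us)) p us =
    coord_d n (\<lambda>q us. \<Sum>j<n. v j * partial j (\<lambda>q. F q us) q) p us -
    coord_d n (coord_d n (\<lambda>q us. F q (v # us))) p us"
    unfolding coord_d_Cons
  proof (rule coord_d_diff)
    show "form_differentiable n (\<lambda>q us. \<Sum>j<n. v j * partial j (\<lambda>q. F q us) q) p"
      using Cons.prems unfolding form_differentiable_def twice_differentiable_def
      by (auto intro!: line_deriv_sum line_deriv_cmult)
    show "form_differentiable n (coord_d n (\<lambda>q us. F q (v # us))) p"
      unfolding form_differentiable_def using coord_d_deriv(1)[OF C] by blast
  qed
  also have "coord_d n (\<lambda>q us. \<Sum>j<n. v j * partial j (\<lambda>q. F q us) q) p us =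
      (\<Sum>j<n. v j * coord_d n (\<lambda>q us. partial j (\<lambda>q. F q us) q) p us)"
    by (rule coord_d_sum) (use Cons.prems in \<open>auto simp: form_differentiable_def twice_differentiable_def\<close>)
  finally show ?case
    using Cons.IH[OF C] by (simp add: coord_d_Cons[of n "coord_d n F"] coord_d_deriv(2)[OF Cons.prems])
qed simp

lemma sum_unit_vec: "k < n \<Longrightarrow> (\<Sum>i<n. unit_vec k i * f i) = f k"
  "k < n \<Longrightarrow> (\<Sum>i<n. f i * unit_vec k i) = f k"
  "k < n \<Longrightarrow> (\<Sum>i<n. f i * unit_vec i k) = f k"
  by (simp_all add: unit_vec_def if_distrib if_distribR sum.delta sum.delta' cong: if_cong)

text \<open>The expansion in unit vectors holds on an open set and may therefore be differentiated
  at p; in the leading slot the derivative term of Cartan's formula is visibly linear.\<close>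

lemma multilinear_coord_d:
  assumes V: "openin (Euclidean_space n) V" "p \<in> V"
    and "\<And>q. q \<in> V \<Longrightarrow> multilinear n (F q)" "form_differentiable n F p"
  shows "multilinear n (coord_d n F p)"
proof -
  have "coord_d n F p (us @ u # vs) = (\<Sum>i<n. u i * coord_d n F p (us @ unit_vec i # vs))"
    if "\<And>q. q \<in> V \<Longrightarrow> multilinear n (F q)" "form_differentiable n F p" for F us u vs
    using that
  proof (induction us arbitrary: F)
    case Nil
    have "coord_d n (\<lambda>q us. F q (u # us)) p vs =
        coord_d n (\<lambda>q us. \<Sum>i<n. u i * F q (unit_vec i # us)) p vs"
      using multilinearD[OF Nil.prems(1), of _ "[]" u] by (intro coord_d_cong_open[OF V]) auto
    also have "\<dots> = (\<Sum>i<n. u i * coord_d n (\<lambda>q us. F q (unit_vec i # us)) p vs)"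
      by (rule coord_d_sum) (use Nil.prems in \<open>auto intro: form_differentiable_Cons\<close>)
    finally show ?case
      by (simp add: coord_d_Cons sum_unit_vec right_diff_distrib sum_subtractf)
  next
    case (Cons w us)
    have "partial j (\<lambda>q. F q (us @ u # vs)) p = (\<Sum>i<n. u i * partial j (\<lambda>q. F q (us @ unit_vec i # vs)) p)"
      if j: "j < n" for j
    proof -
      have "partial j (\<lambda>q. F q (us @ u # vs)) p = partial j (\<lambda>q. \<Sum>i<n. u i * F q (us @ unit_vec i # vs)) p"
        using multilinearD[OF Cons.prems(1), of _ us u vs] by (intro line_deriv_cong_open(2)[OF V j]) auto
      also have "\<dots> = (\<Sum>i<n. u i * partial j (\<lambda>q. F q (us @ unit_vec i # vs)) p)"
        using Cons.prems(2) j unfolding form_differentiable_def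
        by (subst line_deriv_sum(2)) (auto simp: line_deriv_cmult)
      finally show ?thesis .
    qed
    then have "(\<Sum>j<n. w j * partial j (\<lambda>q. F q (us @ u # vs)) p) =
        (\<Sum>j<n. \<Sum>i<n. u i * (w j * partial j (\<lambda>q. F q (us @ unit_vec i # vs)) p))"
      by (simp add: sum_distrib_left mult_ac)
    also have "\<dots> = (\<Sum>i<n. u i * (\<Sum>j<n. w j * partial j (\<lambda>q. F q (us @ unit_vec i # vs)) p))"
      by (subst sum.swap) (simp add: sum_distrib_left)
    finally have 1: "(\<Sum>j<n. w j * partial j (\<lambda>q. F q (us @ u # vs)) p) =
      (\<Sum>i<n. u i * (\<Sum>j<n. w j * partial j (\<lambda>q. F q (us @ unit_vec i # vs)) p))" .
    have 2: "coord_d n (\<lambda>q us. F q (w # us)) p (us @ u # vs) =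
        (\<Sum>i<n. u i * coord_d n (\<lambda>q us. F q (w # us)) p (us @ unit_vec i # vs))"
      by (rule Cons.IH) (use Cons.prems in \<open>auto intro: form_differentiable_Cons multilinear_Cons\<close>)
    show ?case
      by (simp add: coord_d_Cons 1 2 right_diff_distrib sum_subtractf)
  qed
  from this[of F] assms(3,4) show ?thesis unfolding multilinear_def[of n "coord_d n F p"] by blast
qed

text \<open>For two equal leading arguments Cartan's formula produces the same directional
  derivative twice with opposite signs, and what is left differentiates a function that vanishes
  near p.\<close>

lemma alternating_coord_d:
  assumes V: "openin (Euclidean_space n) V" "p \<in> V"
    and "\<And>q. q \<in> V \<Longrightarrow> alternating (F q)"
  shows "alternating (coord_d n F p)"
proof -
  have "coord_d n F p (us @ v # v # vs) = 0"
    if "\<And>q. q \<in> V \<Longrightarrow> alternating (F q)" for F us v vs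
    using that
  proof (induction us arbitrary: F)
    case Nil
    have "coord_d n (\<lambda>q us. F q (v # v # us)) p vs = coord_d n (\<lambda>q us. 0) p vs"
      using alternatingD[OF Nil, of _ "[]"] by (intro coord_d_cong_open[OF V]) auto
    then show ?case
      by (simp add: coord_d_Cons)
  next
    case (Cons w us)
    have "partial j (\<lambda>q. F q (us @ v # v # vs)) p = 0" if j: "j < n" for j
      using line_deriv_cong_open(2)[OF V j, of "\<lambda>q. F q (us @ v # v # vs)" "\<lambda>q. 0"]
        alternatingD[OF Cons.prems] by (simp add: line_deriv_const)
    moreover have "coord_d n (\<lambda>q us. F q (w # us)) p (us @ v # v # vs) = 0"
      by (rule Cons.IH) (use Cons.prems in \<open>auto intro: alternating_Cons\<close>)
    ultimately show ?case
      by (simp add: coord_d_Cons)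
  qed
  from this[of F] assms(3) show ?thesis by (simp add: alternating_def[of "coord_d n F p"])
qed

section \<open>Invariance under a change of coordinates\<close>

text \<open>G on the fields Xs is a polynomial in the values of G on unit vectors and the components
  of the fields, so it inherits any property closed under sums and products. P is instantiated with
  differentiability along a line and with smoothness.\<close>

lemma multilinear_closure:
  fixes P :: "((nat \<Rightarrow> real) \<Rightarrow> real) \<Rightarrow> bool"
  assumes const: "\<And>c. P (\<lambda>q. c)"
    and add: "\<And>f g. P f \<Longrightarrow> P g \<Longrightarrow> P (\<lambda>q. f q + g q)"
    and mult: "\<And>f g. P f \<Longrightarrow> P g \<Longrightarrow> P (\<lambda>q. f q * g q)"
    and cong: "\<And>f g. (\<And>q. q \<in> V \<Longrightarrow> f q = g q) \<Longrightarrow> P f \<Longrightarrow> P g"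
    and "\<And>q. q \<in> V \<Longrightarrow> multilinear n (G q)"
    and "\<And>js. set js \<subseteq> {..<n} \<Longrightarrow> P (\<lambda>q. G q (map unit_vec js))"
    and "\<And>X i. X \<in> set Xs \<Longrightarrow> i < n \<Longrightarrow> P (\<lambda>q. X q i)"
  shows "P (\<lambda>q. G q (map (\<lambda>X. X q) Xs))"
  using assms(5-7)
proof (induction Xs arbitrary: G)
  case Nil
  then show ?case using Nil(2)[of "[]"] by simp
next
  case (Cons X Xs)
  have sum: "P (\<lambda>q. \<Sum>i\<in>I. f i q)" if "finite I" "\<And>i. i \<in> I \<Longrightarrow> P (f i)" for I :: "nat set" and f
    using that by (induction I) (auto intro: const add)
  have "P (\<lambda>q. G q (unit_vec i # map (\<lambda>X. X q) Xs))" if "i < n" for i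
    by (rule Cons.IH) (use Cons.prems(1) Cons.prems(2)[of "i # js" for js] Cons.prems(3) that
        in \<open>auto intro: multilinear_Cons\<close>)
  then have "P (\<lambda>q. \<Sum>i<n. X q i * G q (unit_vec i # map (\<lambda>X. X q) Xs))"
    by (intro sum mult) (use Cons.prems(3) in auto)
  then show ?case
    by (rule cong[rotated]) (use multilinearD[OF Cons.prems(1), of _ "[]"] in simp)
qed

definition pushforward ::
    "nat \<Rightarrow> ((nat \<Rightarrow> real) \<Rightarrow> nat \<Rightarrow> real) \<Rightarrow> (nat \<Rightarrow> real) \<Rightarrow> (nat \<Rightarrow> real) \<Rightarrow> nat \<Rightarrow> real" where
  "pushforward n \<tau> q u i = (\<Sum>j<n. partial j (\<lambda>q. \<tau> q i) q * u j)"

definition coord_pullback ::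
    "nat \<Rightarrow> ((nat \<Rightarrow> real) \<Rightarrow> nat \<Rightarrow> real) \<Rightarrow> ((nat \<Rightarrow> real) \<Rightarrow> (nat \<Rightarrow> real) list \<Rightarrow> real) \<Rightarrow>
      (nat \<Rightarrow> real) \<Rightarrow> (nat \<Rightarrow> real) list \<Rightarrow> real" where
  "coord_pullback n \<tau> F q us = F (\<tau> q) (map (pushforward n \<tau> q) us)"

text \<open>The chain rule along the curve traced by tau when coordinate j moves. As tau takes
  values in V, the coordinates of this curve from n on vanish.\<close>

lemma line_deriv_compose:
  assumes U: "openin (Euclidean_space n) U" "p \<in> U" and V: "openin (Euclidean_space n) V"
    and \<tau>: "\<And>q. q \<in> U \<Longrightarrow> \<tau> q \<in> V" "\<And>i. i < n \<Longrightarrow> line_differentiable j (\<lambda>q. \<tau> q i) p"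
    and f: "Ck_on n (Suc 0) V f" and j: "j < n"
  shows "line_differentiable j (\<lambda>q. f (\<tau> q)) p"
    and "partial j (\<lambda>q. f (\<tau> q)) p = (\<Sum>i<n. partial i f (\<tau> p) * partial j (\<lambda>q. \<tau> q i) p)"
proof -
  let ?\<gamma> = "\<lambda>t. \<tau> (p(j := t))"
  have "\<tau> p \<in> V" using U \<tau>(1) by blast
  have "\<forall>\<^sub>F t in nhds (p j). \<forall>i\<ge>n. ?\<gamma> t i = 0"
    using openin_Euclidean_space_line[OF U j]
    by (rule eventually_mono) (use \<tau>(1) openin_subset[OF V] in \<open>auto simp: topspace_Euclidean_space\<close>)
  then have "((\<lambda>t. f (?\<gamma> t)) has_real_derivative
      (\<Sum>i<n. partial i f (?\<gamma> (p j)) * partial j (\<lambda>q. \<tau> q i) p)) (at (p j))"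
    using \<open>\<tau> p \<in> V\<close> \<tau>(2) by (intro chain_rule[OF V f] line_differentiable_deriv) auto
  then have "((\<lambda>t. f (?\<gamma> t)) has_real_derivative
      (\<Sum>i<n. partial i f (\<tau> p) * partial j (\<lambda>q. \<tau> q i) p)) (at (p j))"
    by simp
  then show "line_differentiable j (\<lambda>q. f (\<tau> q)) p"
    "partial j (\<lambda>q. f (\<tau> q)) p = (\<Sum>i<n. partial i f (\<tau> p) * partial j (\<lambda>q. \<tau> q i) p)"
    by (rule line_derivI)+
qed

text \<open>The coefficients of the pullback contain first derivatives of tau, hence the assumption
  that tau is C^2.\<close>

lemma form_differentiable_pullback:
  assumes U: "openin (Euclidean_space n) U" "p \<in> U" and V: "openin (Euclidean_space n) V"
    and \<tau>: "\<And>q. q \<in> U \<Longrightarrow> \<tau> q \<in> V" "\<And>i. i < n \<Longrightarrow> Ck_on n (Suc (Suc 0)) U (\<lambda>q. \<tau> q i)"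
    and F: "\<And>us. Ck_on n (Suc 0) V (\<lambda>y. F y us)" "\<And>y. y \<in> V \<Longrightarrow> multilinear n (F y)"
  shows "form_differentiable n (coord_pullback n \<tau> F) p"
  unfolding form_differentiable_def
proof (intro allI impI)
  fix us and j :: nat assume j: "j < n"
  note D = Ck_on_Suc_D(1)[OF \<tau>(2) j U(2)] Ck_on_Suc_D(1)[OF Ck_on_Suc_D(2)[OF \<tau>(2)] j U(2)]
  let ?Xs = "map (\<lambda>u q. pushforward n \<tau> q u) us"
  have "line_differentiable j (\<lambda>q. F (\<tau> q) (map (\<lambda>X. X q) ?Xs)) p"
  proof (rule multilinear_closure[where V = U and n = n and P = "\<lambda>f. line_differentiable j f p"
        and G = "\<lambda>q. F (\<tau> q)"])
    fix js
    show "line_differentiable j (\<lambda>q. F (\<tau> q) (map unit_vec js)) p"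
      using line_deriv_compose(1)[where f = "\<lambda>y. F y (map unit_vec js)" and \<tau> = \<tau>,
          OF U V \<tau>(1) D(1) F(1) j] .
  next
    fix X i assume "X \<in> set ?Xs" "i < n"
    then show "line_differentiable j (\<lambda>q. X q i) p"
      using D(2) by (auto simp: pushforward_def mult.commute intro!: line_deriv_sum(1) line_deriv_cmult(1))
  next
    fix f g :: "(nat \<Rightarrow> real) \<Rightarrow> real"
    assume "\<And>q. q \<in> U \<Longrightarrow> f q = g q" "line_differentiable j f p"
    then show "line_differentiable j g p"
      using line_deriv_cong_open(1)[OF U j, of f g] by blast
  qed (auto intro: line_deriv_const line_deriv_add(1) line_deriv_mult(1) F(2) \<tau>(1))
  moreover have "(\<lambda>q. F (\<tau> q) (map (\<lambda>X. X q) ?Xs)) = (\<lambda>q. coord_pullback n \<tau> F q us)"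
    by (simp add: coord_pullback_def comp_def)
  ultimately show "line_differentiable j (\<lambda>q. coord_pullback n \<tau> F q us) p"
    by simp
qed

lemma twice_differentiableI:
  assumes "openin (Euclidean_space n) V" "p \<in> V" "\<And>us. Ck_on n (Suc (Suc 0)) V (\<lambda>q. F q us)"
  shows "twice_differentiable n F p"
  unfolding twice_differentiable_def
  using partial_commute[OF assms] Ck_on_Suc_D(1)[OF Ck_on_Suc_D(2)[OF assms(3)] _ assms(2)] by blast

text \<open>The pullback of a coordinate differential is the differential of the i-th component of
  tau, seen as a form supported on the empty list. Its closedness thereby becomes a case of d d =
  0.\<close>

lemma coord_pullback_dx:
  "coord_pullback n \<tau> (\<lambda>y. dx i) = coord_d n (\<lambda>q us. if us = [] then \<tau> q i else 0)"
proof (intro ext)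
  fix q us
  have "(\<lambda>q us. if v # us = [] then \<tau> q i else 0) = (\<lambda>q us. 0)" for v :: "nat \<Rightarrow> real"
    by simp
  then show "coord_pullback n \<tau> (\<lambda>y. dx i) q us = coord_d n (\<lambda>q us. if us = [] then \<tau> q i else 0) q us"
    by (cases us; cases "tl us")
      (auto simp: coord_pullback_def dx_def coord_d_Cons pushforward_def mult.commute line_deriv_const)
qed

text \<open>Induction on the degree: Euler's identity writes a form of positive degree as a sum of products
  of the coordinate differentials with forms of lower degree.\<close>

lemma coord_d_pullback_length:
  assumes U: "openin (Euclidean_space n) U" "p \<in> U" and V: "openin (Euclidean_space n) V"
    and \<tau>: "\<And>q. q \<in> U \<Longrightarrow> \<tau> q \<in> V" "\<And>i. i < n \<Longrightarrow> Ck_on n (Suc (Suc 0)) U (\<lambda>q. \<tau> q i)"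
    and "\<And>us. Ck_on n (Suc 0) V (\<lambda>y. F y us)" "\<And>y. y \<in> V \<Longrightarrow> multilinear n (F y)"
      "\<And>y. y \<in> V \<Longrightarrow> alternating (F y)"
    and "length us = Suc k"
  shows "coord_d n (coord_pullback n \<tau> F) p us = coord_d n F (\<tau> p) (map (pushforward n \<tau> p) us)"
  using assms(6-)
proof (induction k arbitrary: F us)
  \<comment> \<open>In degree 0 there is a single argument vector, and the claim is the chain rule
    for the function F y [].\<close>
  case 0
  then obtain u where us: "us = [u]" by (auto simp: length_Suc_conv)
  have "partial j (\<lambda>q. F (\<tau> q) []) p = (\<Sum>i<n. partial i (\<lambda>y. F y []) (\<tau> p) * partial j (\<lambda>q. \<tau> q i) p)"
    if "j < n" for j
    using line_deriv_compose(2)[where f = "\<lambda>y. F y []" and \<tau> = \<tau>,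
        OF U V \<tau>(1) Ck_on_Suc_D(1)[OF \<tau>(2) that U(2)] 0(1) that] .
  then have "coord_d n (coord_pullback n \<tau> F) p us =
      (\<Sum>j<n. \<Sum>i<n. u j * (partial i (\<lambda>y. F y []) (\<tau> p) * partial j (\<lambda>q. \<tau> q i) p))"
    by (simp add: us coord_d_Cons coord_pullback_def sum_distrib_left)
  also have "\<dots> = (\<Sum>i<n. \<Sum>j<n. u j * (partial i (\<lambda>y. F y []) (\<tau> p) * partial j (\<lambda>q. \<tau> q i) p))"
    by (rule sum.swap)
  also have "\<dots> = coord_d n F (\<tau> p) (map (pushforward n \<tau> p) us)"
    by (simp add: us coord_d_Cons pushforward_def sum_distrib_left sum_distrib_right mult_ac)
  finally show ?case .
next
  case (Suc k)
  \<comment> \<open>As \<open>us\<close> has length \<open>Suc (Suc k)\<close>, d reads F on lists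
    of length m. This degree is positive, so Euler's identity can be divided by it.\<close>
  define m where "m = real (Suc k)"
  define G where "G = (\<lambda>i y ws. F y (unit_vec i # ws))"
  have G: "Ck_on n (Suc 0) V (\<lambda>y. G i y us)" "y \<in> V \<Longrightarrow> multilinear n (G i y)"
    "y \<in> V \<Longrightarrow> alternating (G i y)" for i y us
    using Suc.prems(1-3) unfolding G_def by (auto intro: multilinear_Cons alternating_Cons)
  have \<tau>p: "\<tau> p \<in> V" using U(2) \<tau>(1) by blast
  have euler: "F y ws = (\<Sum>i<n. (1 / m) * shuffle_prod (dx i) (G i y) ws)"
    if "y \<in> V" "length ws = Suc k" for y ws
    using euler_identity[OF Suc.prems(2,3)[OF that(1)], of ws] that(2)
    by (simp add: G_def m_def sum_divide_distrib[symmetric])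
  have LG: "form_differentiable n (G i) (\<tau> p)" for i
    unfolding form_differentiable_def using Ck_on_Suc_D(1)[OF G(1) _ \<tau>p] by blast
  have Ldx: "form_differentiable n (\<lambda>y. dx i) q" for i q
    by (simp add: form_differentiable_def line_deriv_const)
  have LPG: "form_differentiable n (coord_pullback n \<tau> (G i)) p" for i
    by (rule form_differentiable_pullback[OF U V \<tau> G(1,2)])
  have T: "twice_differentiable n (\<lambda>q us. if us = [] then \<tau> q i else 0) p" if "i < n" for i
  proof (rule twice_differentiableI[OF U])
    fix us :: "(nat \<Rightarrow> real) list"
    show "Ck_on n (Suc (Suc 0)) U (\<lambda>q. if us = [] then \<tau> q i else 0)"
      using \<tau>(2)[OF that] Ck_on_const[of n "Suc (Suc 0)" U 0]
      by (cases "us = []") (simp_all del: Ck_on.simps)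
  qed
  have LPdx: "form_differentiable n (coord_pullback n \<tau> (\<lambda>y. dx i)) p" if "i < n" for i
    unfolding coord_pullback_dx form_differentiable_def using coord_d_deriv(1)[OF T[OF that]] by blast
  have inv_dx: "(-1) ^ length ws * dx i ws = - dx i ws" for i and ws
    by (cases "length ws = 1") (auto simp: dx_length)
  have "coord_d n F (\<tau> p) (map (pushforward n \<tau> p) us) =
    coord_d n (\<lambda>y ws. \<Sum>i<n. (1 / m) * shuffle_prod (dx i) (G i y) ws) (\<tau> p) (map (pushforward n \<tau> p) us)"
    by (rule coord_d_cong_open[OF V \<tau>p]) (use euler Suc.prems(4) in auto)
  also have "\<dots> = (\<Sum>i<n. (1 / m) *
      coord_d n (\<lambda>y. shuffle_prod (dx i) (G i y)) (\<tau> p) (map (pushforward n \<tau> p) us))"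
    by (rule coord_d_sum) (intro form_differentiable_shuffle_prod LG Ldx)
  also have "\<dots> = (\<Sum>i<n. (1 / m) *
      - shuffle_prod (dx i) (coord_d n (G i) (\<tau> p)) (map (pushforward n \<tau> p) us))"
    by (simp add: coord_d_shuffle_prod[OF Ldx LG] ext[OF coord_d_const] inv_dx shuffle_prod_uminus_left)
  finally have rhs: "coord_d n F (\<tau> p) (map (pushforward n \<tau> p) us) = \<dots>" .
  have "coord_d n (coord_pullback n \<tau> F) p us =
    coord_d n (\<lambda>q ws. \<Sum>i<n. (1 / m) *
      shuffle_prod (coord_pullback n \<tau> (\<lambda>y. dx i) q) (coord_pullback n \<tau> (G i) q) ws) p us"
  proof (rule coord_d_cong_open[OF U])
    fix q and ws :: "(nat \<Rightarrow> real) list" assume "q \<in> U" "Suc (length ws) = length us"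
    then have "coord_pullback n \<tau> F q ws =
        (\<Sum>i<n. (1 / m) * shuffle_prod (dx i) (G i (\<tau> q)) (map (pushforward n \<tau> q) ws))"
      unfolding coord_pullback_def using Suc.prems(4) by (intro euler \<tau>(1)) auto
    then show "coord_pullback n \<tau> F q ws = (\<Sum>i<n. (1 / m) *
        shuffle_prod (coord_pullback n \<tau> (\<lambda>y. dx i) q) (coord_pullback n \<tau> (G i) q) ws)"
      by (simp add: shuffle_prod_map coord_pullback_def[abs_def])
  qed
  also have "\<dots> = (\<Sum>i<n. (1 / m) *
      coord_d n (\<lambda>q. shuffle_prod (coord_pullback n \<tau> (\<lambda>y. dx i) q) (coord_pullback n \<tau> (G i) q)) p us)"
    by (rule coord_d_sum) (auto intro: form_differentiable_shuffle_prod LPG LPdx)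
  also have "\<dots> = (\<Sum>i<n. (1 / m) *
      - shuffle_prod (dx i) (coord_d n (G i) (\<tau> p)) (map (pushforward n \<tau> p) us))"
  proof (intro sum.cong HOL.refl arg_cong2[where f = "(*)"])
    fix i assume "i \<in> {..<n}"
    then have i: "i < n" by simp
    have inv: "(-1) ^ length ws * coord_pullback n \<tau> (\<lambda>y. dx i) q ws = - coord_pullback n \<tau> (\<lambda>y. dx i) q ws" for q ws
      using inv_dx[of "map (pushforward n \<tau> q) ws"] by (simp add: coord_pullback_def)
    \<comment> \<open>The first Leibniz term disappears on both sides: here because d d = 0, and for
      dx i itself because its coefficients are constant.\<close>
    have closed: "coord_d n (coord_pullback n \<tau> (\<lambda>y. dx i)) p = (\<lambda>us. 0)"
      unfolding coord_pullback_dx using coord_d_coord_d[OF T[OF i]] by blast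
    have "coord_d n (\<lambda>q. shuffle_prod (coord_pullback n \<tau> (\<lambda>y. dx i) q) (coord_pullback n \<tau> (G i) q)) p us =
      - shuffle_prod (coord_pullback n \<tau> (\<lambda>y. dx i) p) (coord_d n (coord_pullback n \<tau> (G i)) p) us"
      by (simp add: coord_d_shuffle_prod[OF LPdx[OF i] LPG] closed inv shuffle_prod_uminus_left)
    also have "shuffle_prod (coord_pullback n \<tau> (\<lambda>y. dx i) p) (coord_d n (coord_pullback n \<tau> (G i)) p) us =
      shuffle_prod (coord_pullback n \<tau> (\<lambda>y. dx i) p) (\<lambda>ws. coord_d n (G i) (\<tau> p) (map (pushforward n \<tau> p) ws)) us"
    \<comment> \<open>The left factor is a 1-form, so the right factor is evaluated on lists of
      length \<open>Suc k\<close> alone, where the induction hypothesis applies.\<close>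
    proof (rule shuffle_prod_support[of 1 _ "Suc k"])
      fix ws :: "(nat \<Rightarrow> real) list" assume "length ws = Suc k"
      then show "coord_d n (coord_pullback n \<tau> (G i)) p ws = coord_d n (G i) (\<tau> p) (map (pushforward n \<tau> p) ws)"
        by (intro Suc.IH G)
    qed (use Suc.prems(4) in \<open>auto simp: coord_pullback_def dx_length\<close>)
    finally show "coord_d n (\<lambda>q. shuffle_prod (coord_pullback n \<tau> (\<lambda>y. dx i) q) (coord_pullback n \<tau> (G i) q)) p us =
      - shuffle_prod (dx i) (coord_d n (G i) (\<tau> p)) (map (pushforward n \<tau> p) us)"
      by (simp add: shuffle_prod_map coord_pullback_def[abs_def])
  qed
  finally show ?case using rhs by simp
qed

lemma coord_d_pullback:
  assumes "openin (Euclidean_space n) U" "p \<in> U" "openin (Euclidean_space n) V"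
    and "\<And>q. q \<in> U \<Longrightarrow> \<tau> q \<in> V" "\<And>i. i < n \<Longrightarrow> Ck_on n (Suc (Suc 0)) U (\<lambda>q. \<tau> q i)"
    and "\<And>us. Ck_on n (Suc 0) V (\<lambda>y. F y us)" "\<And>y. y \<in> V \<Longrightarrow> multilinear n (F y)"
      "\<And>y. y \<in> V \<Longrightarrow> alternating (F y)"
  shows "coord_d n (coord_pullback n \<tau> F) p us = coord_d n F (\<tau> p) (map (pushforward n \<tau> p) us)"
proof (cases us)
  case (Cons u vs)
  then have "length us = Suc (length vs)" by simp
  from coord_d_pullback_length[OF assms this] show ?thesis .
qed simp

section \<open>The exterior derivative on a manifold\<close>

lemma multilinear_scale:
  assumes "multilinear n a"
  shows "a (us @ (\<lambda>i. r * x i) # ws) = r * a (us @ x # ws)"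
  unfolding multilinearD[OF assms, of us "\<lambda>i. r * x i"] multilinearD[OF assms, of us x]
  by (simp add: sum_distrib_left mult.assoc)

text \<open>Transformed components are controlled below the dimension only; beyond it pushforwards
  and tangent vectors may differ from the given vectors without affecting the value.\<close>

lemma multilinear_map_cong:
  assumes "multilinear n a" "\<And>x i. x \<in> set xs \<Longrightarrow> i < n \<Longrightarrow> f x i = g x i"
  shows "a (map f xs) = a (map g xs)"
  using assms
proof (induction xs arbitrary: a)
  case (Cons x xs)
  have "a (map f (x # xs)) = (\<Sum>i<n. f x i * a (unit_vec i # map f xs))"
    using multilinearD[OF Cons.prems(1), of "[]" "f x"] by simp
  also have "\<dots> = (\<Sum>i<n. g x i * a (unit_vec i # map g xs))"
  proof (intro sum.cong HOL.refl arg_cong2[where f = "(*)"])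
    fix i
    show "a (unit_vec i # map f xs) = a (unit_vec i # map g xs)"
      by (rule Cons.IH[OF multilinear_Cons]) (use Cons.prems in auto)
  qed (use Cons.prems(2) in auto)
  also have "\<dots> = a (map g (x # xs))"
    using multilinearD[OF Cons.prems(1), of "[]" "g x"] by simp
  finally show ?case .
qed simp

lemma smooth_on_shuffle_prod:
  assumes "openin (Euclidean_space n) V"
    and "\<And>us. smooth_on n V (\<lambda>q. F q us)" "\<And>us. smooth_on n V (\<lambda>q. G q us)"
  shows "smooth_on n V (\<lambda>q. shuffle_prod (F q) (G q) us)"
  using assms(2,3)
proof (induction us arbitrary: F G)
  case (Cons v us)
  have "smooth_on n V (\<lambda>q. shuffle_prod (\<lambda>us. F q (v # us)) (G q) us)"
    by (intro Cons.IH Cons.prems)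
  moreover have "smooth_on n V (\<lambda>q. shuffle_prod (\<lambda>us. (-1) ^ length us * F q us) (\<lambda>us. G q (v # us)) us)"
    by (intro Cons.IH Cons.prems smooth_on_mult[OF assms(1) smooth_on_const])
  ultimately show ?case
    by (simp add: smooth_on_add[OF assms(1)])
qed (simp add: smooth_on_mult[OF assms(1)])

lemma smooth_on_coord_d:
  assumes "openin (Euclidean_space n) V" "\<And>us. smooth_on n V (\<lambda>q. F q us)"
  shows "smooth_on n V (\<lambda>q. coord_d n F q us)"
  unfolding coord_d_def
  by (intro smooth_on_sum smooth_on_mult smooth_on_const assms(1) smooth_on_D(2)[OF assms(2)]) auto

context
  fixes M :: "'a mfd"
  assumes M: "smooth_manifold M"
begin

section \<open>Charts, transition maps and Jacobians\<close>

lemma chart_openin: "c \<in> atlas M \<Longrightarrow> openin (mspace M) (fst c)"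
  using M by (auto simp: smooth_manifold_def is_chart_def)

lemma chart_image_openin:
  assumes c: "c \<in> atlas M" and W: "openin (mspace M) W"
  shows "openin (Euclidean_space (mdim M)) (snd c ` (fst c \<inter> W))"
proof -
  have *: "openin (Euclidean_space (mdim M)) (snd c ` fst c)"
    "homeomorphic_map (subtopology (mspace M) (fst c))
      (subtopology (Euclidean_space (mdim M)) (snd c ` fst c)) (snd c)"
    using M c by (auto simp: smooth_manifold_def is_chart_def)
  have "openin (subtopology (mspace M) (fst c)) (fst c \<inter> W)"
    using W by (metis openin_subtopology_Int2)
  then have "openin (subtopology (Euclidean_space (mdim M)) (snd c ` fst c)) (snd c ` (fst c \<inter> W))"
    using homeomorphic_imp_open_map[OF *(2)] unfolding open_map_def by blast
  then show ?thesis
    unfolding openin_open_subtopology[OF *(1)] by blast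
qed

lemma chart_range_openin: "c \<in> atlas M \<Longrightarrow> openin (Euclidean_space (mdim M)) (snd c ` fst c)"
  using M by (auto simp: smooth_manifold_def is_chart_def)

lemma chart_inj: "c \<in> atlas M \<Longrightarrow> inj_on (snd c) (fst c)"
proof -
  assume c: "c \<in> atlas M"
  then have "homeomorphic_map (subtopology (mspace M) (fst c))
      (subtopology (Euclidean_space (mdim M)) (snd c ` fst c)) (snd c)"
    using M by (auto simp: smooth_manifold_def is_chart_def)
  then show ?thesis
    using homeomorphic_imp_injective_map openin_subset[OF chart_openin[OF c]]
    by (metis topspace_subtopology_subset)
qed

lemma chart_inv_left [simp]: "c \<in> atlas M \<Longrightarrow> p \<in> fst c \<Longrightarrow> chart_inv c (snd c p) = p"
  by (simp add: chart_inv_def chart_inj)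

lemma charts_at_nonempty: "p \<in> points M \<Longrightarrow> \<exists>c. c \<in> charts_at M p"
proof -
  assume "p \<in> points M"
  moreover have "(\<Union>c\<in>atlas M. fst c) = points M"
    using M unfolding smooth_manifold_def by blast
  ultimately show ?thesis unfolding charts_at_def by blast
qed

lemma charts_at_points: "c \<in> charts_at M p \<Longrightarrow> p \<in> points M"
  using openin_subset[OF chart_openin[of c]] unfolding charts_at_def by blast

lemma smooth_transition:
  assumes "c \<in> atlas M" "c' \<in> atlas M" "i < mdim M"
  shows "smooth_on (mdim M) (snd c ` (fst c \<inter> fst c')) (\<lambda>q. snd c' (chart_inv c q) i)"
  using M assms by (auto simp: smooth_manifold_def)

lemma jacobian_self:
  assumes c: "c \<in> charts_at M p" and "i < mdim M" "j < mdim M"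
  shows "jacobian c c p i j = (if i = j then 1 else 0)"
proof -
  have c': "c \<in> atlas M" "p \<in> fst c" using c by (auto simp: charts_at_def)
  have "partial j (\<lambda>q. snd c (chart_inv c q) i) (snd c p) = partial j (\<lambda>q. q i) (snd c p)"
    by (rule line_deriv_cong_open(2)[OF chart_range_openin[OF c'(1)] _ assms(3)])
      (use c' in auto)
  then show ?thesis by (simp add: jacobian_def line_deriv_coord)
qed

text \<open>The chain rule for the composition of the transition maps from c to c' and from c' to
  c'', on the open image of the triple overlap.\<close>

lemma jacobian_chain:
  assumes c: "c \<in> charts_at M p" "c' \<in> charts_at M p" "c'' \<in> charts_at M p"
    and ij: "i < mdim M" "j < mdim M"
  shows "jacobian c c'' p i j = (\<Sum>k<mdim M. jacobian c' c'' p i k * jacobian c c' p k j)"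
proof -
  have a: "c \<in> atlas M" "p \<in> fst c" "c' \<in> atlas M" "p \<in> fst c'" "c'' \<in> atlas M" "p \<in> fst c''"
    using c by (auto simp: charts_at_def)
  let ?n = "mdim M" and ?U = "snd c ` (fst c \<inter> (fst c' \<inter> fst c''))"
    and ?V = "snd c' ` (fst c' \<inter> fst c'')"
  have U: "openin (Euclidean_space ?n) ?U" "snd c p \<in> ?U"
    using a by (auto intro!: chart_image_openin openin_Int chart_openin)
  have V: "openin (Euclidean_space ?n) ?V"
    using a by (auto intro!: chart_image_openin chart_openin)
  have "line_differentiable j (\<lambda>q. snd c' (chart_inv c q) k) (snd c p)" if "k < ?n" for k
    by (rule smooth_on_D(1)[OF smooth_transition[OF a(1,3) that] ij(2)]) (use a in auto)
  moreover have "Ck_on ?n (Suc 0) ?V (\<lambda>q. snd c'' (chart_inv c' q) i)"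
    using smooth_transition[OF a(3,5) ij(1)] unfolding smooth_on_def by blast
  ultimately have "partial j (\<lambda>q. snd c'' (chart_inv c' (snd c' (chart_inv c q))) i) (snd c p) =
    (\<Sum>k<?n. partial k (\<lambda>q. snd c'' (chart_inv c' q) i) (snd c' (chart_inv c (snd c p))) *
      partial j (\<lambda>q. snd c' (chart_inv c q) k) (snd c p))"
    using a by (intro line_deriv_compose(2)[where f = "\<lambda>q. snd c'' (chart_inv c' q) i"
        and \<tau> = "\<lambda>q. snd c' (chart_inv c q)", OF U V _ _ _ ij(2)]) auto
  moreover have "partial j (\<lambda>q. snd c'' (chart_inv c q) i) (snd c p) =
      partial j (\<lambda>q. snd c'' (chart_inv c' (snd c' (chart_inv c q))) i) (snd c p)"
    using a by (intro line_deriv_cong_open(2)[OF U ij(2)]) auto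
  ultimately show ?thesis
    using a by (simp add: jacobian_def)
qed

section \<open>Tangent vectors and their components\<close>

lemma tangent_spaceI:
  assumes "\<And>c i. \<not> (c \<in> charts_at M p \<and> i < mdim M) \<Longrightarrow> v c i = 0"
    and "\<And>c c' i. c \<in> charts_at M p \<Longrightarrow> c' \<in> charts_at M p \<Longrightarrow> i < mdim M \<Longrightarrow>
      v c' i = (\<Sum>j<mdim M. jacobian c c' p i j * v c j)"
  shows "v \<in> tangent_space M p"
  unfolding tangent_space_def mem_Collect_eq using assms by blast

lemma tangent_spaceD:
  assumes "v \<in> tangent_space M p"
  shows "\<not> (c \<in> charts_at M p \<and> i < mdim M) \<Longrightarrow> v c i = 0"
    and "c \<in> charts_at M p \<Longrightarrow> c' \<in> charts_at M p \<Longrightarrow> i < mdim M \<Longrightarrow>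
      v c' i = (\<Sum>j<mdim M. jacobian c c' p i j * v c j)"
  using assms unfolding tangent_space_def mem_Collect_eq by blast+

lemma tangent_of_apply:
  "c' \<in> charts_at M p \<Longrightarrow> i < mdim M \<Longrightarrow>
    tangent_of M c p \<xi> c' i = (\<Sum>j<mdim M. jacobian c c' p i j * \<xi> j)"
  by (simp add: tangent_of_def)

lemma tangent_of_self:
  assumes "c \<in> charts_at M p" "i < mdim M"
  shows "tangent_of M c p \<xi> c i = \<xi> i"
  using assms by (simp add: tangent_of_apply jacobian_self if_distrib if_distribR cong: if_cong)

text \<open>Compatibility of the component vectors between charts is the cocycle identity
  \<open>jacobian_chain\<close>.\<close>

lemma tangent_of_in_tangent_space:
  assumes "c \<in> charts_at M p"
  shows "tangent_of M c p \<xi> \<in> tangent_space M p"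
proof -
  have "tangent_of M c p \<xi> c'' i = (\<Sum>j<mdim M. jacobian c' c'' p i j * tangent_of M c p \<xi> c' j)"
    if c: "c' \<in> charts_at M p" "c'' \<in> charts_at M p" and i: "i < mdim M" for c' c'' i
  proof -
    have "tangent_of M c p \<xi> c'' i =
        (\<Sum>j<mdim M. \<Sum>k<mdim M. jacobian c' c'' p i k * (jacobian c c' p k j * \<xi> j))"
      using i c by (simp add: tangent_of_apply jacobian_chain[OF assms c] sum_distrib_right mult.assoc)
    also have "\<dots> = (\<Sum>k<mdim M. \<Sum>j<mdim M. jacobian c' c'' p i k * (jacobian c c' p k j * \<xi> j))"
      by (rule sum.swap)
    finally show ?thesis
      using c by (simp add: tangent_of_apply sum_distrib_left)
  qed
  moreover have "tangent_of M c p \<xi> c' i = 0" if "\<not> (c' \<in> charts_at M p \<and> i < mdim M)" for c' i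
    using that by (simp only: tangent_of_def if_False)
  ultimately show ?thesis by (intro tangent_spaceI)
qed

lemma tangent_of_coords:
  assumes "v \<in> tangent_space M p" "c \<in> charts_at M p"
  shows "tangent_of M c p (v c) = v"
proof (intro ext)
  fix c' i
  show "tangent_of M c p (v c) c' i = v c' i"
    using tangent_spaceD(1)[OF assms(1), of c' i] tangent_spaceD(2)[OF assms(1,2), of c' i]
    by (auto simp: tangent_of_def)
qed

lemma tangent_of_cong:
  "(\<And>i. i < mdim M \<Longrightarrow> \<xi> i = \<eta> i) \<Longrightarrow> tangent_of M c p \<xi> = tangent_of M c p \<eta>"
  by (auto simp: tangent_of_def fun_eq_iff)

lemma tangent_of_add:
  "tangent_of M c p (\<lambda>i. \<xi> i + \<eta> i) = tangent_of M c p \<xi> + tangent_of M c p \<eta>"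
  by (auto simp: tangent_of_def fun_eq_iff distrib_left sum.distrib)

lemma tangent_of_scale:
  "tangent_of M c p (\<lambda>i. r * \<xi> i) = (\<lambda>c' i. r * tangent_of M c p \<xi> c' i)"
  by (auto simp: tangent_of_def fun_eq_iff sum_distrib_left mult_ac)

lemma tangent_of_change:
  assumes "c \<in> charts_at M p" "c' \<in> charts_at M p"
  shows "tangent_of M c p \<xi> =
    tangent_of M c' p (pushforward (mdim M) (\<lambda>q. snd c' (chart_inv c q)) (snd c p) \<xi>)"
proof -
  have "tangent_of M c p \<xi> = tangent_of M c' p (tangent_of M c p \<xi> c')"
    using tangent_of_coords[OF tangent_of_in_tangent_space[OF assms(1)] assms(2)] by simp
  also have "\<dots> = tangent_of M c' p (pushforward (mdim M) (\<lambda>q. snd c' (chart_inv c q)) (snd c p) \<xi>)"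
    by (rule tangent_of_cong) (simp add: tangent_of_apply[OF assms(2)] pushforward_def jacobian_def)
  finally show ?thesis .
qed

lemma tangent_space_add:
  assumes "v \<in> tangent_space M p" "w \<in> tangent_space M p"
  shows "v + w \<in> tangent_space M p"
proof (rule tangent_spaceI)
  fix c c' i assume "c \<in> charts_at M p" "c' \<in> charts_at M p" "i < mdim M"
  then show "(v + w) c' i = (\<Sum>j<mdim M. jacobian c c' p i j * (v + w) c j)"
    using tangent_spaceD(2)[OF assms(1), of c c' i] tangent_spaceD(2)[OF assms(2), of c c' i]
    by (simp add: distrib_left sum.distrib)
qed (simp add: assms[THEN tangent_spaceD(1)])

lemma tangent_space_scale:
  assumes "v \<in> tangent_space M p"
  shows "(\<lambda>c i. r * v c i) \<in> tangent_space M p"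
proof (rule tangent_spaceI)
  fix c c' i assume "c \<in> charts_at M p" "c' \<in> charts_at M p" "i < mdim M"
  then show "r * v c' i = (\<Sum>j<mdim M. jacobian c c' p i j * (r * v c j))"
    using tangent_spaceD(2)[OF assms, of c c' i] by (simp add: sum_distrib_left mult_ac)
qed (simp add: assms[THEN tangent_spaceD(1)])

section \<open>Coordinate expressions of forms and chart independence of d\<close>

definition coord_form :: "'a chart \<Rightarrow> 'a form \<Rightarrow> (nat \<Rightarrow> real) \<Rightarrow> (nat \<Rightarrow> real) list \<Rightarrow> real" where
  "coord_form c \<omega> q us = \<omega> (chart_inv c q) (map (tangent_of M c (chart_inv c q)) us)"

lemma chart_inv_charts_at:
  "c \<in> atlas M \<Longrightarrow> q \<in> snd c ` fst c \<Longrightarrow> c \<in> charts_at M (chart_inv c q)"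
  by (auto simp: charts_at_def)

lemma chart_inv_right: "c \<in> atlas M \<Longrightarrow> q \<in> snd c ` fst c \<Longrightarrow> snd c (chart_inv c q) = q"
  by auto

lemma set_map_tangent_of:
  "c \<in> charts_at M p \<Longrightarrow> set (map (tangent_of M c p) us) \<subseteq> tangent_space M p"
  unfolding set_map by (blast intro: tangent_of_in_tangent_space)

lemma formD:
  assumes "\<omega> \<in> forms M" "p \<in> points M"
  shows "\<not> set vs \<subseteq> tangent_space M p \<Longrightarrow> \<omega> p vs = 0"
    and "v \<in> tangent_space M p \<Longrightarrow> v' \<in> tangent_space M p \<Longrightarrow>
      set us \<union> set vs \<subseteq> tangent_space M p \<Longrightarrow>
      \<omega> p (us @ (v + v') # vs) = \<omega> p (us @ v # vs) + \<omega> p (us @ v' # vs)"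
    and "v \<in> tangent_space M p \<Longrightarrow> set us \<union> set vs \<subseteq> tangent_space M p \<Longrightarrow>
      \<omega> p (us @ (\<lambda>c i. r * v c i) # vs) = r * \<omega> p (us @ v # vs)"
    and "\<not> distinct vs \<Longrightarrow> \<omega> p vs = 0"
proof -
  have "\<omega> p \<in> ext_cotangent M p" using assms by (simp add: forms_def)
  note * = this[unfolded ext_cotangent_def mem_Collect_eq]
  show "\<not> set vs \<subseteq> tangent_space M p \<Longrightarrow> \<omega> p vs = 0" using * by blast
  show "v \<in> tangent_space M p \<Longrightarrow> v' \<in> tangent_space M p \<Longrightarrow>
      set us \<union> set vs \<subseteq> tangent_space M p \<Longrightarrow>
      \<omega> p (us @ (v + v') # vs) = \<omega> p (us @ v # vs) + \<omega> p (us @ v' # vs)" using * by blast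
  show "v \<in> tangent_space M p \<Longrightarrow> set us \<union> set vs \<subseteq> tangent_space M p \<Longrightarrow>
      \<omega> p (us @ (\<lambda>c i. r * v c i) # vs) = r * \<omega> p (us @ v # vs)" using * by blast
  show "\<not> distinct vs \<Longrightarrow> \<omega> p vs = 0" using * by blast
qed

lemma form_outside: "\<omega> \<in> forms M \<Longrightarrow> p \<notin> points M \<Longrightarrow> \<omega> p vs = 0"
  by (simp add: forms_def)

lemma multilinear_coord_form:
  assumes \<omega>: "\<omega> \<in> forms M" and c: "c \<in> atlas M" and q: "q \<in> snd c ` fst c"
  shows "multilinear (mdim M) (coord_form c \<omega> q)"
  unfolding multilinear_def
proof (intro allI)
  fix us u vs
  let ?p = "chart_inv c q"
  let ?T = "tangent_of M c ?p"
  have cp: "c \<in> charts_at M ?p" using chart_inv_charts_at[OF c q] .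
  note D = formD[OF \<omega> charts_at_points[OF cp]]
  have S: "set (map ?T us) \<union> set (map ?T vs) \<subseteq> tangent_space M ?p"
    using set_map_tangent_of[OF cp] by blast
  \<comment> \<open>Induction on the number m of components of u that are kept. At m =
    \<open>mdim M\<close> the truncated vector determines the same tangent vector as u.\<close>
  have "\<omega> ?p (map ?T us @ ?T (\<lambda>i. if i < m then u i else 0) # map ?T vs) =
      (\<Sum>i<m. u i * \<omega> ?p (map ?T us @ ?T (unit_vec i) # map ?T vs))" for m
  proof (induction m)
    case 0
    \<comment> \<open>The zero vector is written as 0 times a tangent vector, so that homogeneity of
      the form applies to it.\<close>
    have "?T (\<lambda>i. if i < 0 then u i else 0) = (\<lambda>c' i. 0 * ?T u c' i)"
      unfolding tangent_of_scale[symmetric] by (rule tangent_of_cong) simp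
    then show ?case
      using D(3)[OF tangent_of_in_tangent_space[OF cp] S, of 0 u] by simp
  next
    case (Suc m)
    have "?T (\<lambda>i. if i < Suc m then u i else 0) =
        ?T (\<lambda>i. if i < m then u i else 0) + (\<lambda>c' i. u m * ?T (unit_vec m) c' i)"
      unfolding tangent_of_scale[symmetric] tangent_of_add[symmetric]
      by (rule tangent_of_cong) (auto simp: unit_vec_def less_Suc_eq)
    then have "\<omega> ?p (map ?T us @ ?T (\<lambda>i. if i < Suc m then u i else 0) # map ?T vs) =
      \<omega> ?p (map ?T us @ ?T (\<lambda>i. if i < m then u i else 0) # map ?T vs) +
      u m * \<omega> ?p (map ?T us @ ?T (unit_vec m) # map ?T vs)"
      using D(2)[OF tangent_of_in_tangent_space[OF cp]
          tangent_space_scale[OF tangent_of_in_tangent_space[OF cp]] S]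
        D(3)[OF tangent_of_in_tangent_space[OF cp] S] by simp
    then show ?case using Suc by simp
  qed
  from this[of "mdim M"]
  show "coord_form c \<omega> q (us @ u # vs) = (\<Sum>i<mdim M. u i * coord_form c \<omega> q (us @ unit_vec i # vs))"
    using tangent_of_cong[of "\<lambda>i. if i < mdim M then u i else 0" u c ?p]
    by (simp add: coord_form_def)
qed

lemma alternating_coord_form:
  assumes "\<omega> \<in> forms M" "c \<in> atlas M" "q \<in> snd c ` fst c"
  shows "alternating (coord_form c \<omega> q)"
  using formD(4)[OF assms(1) charts_at_points[OF chart_inv_charts_at[OF assms(2,3)]]]
  by (simp add: alternating_def coord_form_def)

lemma coord_form_unit_vec:
  "coord_form c \<omega> q (map unit_vec js) = \<omega> (chart_inv c q) (map (coord_vector M c (chart_inv c q)) js)"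
  by (simp add: coord_form_def coord_vector_def[abs_def] unit_vec_def comp_def)

text \<open>Membership in \<open>forms\<close> speaks of coordinate vectors; fields with arbitrary
  constant components are reached by multilinear expansion.\<close>

lemma smooth_coord_form:
  assumes \<omega>: "\<omega> \<in> forms M" and c: "c \<in> atlas M"
  shows "smooth_on (mdim M) (snd c ` fst c) (\<lambda>q. coord_form c \<omega> q us)"
proof -
  let ?V = "snd c ` fst c" and ?n = "mdim M"
  note V = chart_range_openin[OF c]
  let ?Xs = "map (\<lambda>u q. u) us"
  have "smooth_on ?n ?V (\<lambda>q. coord_form c \<omega> q (map (\<lambda>X. X q) ?Xs))"
  proof (rule multilinear_closure[where V = ?V and n = ?n and P = "smooth_on ?n ?V"
        and G = "coord_form c \<omega>"])
    fix js :: "nat list" assume "set js \<subseteq> {..<?n}"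
    then show "smooth_on ?n ?V (\<lambda>q. coord_form c \<omega> q (map unit_vec js))"
      using \<omega> c unfolding coord_form_unit_vec forms_def by blast
  qed (use multilinear_coord_form[OF \<omega> c] in
      \<open>auto intro: smooth_on_const smooth_on_add[OF V] smooth_on_mult[OF V] smooth_on_cong[OF V]\<close>)
  then show ?thesis by (simp add: comp_def)
qed

lemma form_differentiable_coord_form:
  assumes "\<omega> \<in> forms M" "c \<in> atlas M" "q \<in> snd c ` fst c"
  shows "form_differentiable (mdim M) (coord_form c \<omega>) q"
  unfolding form_differentiable_def
  using smooth_on_D(1)[OF smooth_coord_form[OF assms(1,2)] _ assms(3)] by blast

lemma coord_form_change:
  assumes "c \<in> atlas M" "c' \<in> atlas M" "q \<in> snd c ` (fst c \<inter> fst c')"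
  shows "coord_form c \<omega> q us =
    coord_pullback (mdim M) (\<lambda>q. snd c' (chart_inv c q)) (coord_form c' \<omega>) q us"
proof -
  let ?p = "chart_inv c q"
  have p: "c \<in> charts_at M ?p" "c' \<in> charts_at M ?p" "snd c ?p = q" "chart_inv c' (snd c' ?p) = ?p"
    using assms by (auto simp: charts_at_def)
  show ?thesis
    unfolding coord_form_def coord_pullback_def p(4) map_map
    using tangent_of_change[OF p(1,2)]
    by (intro arg_cong[where f = "\<omega> ?p"] map_cong) (simp_all add: p(3))
qed

lemma multilinear_coord_d_form:
  assumes "\<omega> \<in> forms M" "c \<in> atlas M" "q \<in> snd c ` fst c"
  shows "multilinear (mdim M) (coord_d (mdim M) (coord_form c \<omega>) q)"
  by (rule multilinear_coord_d[OF chart_range_openin[OF assms(2)] assms(3)])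
    (use assms in \<open>auto intro: multilinear_coord_form form_differentiable_coord_form\<close>)

text \<open>The expression of the form in c is the pullback, under the transition map, of its
  expression in c'. Chart independence is therefore naturality of d under pullback.\<close>

lemma coord_d_change:
  assumes \<omega>: "\<omega> \<in> forms M" and c: "c \<in> charts_at M p" "c' \<in> charts_at M p"
    and vs: "set vs \<subseteq> tangent_space M p"
  shows "coord_d (mdim M) (coord_form c \<omega>) (snd c p) (map (\<lambda>v. v c) vs) =
    coord_d (mdim M) (coord_form c' \<omega>) (snd c' p) (map (\<lambda>v. v c') vs)"
proof -
  have a: "c \<in> atlas M" "p \<in> fst c" "c' \<in> atlas M" "p \<in> fst c'"
    using c by (auto simp: charts_at_def)
  let ?n = "mdim M" and ?U = "snd c ` (fst c \<inter> fst c')" and ?V = "snd c' ` fst c'"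
    and ?\<tau> = "\<lambda>q. snd c' (chart_inv c q)"
  have U: "openin (Euclidean_space ?n) ?U" "snd c p \<in> ?U"
    using a by (auto intro!: chart_image_openin chart_openin)
  have "coord_d ?n (coord_form c \<omega>) (snd c p) (map (\<lambda>v. v c) vs) =
      coord_d ?n (coord_pullback ?n ?\<tau> (coord_form c' \<omega>)) (snd c p) (map (\<lambda>v. v c) vs)"
    by (rule coord_d_cong_open[OF U]) (rule coord_form_change[OF a(1,3)])
  also have "\<dots> = coord_d ?n (coord_form c' \<omega>) (?\<tau> (snd c p))
      (map (pushforward ?n ?\<tau> (snd c p)) (map (\<lambda>v. v c) vs))"
  proof (rule coord_d_pullback[where \<tau> = ?\<tau>, OF U chart_range_openin[OF a(3)]])
    show "Ck_on ?n (Suc (Suc 0)) ?U (\<lambda>q. ?\<tau> q i)" if "i < ?n" for i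
      using smooth_transition[OF a(1,3) that] unfolding smooth_on_def by blast
    show "Ck_on ?n (Suc 0) ?V (\<lambda>y. coord_form c' \<omega> y us)" for us
      using smooth_coord_form[OF \<omega> a(3)] unfolding smooth_on_def by blast
  qed (use a in \<open>auto intro: multilinear_coord_form[OF \<omega>] alternating_coord_form[OF \<omega>]\<close>)
  also have "\<dots> = coord_d ?n (coord_form c' \<omega>) (snd c' p)
      (map (\<lambda>v. pushforward ?n ?\<tau> (snd c p) (v c)) vs)"
    using a by (simp add: comp_def)
  also have "\<dots> = coord_d ?n (coord_form c' \<omega>) (snd c' p) (map (\<lambda>v. v c') vs)"
  proof (rule multilinear_map_cong[OF multilinear_coord_d_form[OF \<omega> a(3)]])
    fix v i assume "v \<in> set vs" "i < ?n"
    then show "pushforward ?n ?\<tau> (snd c p) (v c) i = v c' i"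
      using tangent_spaceD(2)[of v p c c' i] vs c unfolding pushforward_def jacobian_def by auto
  qed (use a in auto)
  finally show ?thesis .
qed

text \<open>Replaces the chart picked by \<open>SOME\<close>, which may vary from point to point, by
  any given chart; one chart can then serve a whole neighbourhood.\<close>

lemma ext_d_coords:
  assumes \<omega>: "\<omega> \<in> forms M" and c: "c \<in> charts_at M p" and vs: "set vs \<subseteq> tangent_space M p"
  shows "ext_d M \<omega> p vs = coord_d (mdim M) (coord_form c \<omega>) (snd c p) (map (\<lambda>v. v c) vs)"
proof -
  define c' where "c' = (SOME c. c \<in> charts_at M p)"
  have c': "c' \<in> charts_at M p" unfolding c'_def using c by (rule someI)
  have "ext_d M \<omega> p vs = ext_d_at M c' \<omega> p vs"
    using \<omega> vs charts_at_points[OF c] by (simp add: ext_d_def c'_def)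
  also have "\<dots> = coord_d (mdim M) (coord_form c' \<omega>) (snd c' p) (map (\<lambda>v. v c') vs)"
    by (simp add: ext_d_at_def coord_d_def coord_form_def nths_map comp_def)
  also have "\<dots> = coord_d (mdim M) (coord_form c \<omega>) (snd c p) (map (\<lambda>v. v c) vs)"
    by (rule coord_d_change[OF \<omega> c' c vs])
  finally show ?thesis .
qed

lemma ext_d_outside:
  "\<omega> \<in> forms M \<Longrightarrow> \<not> (p \<in> points M \<and> set vs \<subseteq> tangent_space M p) \<Longrightarrow> ext_d M \<omega> p vs = 0"
  by (auto simp: ext_d_def)

text \<open>It holds on the entire chart domain, so the coordinate expression of the differential
  can be differentiated in turn.\<close>

lemma coord_form_ext_d:
  assumes \<omega>: "\<omega> \<in> forms M" and c: "c \<in> atlas M" and q: "q \<in> snd c ` fst c"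
  shows "coord_form c (ext_d M \<omega>) q us = coord_d (mdim M) (coord_form c \<omega>) q us"
proof -
  have cp: "c \<in> charts_at M (chart_inv c q)" using chart_inv_charts_at[OF c q] .
  have "coord_form c (ext_d M \<omega>) q us = coord_d (mdim M) (coord_form c \<omega>) q
      (map (\<lambda>u. tangent_of M c (chart_inv c q) u c) us)"
    unfolding coord_form_def[of c "ext_d M \<omega>"] ext_d_coords[OF \<omega> cp set_map_tangent_of[OF cp]]
    by (simp add: chart_inv_right[OF c q] comp_def)
  also have "\<dots> = coord_d (mdim M) (coord_form c \<omega>) q (map (\<lambda>u. u) us)"
    by (rule multilinear_map_cong[OF multilinear_coord_d_form[OF \<omega> c q]])
      (rule tangent_of_self[OF cp])
  finally show ?thesis by simp
qed

section \<open>Closure of the forms under d, the wedge product and linear operations\<close>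

lemma ext_cotangentI:
  assumes "\<And>vs. \<not> set vs \<subseteq> tangent_space M p \<Longrightarrow> w vs = 0"
    and "\<And>us vs v v'. v \<in> tangent_space M p \<Longrightarrow> v' \<in> tangent_space M p \<Longrightarrow>
      set us \<union> set vs \<subseteq> tangent_space M p \<Longrightarrow> w (us @ (v + v') # vs) = w (us @ v # vs) + w (us @ v' # vs)"
    and "\<And>us vs v r. v \<in> tangent_space M p \<Longrightarrow> set us \<union> set vs \<subseteq> tangent_space M p \<Longrightarrow>
      w (us @ (\<lambda>c i. r * v c i) # vs) = r * w (us @ v # vs)"
    and "\<And>us v vs. set (us @ v # vs) \<subseteq> tangent_space M p \<Longrightarrow> w (us @ v # v # vs) = 0"
  shows "w \<in> ext_cotangent M p"
proof -
  \<comment> \<open>Vanishing on adjacent repetitions is extended to arbitrary ones by swaps, within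
    the tangent space; all other lists have the default value 0.\<close>
  have nd: "w vs = 0" if "\<not> distinct vs" for vs
  proof (cases "set vs \<subseteq> tangent_space M p")
    case True
    show ?thesis
      by (rule alternating_not_distinct[where T = "tangent_space M p"])
        (use assms(2,4) tangent_space_add that True in auto)
  qed (rule assms(1))
  show ?thesis
    unfolding ext_cotangent_def mem_Collect_eq
  proof (intro conjI allI ballI impI)
    fix us vs v v'
    assume "v \<in> tangent_space M p" "v' \<in> tangent_space M p" "set us \<union> set vs \<subseteq> tangent_space M p"
    then show "w (us @ (v + v') # vs) = w (us @ v # vs) + w (us @ v' # vs)" by (rule assms(2))
  next
    fix us vs r v
    assume "v \<in> tangent_space M p" "set us \<union> set vs \<subseteq> tangent_space M p"
    then show "w (us @ (\<lambda>c i. r * v c i) # vs) = r * w (us @ v # vs)" by (rule assms(3))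
  qed (fact assms(1) nd)+
qed

lemma formsI:
  assumes "\<And>p. p \<in> points M \<Longrightarrow> \<omega> p \<in> ext_cotangent M p"
    and "\<And>p vs. p \<notin> points M \<Longrightarrow> \<omega> p vs = 0"
    and "\<And>c js. c \<in> atlas M \<Longrightarrow> smooth_on (mdim M) (snd c ` fst c) (\<lambda>q. coord_form c \<omega> q (map unit_vec js))"
  shows "\<omega> \<in> forms M"
  using assms by (auto simp: forms_def coord_form_unit_vec fun_eq_iff)

lemma ext_d_in_forms:
  assumes \<omega>: "\<omega> \<in> forms M"
  shows "ext_d M \<omega> \<in> forms M"
proof (rule formsI)
  fix p assume "p \<in> points M"
  then obtain c where c: "c \<in> charts_at M p" using charts_at_nonempty by blast
  then have ca: "c \<in> atlas M" "snd c p \<in> snd c ` fst c" by (auto simp: charts_at_def)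
  let ?a = "coord_d (mdim M) (coord_form c \<omega>) (snd c p)" and ?T = "tangent_space M p"
  have a: "multilinear (mdim M) ?a" by (rule multilinear_coord_d_form[OF \<omega> ca])
  have alt: "alternating ?a"
    by (rule alternating_coord_d[OF chart_range_openin[OF ca(1)] ca(2)])
      (rule alternating_coord_form[OF \<omega> ca(1)])
  note E = ext_d_coords[OF \<omega> c]
  show "ext_d M \<omega> p \<in> ext_cotangent M p"
  proof (rule ext_cotangentI)
    fix us vs v v' assume "v \<in> ?T" "v' \<in> ?T" "set us \<union> set vs \<subseteq> ?T"
    then show "ext_d M \<omega> p (us @ (v + v') # vs) = ext_d M \<omega> p (us @ v # vs) + ext_d M \<omega> p (us @ v' # vs)"
      using tangent_space_add multilinear_add[OF a, of _ "v c" "v' c"] by (simp add: E)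
  next
    fix us vs v r assume "v \<in> ?T" "set us \<union> set vs \<subseteq> ?T"
    then show "ext_d M \<omega> p (us @ (\<lambda>c i. r * v c i) # vs) = r * ext_d M \<omega> p (us @ v # vs)"
      using tangent_space_scale multilinear_scale[OF a, of _ r "v c"] by (simp add: E)
  next
    fix us v vs assume "set (us @ v # vs) \<subseteq> ?T"
    then show "ext_d M \<omega> p (us @ v # v # vs) = 0"
      using alternatingD[OF alt] by (simp add: E)
  qed (simp add: ext_d_outside[OF \<omega>])
next
  fix c js assume c: "c \<in> atlas M"
  show "smooth_on (mdim M) (snd c ` fst c) (\<lambda>q. coord_form c (ext_d M \<omega>) q (map unit_vec js))"
    by (rule smooth_on_cong[OF chart_range_openin[OF c] coord_form_ext_d[OF \<omega> c, symmetric]], assumption)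
      (rule smooth_on_coord_d[OF chart_range_openin[OF c] smooth_coord_form[OF \<omega> c]])
qed (simp add: ext_d_outside[OF \<omega>])

lemma coord_form_wedge:
  "coord_form c (wedge \<alpha> \<beta>) q us = shuffle_prod (coord_form c \<alpha> q) (coord_form c \<beta> q) us"
  by (simp add: coord_form_def[abs_def] wedge_eq shuffle_prod_map)

lemma wedge_in_forms:
  assumes \<alpha>: "\<alpha> \<in> forms M" and \<beta>: "\<beta> \<in> forms M"
  shows "wedge \<alpha> \<beta> \<in> forms M"
proof (rule formsI)
  fix p assume p: "p \<in> points M"
  let ?T = "tangent_space M p"
  note A = formD[OF \<alpha> p] and B = formD[OF \<beta> p]
  show "wedge \<alpha> \<beta> p \<in> ext_cotangent M p"
  proof (rule ext_cotangentI)
    fix vs assume "\<not> set vs \<subseteq> ?T"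
    then show "wedge \<alpha> \<beta> p vs = 0"
      unfolding wedge_eq by (intro shuffle_prod_eq_0[where T = ?T] A(1) B(1))
  next
    fix us vs v v' assume T: "v \<in> ?T" "v' \<in> ?T" "set us \<union> set vs \<subseteq> ?T"
    show "wedge \<alpha> \<beta> p (us @ (v + v') # vs) = wedge \<alpha> \<beta> p (us @ v # vs) + wedge \<alpha> \<beta> p (us @ v' # vs)"
      using shuffle_prod_slot[where r = 1 and s = 1 and T = ?T and a = "\<alpha> p" and b = "\<beta> p"
          and x = v and y = v' and z = "v + v'", OF _ _ T(3)] A(2)[OF T(1,2)] B(2)[OF T(1,2)]
      by (simp add: wedge_eq)
  next
    fix us vs v r assume T: "v \<in> ?T" "set us \<union> set vs \<subseteq> ?T"
    show "wedge \<alpha> \<beta> p (us @ (\<lambda>c i. r * v c i) # vs) = r * wedge \<alpha> \<beta> p (us @ v # vs)"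
      using shuffle_prod_slot[where r = r and s = 0 and T = ?T and a = "\<alpha> p" and b = "\<beta> p"
          and x = v and y = v and z = "\<lambda>c i. r * v c i", OF _ _ T(2)] A(3)[OF T(1)] B(3)[OF T(1)]
      by (simp add: wedge_eq)
  next
    fix us v vs assume T: "set (us @ v # vs) \<subseteq> ?T"
    show "wedge \<alpha> \<beta> p (us @ v # v # vs) = 0"
      unfolding wedge_eq by (rule shuffle_prod_adjacent[OF _ _ T]) (rule A(4) B(4), simp)+
  qed
next
  fix p vs assume "p \<notin> points M"
  then show "wedge \<alpha> \<beta> p vs = 0"
    using form_outside[OF \<alpha>, of p] by (simp add: wedge_eq ext[of "\<alpha> p" "\<lambda>us. 0"])
next
  fix c js assume c: "c \<in> atlas M"
  show "smooth_on (mdim M) (snd c ` fst c) (\<lambda>q. coord_form c (wedge \<alpha> \<beta>) q (map unit_vec js))"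
    unfolding coord_form_wedge
    by (rule smooth_on_shuffle_prod[OF chart_range_openin[OF c] smooth_coord_form[OF \<alpha> c]
          smooth_coord_form[OF \<beta> c]])
qed

lemma coord_form_add: "coord_form c (\<alpha> + \<beta>) q us = coord_form c \<alpha> q us + coord_form c \<beta> q us"
  by (simp add: coord_form_def)

lemma coord_form_scale: "coord_form c (scale_form r \<alpha>) q us = r * coord_form c \<alpha> q us"
  by (simp add: coord_form_def scale_form_def)

lemma add_in_forms:
  assumes "\<alpha> \<in> forms M" "\<beta> \<in> forms M"
  shows "\<alpha> + \<beta> \<in> forms M"
proof (rule formsI)
  fix p assume p: "p \<in> points M"
  note A = formD[OF assms(1) p] and B = formD[OF assms(2) p]
  show "(\<alpha> + \<beta>) p \<in> ext_cotangent M p"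
    by (rule ext_cotangentI) (use A B in \<open>simp_all add: algebra_simps\<close>)
qed (use assms in \<open>simp_all add: form_outside coord_form_add smooth_on_add[OF chart_range_openin] smooth_coord_form\<close>)

lemma scale_in_forms:
  assumes "\<alpha> \<in> forms M"
  shows "scale_form r \<alpha> \<in> forms M"
proof (rule formsI)
  fix p assume p: "p \<in> points M"
  note A = formD[OF assms p]
  show "scale_form r \<alpha> p \<in> ext_cotangent M p"
    by (rule ext_cotangentI) (use A in \<open>simp_all add: scale_form_def algebra_simps\<close>)
next
  fix c js assume c: "c \<in> atlas M"
  show "smooth_on (mdim M) (snd c ` fst c) (\<lambda>q. coord_form c (scale_form r \<alpha>) q (map unit_vec js))"
    unfolding coord_form_scale
    by (intro smooth_on_mult chart_range_openin[OF c] smooth_on_const smooth_coord_form[OF assms c])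
qed (use assms in \<open>simp add: form_outside scale_form_def\<close>)

lemma zero_in_forms: "0 \<in> forms M"
proof (rule formsI)
  show "(0 :: 'a form) p \<in> ext_cotangent M p" for p
    by (rule ext_cotangentI) simp_all
qed (simp_all add: coord_form_def smooth_on_const)

text \<open>Off the manifold, and on lists that are not made of tangent vectors, both forms take the
  default value 0, so one chart at each point is enough.\<close>

lemma form_eqI:
  assumes "\<alpha> \<in> forms M" "\<beta> \<in> forms M"
    and "\<And>p c vs. c \<in> charts_at M p \<Longrightarrow> c \<in> atlas M \<Longrightarrow> snd c p \<in> snd c ` fst c \<Longrightarrow> set vs \<subseteq> tangent_space M p \<Longrightarrow> \<alpha> p vs = \<beta> p vs"
  shows "\<alpha> = \<beta>"
proof (intro ext)
  fix p vs
  show "\<alpha> p vs = \<beta> p vs"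
  proof (cases "p \<in> points M")
    case True
    then obtain c where c: "c \<in> charts_at M p" using charts_at_nonempty by blast
    then have "c \<in> atlas M" "snd c p \<in> snd c ` fst c" by (auto simp: charts_at_def)
    with c show ?thesis
      using assms(3) formD(1)[OF assms(1) True] formD(1)[OF assms(2) True]
      by (cases "set vs \<subseteq> tangent_space M p") auto
  next
    case False
    then show ?thesis using assms(1,2) by (simp add: form_outside)
  qed
qed

section \<open>d as an odd derivation of square zero\<close>

lemma ext_d_ext_d:
  assumes \<omega>: "\<omega> \<in> forms M"
  shows "ext_d M (ext_d M \<omega>) = 0"
proof (rule form_eqI[OF ext_d_in_forms[OF ext_d_in_forms[OF \<omega>]] zero_in_forms])
  fix p c vs
  assume c: "c \<in> charts_at M p" "c \<in> atlas M" "snd c p \<in> snd c ` fst c" and vs: "set vs \<subseteq> tangent_space M p"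
  note V = chart_range_openin[OF c(2)] c(3)
  have "ext_d M (ext_d M \<omega>) p vs =
      coord_d (mdim M) (coord_form c (ext_d M \<omega>)) (snd c p) (map (\<lambda>v. v c) vs)"
    by (rule ext_d_coords[OF ext_d_in_forms[OF \<omega>] c(1) vs])
  also have "\<dots> = coord_d (mdim M) (coord_d (mdim M) (coord_form c \<omega>)) (snd c p) (map (\<lambda>v. v c) vs)"
    by (rule coord_d_cong_open[OF V]) (rule coord_form_ext_d[OF \<omega> c(2)])
  also have "\<dots> = 0"
    using smooth_coord_form[OF \<omega> c(2)]
    by (intro coord_d_coord_d twice_differentiableI[OF V]) (auto simp: smooth_on_def simp del: Ck_on.simps)
  finally show "ext_d M (ext_d M \<omega>) p vs = 0 p vs" by simp
qed

lemma ext_d_add: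
  assumes "\<alpha> \<in> forms M" "\<beta> \<in> forms M"
  shows "ext_d M (\<alpha> + \<beta>) = ext_d M \<alpha> + ext_d M \<beta>"
proof (rule form_eqI[OF ext_d_in_forms[OF add_in_forms[OF assms]] add_in_forms[OF assms[THEN ext_d_in_forms]]])
  fix p c vs
  assume c: "c \<in> charts_at M p" "c \<in> atlas M" "snd c p \<in> snd c ` fst c" and vs: "set vs \<subseteq> tangent_space M p"
  have "coord_form c (\<alpha> + \<beta>) = (\<lambda>q us. coord_form c \<alpha> q us + coord_form c \<beta> q us)"
    using coord_form_add by blast
  then show "ext_d M (\<alpha> + \<beta>) p vs = (ext_d M \<alpha> + ext_d M \<beta>) p vs"
    using assms add_in_forms c vs
    by (simp add: ext_d_coords[OF _ c(1) vs] coord_d_add form_differentiable_coord_form)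
qed

lemma ext_d_scale:
  assumes "\<alpha> \<in> forms M"
  shows "ext_d M (scale_form r \<alpha>) = scale_form r (ext_d M \<alpha>)"
proof (rule form_eqI[OF ext_d_in_forms[OF scale_in_forms[OF assms]] scale_in_forms[OF ext_d_in_forms[OF assms]]])
  fix p c vs
  assume c: "c \<in> charts_at M p" "c \<in> atlas M" "snd c p \<in> snd c ` fst c" and vs: "set vs \<subseteq> tangent_space M p"
  have "coord_form c (scale_form r \<alpha>) = (\<lambda>q us. r * coord_form c \<alpha> q us)"
    using coord_form_scale by blast
  then show "ext_d M (scale_form r \<alpha>) p vs = scale_form r (ext_d M \<alpha>) p vs"
    using assms scale_in_forms c vs
    by (simp add: ext_d_coords[OF _ c(1) vs] coord_d_cmult form_differentiable_coord_form scale_form_def)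
qed

lemma ext_d_parity:
  assumes \<alpha>: "\<alpha> \<in> forms_par M j" and j: "j < 2"
  shows "ext_d M \<alpha> \<in> forms_par M ((1 + j) mod 2)"
proof -
  have \<alpha>f: "\<alpha> \<in> forms M" and zero: "\<And>p vs. length vs mod 2 \<noteq> j \<Longrightarrow> \<alpha> p vs = 0"
    using \<alpha> by (auto simp: forms_par_def)
  have "ext_d M \<alpha> p vs = 0" if len: "length vs mod 2 \<noteq> (1 + j) mod 2" for p vs
  proof (cases "p \<in> points M \<and> set vs \<subseteq> tangent_space M p")
    case True
    then obtain c where c: "c \<in> charts_at M p" using charts_at_nonempty by blast
    have "coord_d (mdim M) (coord_form c \<alpha>) (snd c p) (map (\<lambda>v. v c) vs) =
        coord_d (mdim M) (\<lambda>q us. 0) (snd c p) (map (\<lambda>v. v c) vs)"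
    proof (rule coord_d_cong)
      fix ws :: "(nat \<Rightarrow> real) list" and j'
      assume "Suc (length ws) = length (map (\<lambda>v. v c) vs)"
      then have "Suc (length ws) = length vs" by simp
      \<comment> \<open>Omitting one argument flips the parity, which puts \<open>ws\<close> where
        the form vanishes.\<close>
      then have "length ws mod 2 \<noteq> j" using len j by presburger
      then show "partial j' (\<lambda>q. coord_form c \<alpha> q ws) (snd c p) = partial j' (\<lambda>q. 0) (snd c p)"
        by (simp add: coord_form_def zero)
    qed
    then show ?thesis
      using ext_d_coords[OF \<alpha>f c] True by simp
  qed (use ext_d_outside[OF \<alpha>f] in blast)
  then show ?thesis
    using ext_d_in_forms[OF \<alpha>f] by (simp add: forms_par_def)
qed

lemma ext_d_wedge:
  assumes \<alpha>: "\<alpha> \<in> forms_par M j" and \<beta>: "\<beta> \<in> forms M" and j: "j < 2"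
  shows "ext_d M (wedge \<alpha> \<beta>) = wedge (ext_d M \<alpha>) \<beta> + scale_form ((-1) ^ j) (wedge \<alpha> (ext_d M \<beta>))"
proof -
  have \<alpha>f: "\<alpha> \<in> forms M" and zero: "\<And>p vs. length vs mod 2 \<noteq> j \<Longrightarrow> \<alpha> p vs = 0"
    using \<alpha> by (auto simp: forms_par_def)
  show ?thesis
  proof (rule form_eqI)
    fix p c vs
    assume c: "c \<in> charts_at M p" "c \<in> atlas M" "snd c p \<in> snd c ` fst c" and vs: "set vs \<subseteq> tangent_space M p"
    let ?n = "mdim M" and ?q = "snd c p" and ?us = "map (\<lambda>v. v c) vs"
    have inv: "chart_inv c ?q = p" using c by (auto simp: charts_at_def)
    have coords: "coord_form c \<gamma> ?q (map (\<lambda>v. v c) ws) = \<gamma> p ws" if "set ws \<subseteq> tangent_space M p" for \<gamma> ws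
    proof -
      have "map (tangent_of M c p) (map (\<lambda>v. v c) ws) = ws"
        using that tangent_of_coords[OF _ c(1)] by (auto simp: map_idI subset_iff)
      then show ?thesis by (simp add: coord_form_def inv)
    qed
    \<comment> \<open>Homogeneity turns the grading involution of the coordinate Leibniz rule into
      one constant sign; the form need not have a single degree, a single parity does it.\<close>
    have sign: "(-1) ^ length ws * \<alpha> p ws = (-1) ^ j * \<alpha> p ws" for ws
    proof (cases "length ws mod 2 = j")
      case True
      then show ?thesis by (metis minus_one_power_iff even_mod_2_iff)
    qed (simp add: zero)
    have "coord_form c (wedge \<alpha> \<beta>) = (\<lambda>q. shuffle_prod (coord_form c \<alpha> q) (coord_form c \<beta> q))"
      using coord_form_wedge by blast
    then have "ext_d M (wedge \<alpha> \<beta>) p vs =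
      coord_d ?n (\<lambda>q. shuffle_prod (coord_form c \<alpha> q) (coord_form c \<beta> q)) ?q ?us"
      by (simp add: ext_d_coords[OF wedge_in_forms[OF \<alpha>f \<beta>] c(1) vs])
    also have "\<dots> = shuffle_prod (coord_d ?n (coord_form c \<alpha>) ?q) (coord_form c \<beta> ?q) ?us +
        shuffle_prod (\<lambda>us. (-1) ^ length us * coord_form c \<alpha> ?q us) (coord_d ?n (coord_form c \<beta>) ?q) ?us"
      by (intro coord_d_shuffle_prod form_differentiable_coord_form \<alpha>f \<beta> c)
    also have "shuffle_prod (coord_d ?n (coord_form c \<alpha>) ?q) (coord_form c \<beta> ?q) ?us = wedge (ext_d M \<alpha>) \<beta> p vs"
      unfolding wedge_eq shuffle_prod_map
      by (rule shuffle_prod_cong) (use vs in \<open>auto simp: coords ext_d_coords[OF \<alpha>f c(1)]\<close>)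
    also have "shuffle_prod (\<lambda>us. (-1) ^ length us * coord_form c \<alpha> ?q us) (coord_d ?n (coord_form c \<beta>) ?q) ?us =
        shuffle_prod (\<lambda>us. (-1) ^ j * \<alpha> p us) (ext_d M \<beta> p) vs"
      unfolding shuffle_prod_map
      by (rule shuffle_prod_cong) (use vs in \<open>auto simp: coords sign ext_d_coords[OF \<beta> c(1)]\<close>)
    finally have eq: "ext_d M (wedge \<alpha> \<beta>) p vs = wedge (ext_d M \<alpha>) \<beta> p vs +
        shuffle_prod (\<lambda>us. (-1) ^ j * \<alpha> p us) (ext_d M \<beta> p) vs" .
    show "ext_d M (wedge \<alpha> \<beta>) p vs =
        (wedge (ext_d M \<alpha>) \<beta> + scale_form ((-1) ^ j) (wedge \<alpha> (ext_d M \<beta>))) p vs"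
      unfolding eq by (simp add: scale_form_def wedge_eq shuffle_prod_scale_left)
  qed (intro ext_d_in_forms add_in_forms scale_in_forms wedge_in_forms \<alpha>f \<beta>)+
qed

lemma ext_d_in_der_par: "ext_d M \<in> der_par M 1"
proof -
  have "ext_d M \<in> forms M \<rightarrow>\<^sub>E forms M"
    using ext_d_in_forms by (auto simp: ext_d_def)
  then show ?thesis
    unfolding der_par_def using ext_d_add ext_d_scale ext_d_parity ext_d_wedge by simp
qed

end

section \<open>The graded curvature\<close>

lemma wedge_zero [simp]: "wedge 0 \<beta> = 0" "wedge \<alpha> 0 = 0"
  by (simp_all add: wedge_def fun_eq_iff)

lemma scale_form_zero [simp]: "scale_form r 0 = 0"
  by (simp add: scale_form_def fun_eq_iff)

lemma ext_d_in_Der: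
  assumes M: "smooth_manifold M"
  shows "ext_d M \<in> Der M"
proof -
  \<comment> \<open>\<open>Der\<close> consists of sums of an even and an odd derivation, so d is
    presented as zero plus d. Restricting the zero operator to \<open>forms M\<close> makes it
    extensional, as \<open>der_par\<close> demands.\<close>
  define z :: "'a form_op" where "z = (\<lambda>\<omega>\<in>forms M. 0)"
  have z: "z \<omega> = 0" if "\<omega> \<in> forms M" for \<omega>
    using that by (simp add: z_def)
  have "z \<in> forms M \<rightarrow>\<^sub>E forms M"
    using zero_in_forms[OF M] by (auto simp: z_def)
  moreover have parD: "\<alpha> \<in> forms M" if "\<alpha> \<in> forms_par M j" for \<alpha> j
    using that by (simp add: forms_par_def)
  moreover have "0 \<in> forms_par M j" for j
    using zero_in_forms[OF M] by (simp add: forms_par_def)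
  ultimately have "z \<in> der_par M 0"
    unfolding der_par_def mem_Collect_eq
    by (intro conjI allI ballI impI)
      (simp_all add: z add_in_forms[OF M] scale_in_forms[OF M] wedge_in_forms[OF M] parD)
  moreover have "der_add M z (ext_d M) = ext_d M"
    by (auto simp: der_add_def z ext_d_def fun_eq_iff restrict_def)
  ultimately show ?thesis
    unfolding Der_def using ext_d_in_der_par[OF M] by (metis (mono_tags, lifting) mem_Collect_eq)
qed

text \<open>Both sides are extensional and send every form to 0. Writing the bracket as a multiple
  of d makes the left linearity of a connection applicable to it.\<close>

lemma der_bracket_ext_d:
  assumes "smooth_manifold M"
  shows "der_bracket M (ext_d M) (ext_d M) = der_lmul M 0 (ext_d M)"
  by (auto simp: der_bracket_def der_lmul_def ext_d_ext_d[OF assms] fun_eq_iff)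

section \<open>Computing with classes in the tensor product\<close>

lemma tensor_rel_class_eq:
  assumes "(xs, ys) \<in> tensor_rel M E"
  shows "tensor_rel M E `` {xs} = tensor_rel M E `` {ys}"
  using assms by (blast intro: tensor_rel.sym tensor_rel.trans)

text \<open>The unions in \<open>bf_add\<close> run over all representatives. Each pair contributes
  the same class, and reflexivity ensures that there is a pair.\<close>

lemma bf_add_class:
  assumes "xs \<in> lists (forms M \<times> sections M E)" "ys \<in> lists (forms M \<times> sections M E)"
  shows "bf_add M E (tensor_rel M E `` {xs}) (tensor_rel M E `` {ys}) = tensor_rel M E `` {xs @ ys}"
proof -
  have "tensor_rel M E `` {xs' @ ys'} = tensor_rel M E `` {xs @ ys}"
    if "(xs, xs') \<in> tensor_rel M E" "(ys, ys') \<in> tensor_rel M E" for xs' ys'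
    using tensor_rel_class_eq[OF tensor_rel.append[OF that]] by simp
  moreover have "(xs, xs) \<in> tensor_rel M E" "(ys, ys) \<in> tensor_rel M E"
    using assms by (auto intro: tensor_rel.refl)
  ultimately show ?thesis
    unfolding bf_add_def by blast
qed

abbreviation scale_list :: "real \<Rightarrow> ('a form \<times> ('a \<Rightarrow> 'v)) list \<Rightarrow> ('a form \<times> ('a \<Rightarrow> 'v)) list" where
  "scale_list r \<equiv> map (\<lambda>(\<alpha>, \<phi>). (scale_form r \<alpha>, \<phi>))"

lemma scale_list_in_lists:
  assumes "smooth_manifold M" "xs \<in> lists (forms M \<times> sections M E)"
  shows "scale_list r xs \<in> lists (forms M \<times> sections M E)"
  using assms(2) by (induction xs) (auto intro: scale_in_forms[OF assms(1)])

lemma tensor_rel_scale: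
  assumes M: "smooth_manifold M" and "(xs, ys) \<in> tensor_rel M E"
  shows "(scale_list r xs, scale_list r ys) \<in> tensor_rel M E"
  using assms(2)
proof induction
  case (refl xs)
  then show ?case by (intro tensor_rel.refl scale_list_in_lists[OF M])
next
  case (commute xs ys)
  then show ?case unfolding map_append by (intro tensor_rel.commute scale_list_in_lists[OF M])
next
  case (add_left \<alpha> \<beta> \<phi>)
  have "scale_form r (\<alpha> + \<beta>) = scale_form r \<alpha> + scale_form r \<beta>"
    by (simp add: scale_form_def fun_eq_iff distrib_left)
  then show ?case using add_left by (auto intro: tensor_rel.add_left scale_in_forms[OF M])
next
  case (balanced f \<alpha> \<phi>)
  have "scale_form r (fun_form f \<alpha>) = fun_form f (scale_form r \<alpha>)"
    by (simp add: scale_form_def fun_form_def fun_eq_iff)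
  then show ?case using balanced by (auto intro: tensor_rel.balanced scale_in_forms[OF M])
qed (auto intro: tensor_rel.intros scale_in_forms[OF M])

lemma bf_scale_class:
  assumes M: "smooth_manifold M" and "xs \<in> lists (forms M \<times> sections M E)"
  shows "bf_scale M E r (tensor_rel M E `` {xs}) = tensor_rel M E `` {scale_list r xs}"
proof -
  have "tensor_rel M E `` {scale_list r xs'} = tensor_rel M E `` {scale_list r xs}"
    if "(xs, xs') \<in> tensor_rel M E" for xs'
    using tensor_rel_class_eq[OF tensor_rel_scale[OF M that]] by blast
  moreover have "(xs, xs) \<in> tensor_rel M E"
    using assms by (auto intro: tensor_rel.refl)
  ultimately show ?thesis
    unfolding bf_scale_def by blast
qed

text \<open>On representatives, replacing every form by 0 is the same as scaling by the number 0,
  which is already known to respect the relation.\<close>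

lemma tensor_rel_zero_forms:
  assumes M: "smooth_manifold M" and "(xs, ys) \<in> tensor_rel M E"
  shows "(map (\<lambda>(\<alpha>, \<phi>). (0, \<phi>)) xs, map (\<lambda>(\<alpha>, \<phi>). (0, \<phi>)) ys) \<in> tensor_rel M E"
proof -
  have 0: "scale_form 0 \<alpha> = 0" for \<alpha> :: "'a form"
    by (simp add: scale_form_def fun_eq_iff)
  show ?thesis using tensor_rel_scale[OF assms, of 0] by (simp add: 0)
qed

lemma tensor_rel_zero_forms_Nil:
  assumes M: "smooth_manifold M" and "xs \<in> lists (forms M \<times> sections M E)"
  shows "(map (\<lambda>(\<alpha>, \<phi>). (0, \<phi>)) xs, []) \<in> tensor_rel M E"
  using assms(2)
proof induction
  case (Cons x xs)
  obtain \<alpha> \<phi> where x: "x = (\<alpha>, \<phi>)" by (cases x)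
  have "([(0, \<phi>)], []) \<in> tensor_rel M E"
    by (rule tensor_rel.zero) (use Cons.hyps x in auto)
  from tensor_rel.append[OF this Cons.IH] show ?case
    by (simp only: x list.map prod.case append_Cons append_Nil)
qed (auto intro: tensor_rel.refl)

lemma bf_lmul_zero_class:
  assumes M: "smooth_manifold M" and xs: "xs \<in> lists (forms M \<times> sections M E)"
  shows "bf_lmul M E 0 (tensor_rel M E `` {xs}) = tensor_rel M E `` {[]}"
proof -
  have "tensor_rel M E `` {map (\<lambda>(\<alpha>, \<phi>). (0, \<phi>)) xs'} = tensor_rel M E `` {[]}"
    if "(xs, xs') \<in> tensor_rel M E" for xs'
    using tensor_rel_class_eq[OF tensor_rel_zero_forms[OF M that]]
      tensor_rel_class_eq[OF tensor_rel_zero_forms_Nil[OF M xs]] by simp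
  moreover have "(xs, xs) \<in> tensor_rel M E"
    using xs by (auto intro: tensor_rel.refl)
  ultimately show ?thesis
    unfolding bf_lmul_def by simp blast
qed

text \<open>The two halves of an entry stand in different copies of the list: \<open>commute\<close>
  brings them side by side and \<open>add_left\<close> merges them.\<close>

lemma tensor_rel_halves:
  assumes M: "smooth_manifold M" and "xs \<in> lists (forms M \<times> sections M E)"
  shows "(scale_list (1/2) xs @ scale_list (1/2) xs, xs) \<in> tensor_rel M E"
  using assms(2)
proof induction
  case (Cons x xs)
  obtain \<alpha> \<phi> where x: "x = (\<alpha>, \<phi>)" by (cases x)
  with Cons have \<alpha>: "\<alpha> \<in> forms M" "\<phi> \<in> sections M E" by auto
  let ?h = "scale_form (1/2) \<alpha>" and ?H = "scale_list (1/2) xs"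
  have h: "?h \<in> forms M" using \<alpha> by (intro scale_in_forms[OF M])
  have H: "?H \<in> lists (forms M \<times> sections M E)"
    using Cons by (intro scale_list_in_lists[OF M]) auto
  have hL: "[(?h, \<phi>)] \<in> lists (forms M \<times> sections M E)" using h \<alpha> by simp
  have "([(?h, \<phi>)] @ (?H @ [(?h, \<phi>)]) @ ?H, [(?h, \<phi>)] @ ([(?h, \<phi>)] @ ?H) @ ?H) \<in> tensor_rel M E"
    by (intro tensor_rel.append tensor_rel.refl tensor_rel.commute hL H)
  moreover have "([(?h, \<phi>), (?h, \<phi>)] @ (?H @ ?H), [(\<alpha>, \<phi>)] @ xs) \<in> tensor_rel M E"
  proof (rule tensor_rel.append)
    have "?h + ?h = \<alpha>" by (simp add: scale_form_def fun_eq_iff)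
    then show "([(?h, \<phi>), (?h, \<phi>)], [(\<alpha>, \<phi>)]) \<in> tensor_rel M E"
      using tensor_rel.sym[OF tensor_rel.add_left[OF h h \<alpha>(2)]] by simp
  qed (rule Cons.IH)
  ultimately show ?case
    using tensor_rel.trans by (fastforce simp: x)
qed (auto intro: tensor_rel.refl)

theorem theorem6p4:
  fixes M :: "'a mfd"
    and E :: "('a, 'v::real_vector \<times> 'w::real_vector) vbundle"
    and nabla :: "'a form_op \<Rightarrow> ('a, 'v \<times> 'w) bf_op"
  assumes "smooth_manifold M"
    and "supervector_bundle M E"
    and "graded_connection M E nabla"
  shows "\<forall>\<sigma>\<in>bundle_forms M E.
     superconnection_curvature (assoc_superconnection M nabla) \<sigma> =
       bf_scale M E (1/2) (graded_curvature M E nabla (ext_d M) (ext_d M) \<sigma>)"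
proof
  fix \<sigma> assume \<sigma>: "\<sigma> \<in> bundle_forms M E"
  note M = assms(1)
  let ?d = "ext_d M" and ?R = "tensor_rel M E" and ?L = "lists (forms M \<times> sections M E)"
  have d: "?d \<in> Der M" by (rule ext_d_in_Der[OF M])
  have mapsto: "nabla ?d X \<in> bundle_forms M E" if "X \<in> bundle_forms M E" for X
    using assms(3)[unfolded graded_connection_def, THEN conjunct1, THEN bspec, OF d, THEN conjunct1] that
    by (rule funcset_mem)
  have lmul: "nabla (der_lmul M 0 ?d) \<sigma> = bf_lmul M E 0 (nabla ?d \<sigma>)"
    using assms(3)[unfolded graded_connection_def, THEN conjunct2, THEN conjunct2, THEN conjunct1]
      d \<sigma> zero_in_forms[OF M] by blast
  \<comment> \<open>\<open>xs\<close> serves the bracket term, while \<open>ys\<close> below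
    represents the left-hand side of the claim.\<close>
  obtain xs where xs: "xs \<in> ?L" "nabla ?d \<sigma> = ?R `` {xs}"
    using mapsto[OF \<sigma>] unfolding bundle_forms_def by (rule quotientE)
  obtain ys where ys: "ys \<in> ?L" "nabla ?d (nabla ?d \<sigma>) = ?R `` {ys}"
    using mapsto[OF mapsto[OF \<sigma>]] unfolding bundle_forms_def by (rule quotientE)
  have bracket: "nabla (der_bracket M ?d ?d) \<sigma> = ?R `` {[]}"
    by (simp add: der_bracket_ext_d[OF M] lmul xs bf_lmul_zero_class[OF M])
  have deg: "der_deg M ?d = 1"
    using ext_d_in_der_par[OF M] by (simp add: der_deg_def)
  note S = scale_list_in_lists[OF M] bf_scale_class[OF M] bf_add_class
  \<comment> \<open>Two factors -1 meet on the second summand, one from the odd degree of d and one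
    from \<open>bf_minus\<close>. They cancel, so the graded commutator is the class of ys added to
    itself.\<close>
  have neg: "scale_list (-1) (scale_list (-1) ys) = ys"
    by (simp add: scale_form_def case_prod_unfold comp_def)
  have "graded_curvature M E nabla ?d ?d \<sigma> = ?R `` {ys @ ys}"
    using S(3)[OF ys(1) S(1)[OF S(1)[OF ys(1)]], of "-1" "-1"] S(3)[of "ys @ ys" M E "[]"] ys(1)
    by (simp add: graded_curvature_def bf_minus_def bracket deg ys S(1) S(2)[OF ys(1)]
        S(2)[OF S(1)[OF ys(1)]] S(2)[of "[]"] neg del: map_map)
  also have "bf_scale M E (1/2) \<dots> = ?R `` {scale_list (1/2) ys @ scale_list (1/2) ys}"
    using S(2)[of "ys @ ys"] ys(1) by simp
  also have "\<dots> = ?R `` {ys}"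
    by (rule tensor_rel_class_eq[OF tensor_rel_halves[OF M ys(1)]])
  finally show "superconnection_curvature (assoc_superconnection M nabla) \<sigma> =
      bf_scale M E (1/2) (graded_curvature M E nabla ?d ?d \<sigma>)"
    by (simp add: superconnection_curvature_def assoc_superconnection_def ys)
qed

end
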